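(* Let $z(\hbar_{\mathrm{ren}})=z_{\varphi_c\psi_c\bar\psi_c}(\hbar_{\mathrm{ren}})$ be the vertex renormalization constant of zero-dimensional Yukawa theory. There are real numbers $c_0,c_1,\dots$ such that for every $R\ge0$, as $n\to\infty$, $$[\hbar_{\mathrm{ren}}^n]\big(1-z(\hbar_{\mathrm{ren}})\big)=e^{-\frac72}\sum_{k=0}^{R-1}c_k\,(2n+3-2k)!!+\mathcal{O}\big((2n+3-2R)!!\big),$$ with $c_0=1$, $c_1=-\frac{15}{2}$, $c_2=-\frac{97}{8}$, $c_3=-\frac{1935}{16}$; equivalently, $$[\hbar_{\mathrm{ren}}^n](1-z)\sim e^{-\frac72}(2n+3)!!\left(1-\frac{15}{2}\frac{1}{2n+3}-\frac{97}{8}\frac{1}{(2n+1)(2n+3)}-\frac{1935}{16}\frac{1}{(2n-1)(2n+1)(2n+3)}+\cdots\right).$$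
   Context: Let $\chi(\hbar)=\sum_{n\ge0}(2n-1)!!\,\hbar^n$ with $(-1)!!=1$. The free energy of zero-dimensional Yukawa theory is, up to first order in $|\eta|^2=\eta\bar\eta$, $$W(\hbar,j,\eta)=\frac{j^2}{2}+\hbar\log\frac{1}{1-j-\frac{|\eta|^2}{\hbar}}+\hbar\log\chi\!\left(\frac{\hbar}{\left(1-j-\frac{|\eta|^2}{\hbar}\right)^2}\right)+\mathcal{O}(|\eta|^4).$$ Let $j_0(\hbar)=-\hbar+\cdots$ be the unique power series (without constant term) with $\partial_jW|_{\eta=0,\,j=j_0(\hbar)}=0$. The effective action is the Legendre transform $G(\hbar,\varphi_c,\psi_c)=W-j\varphi_c-\bar\eta\psi_c-\eta\bar\psi_c$ with $\varphi_c=\partial_jW$, $\psi_c=\partial_{\bar\eta}W$. Thus, at $\varphi_c=\psi_c=0$ (i.e. $j=j_0(\hbar)$, $\eta=0$), its derivatives are $G_{\varphi\varphi}=-\frac1{\partial_j^2W}$, $G_{\psi\bar\psi}=-\frac{1}{\partial_\eta\partial_{\bar\eta}W}$, $G_{\varphi\psi\bar\psi}=\frac{\partial_j\partial_\eta\partial_{\bar\eta}W}{\partial_j^2W\,(\partial_\eta\partial_{\bar\eta}W)^2}$, with the derivatives of $W$ evaluated at $j=j_0(\hbar)$, $\eta=0$; these are power series in $\hbar$. Renormalization: the squared invariant charge is $\alpha(\hbar)=\left(\frac{G_{\varphi\psi\bar\psi}}{(-G_{\varphi\varphi})^{1/2}(-G_{\psi\bar\psi})}\right)^2$; $\hbar(\hbar_{\mathrm{ren}})=\hbar_{\mathrm{ren}}+\cdots$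 is the unique power series with $\hbar_{\mathrm{ren}}=\hbar(\hbar_{\mathrm{ren}})\,\alpha(\hbar(\hbar_{\mathrm{ren}}))$; and $z_{\varphi_c\psi_c\bar\psi_c}(\hbar_{\mathrm{ren}})=1/G_{\varphi\psi\bar\psi}(\hbar(\hbar_{\mathrm{ren}}))=1-\hbar_{\mathrm{ren}}-3\hbar_{\mathrm{ren}}^2-13\hbar_{\mathrm{ren}}^3-\cdots$. *)

theory Defs
  imports
    "HOL-Computational_Algebra.Formal_Power_Series"
    "HOL-Library.Landau_Symbols"
begin

unbundle fps_syntax

fun dfact :: "nat \<Rightarrow> nat" where
  "dfact 0 = 1"
| "dfact (Suc 0) = 1"
| "dfact (Suc (Suc n)) = Suc (Suc n) * dfact n"

text \<open>Below, for \<open>n = 0\<close> the truncated subtraction gives \<open>dfact 0 = 1\<close>, the convention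
  \<open>(-1)!! = 1\<close>.\<close>

definition chi :: "real fps" where
  "chi = Abs_fps (\<lambda>n. real (dfact (2 * n - 1)))"

text \<open>
  The sources enter \<open>W\<close> through \<open>j\<close> and \<open>t = |\<eta>|\<^sup>2 / \<hbar>\<close>, and in terms of these \<open>W\<close> is a power
  series in \<open>\<hbar>, j, t\<close> without negative powers of \<open>\<hbar>\<close>. Such series are nested: the outermost
  variable is \<open>t\<close>, the middle one \<open>j\<close>, the innermost one \<open>\<hbar>\<close>, so that \<open>F $ a $ b $ c\<close> is the
  coefficient of \<open>t\<^sup>a j\<^sup>b \<hbar>\<^sup>c\<close>.
\<close>

type_synonym series3 = "real fps fps fps"

definition Hbar :: series3 where "Hbar = fps_const (fps_const fps_X)"
definition Jsrc :: series3 where "Jsrc = fps_const fps_X"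
definition Tsrc :: series3 where "Tsrc = fps_X"

text \<open>
  Substitution \<open>f(Y) = \<Sum>k. f\<^sub>k Y\<^sup>k\<close> of a trivariate series \<open>Y\<close> without constant term (that is,
  \<open>Y $ 0 $ 0 $ 0 = 0\<close>) into a univariate one. The powers \<open>Y\<^sup>k\<close> with \<open>k > a + b + c\<close> do not
  contribute to the coefficient of \<open>t\<^sup>a j\<^sup>b \<hbar>\<^sup>c\<close>. (The library composition would require the
  whole coefficient \<open>Y $ 0\<close> to vanish.)
\<close>

definition subst3 :: "real fps \<Rightarrow> series3 \<Rightarrow> series3" where
  "subst3 f Y = Abs_fps (\<lambda>a. Abs_fps (\<lambda>b. Abs_fps (\<lambda>c.
     \<Sum>k\<le>a + b + c. fps_nth f k * (Y ^ k) $ a $ b $ c)))"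

text \<open>Logarithm of a series with constant term 1; \<open>fps_ln 1\<close> is the series of \<open>log (1 + X)\<close>.\<close>

definition log3 :: "series3 \<Rightarrow> series3" where
  "log3 F = subst3 (fps_ln 1) (F - 1)"

definition Usrc :: series3 where
  "Usrc = 1 - Jsrc - Tsrc"

text \<open>The library inverse also yields the reciprocal here, although the coefficients do not form a
  field.\<close>

lemma Usrc_inverse: "Usrc * inverse Usrc = 1"
proof -
  have "Usrc $ 0 * inverse (Usrc $ 0) = 1"
    unfolding fps_inverse_def[of "Usrc $ 0"]
    by (rule fps_right_inverse) (simp add: Usrc_def Jsrc_def Tsrc_def)
  then show ?thesis
    unfolding fps_inverse_def[of Usrc] by (rule fps_right_inverse)
qed

text \<open>The free energy \<open>W\<close>; the terms of order \<open>|\<eta>|\<^sup>4\<close> left open by the expansion do not matter, since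
  only the coefficients of \<open>t\<^sup>0\<close> and \<open>t\<^sup>1\<close> are used below.\<close>

definition free_energy :: series3 where
  "free_energy = fps_const (fps_const (fps_const (1/2))) * Jsrc ^ 2
     + Hbar * log3 (inverse Usrc)
     + Hbar * log3 (subst3 chi (Hbar * inverse Usrc ^ 2))"

text \<open>Value of a series \<open>A\<close> in \<open>j\<close> (outer) and \<open>\<hbar>\<close> (inner) at \<open>j = y(\<hbar>)\<close>, for \<open>y\<close> without
  constant term.\<close>

definition at_j :: "real fps fps \<Rightarrow> real fps \<Rightarrow> real fps" where
  "at_j A y = Abs_fps (\<lambda>n. \<Sum>k\<le>n. (fps_nth A k * y ^ k) $ n)"

definition j_vac :: "real fps" where
  "j_vac = (THE j. j $ 0 = 0 \<and> at_j (fps_deriv (free_energy $ 0)) j = 0)"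

text \<open>
  Derivatives of \<open>W\<close> at \<open>j = j\<^sub>0(\<hbar>)\<close>, \<open>\<eta> = 0\<close>. For a function \<open>f\<close> of \<open>t = \<eta> \<eta>bar / \<hbar>\<close> the mixed
  derivative with respect to \<open>\<eta>\<close> and \<open>\<eta>bar\<close> at \<open>\<eta> = 0\<close> is \<open>f'(0) / \<hbar>\<close>, where \<open>f'(0)\<close> is
  \<open>fps_deriv _ $ 0\<close>. The division by \<open>\<hbar>\<close> is exact: \<open>\<hbar>\<close> divides the \<open>t\<close>-dependent part of \<open>W\<close>.
\<close>

definition W_jj :: "real fps" where
  "W_jj = at_j (fps_deriv (fps_deriv (free_energy $ 0))) j_vac"

definition W_ee :: "real fps" where
  "W_ee = at_j (fps_deriv free_energy $ 0) j_vac / fps_X"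

definition W_jee :: "real fps" where
  "W_jee = at_j (fps_deriv (fps_deriv free_energy $ 0)) j_vac / fps_X"

text \<open>Derivatives of the effective action, the Legendre transform of \<open>W\<close>, at
  \<open>\<phi>\<^sub>c = \<psi>\<^sub>c = 0\<close>, in terms of those of \<open>W\<close>.\<close>

definition G_phiphi :: "real fps" where
  "G_phiphi = - (1 / W_jj)"

definition G_psipsi :: "real fps" where
  "G_psipsi = - (1 / W_ee)"

definition G_phipsipsi :: "real fps" where
  "G_phipsipsi = W_jee / (W_jj * W_ee ^ 2)"

text \<open>Squared invariant charge; \<open>fps_radical root 2\<close> is the formal square root.\<close>

definition inv_charge :: "real fps" where
  "inv_charge = (G_phipsipsi / (fps_radical root 2 (- G_phiphi) * (- G_psipsi))) ^ 2"

definition hbar_of_ren :: "real fps" where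
  "hbar_of_ren = (THE h. h $ 0 = 0 \<and> h $ 1 = 1 \<and> fps_X = h * (inv_charge oo h))"

definition z_vertex :: "real fps" where
  "z_vertex = 1 / (G_phipsipsi oo hbar_of_ren)"

end

theory Submission
  imports Defs
begin

text \<open>
  Parametrise by \<open>x = \<hbar> / (1 - j\<^sub>0)\<^sup>2\<close>. The differential equation of \<open>\<chi>\<close> turns the vacuum condition into
  \<open>1 - j\<^sub>0 = \<chi>(x)\<close>, hence \<open>\<hbar> = x \<chi>(x)\<^sup>2\<close>. With \<open>Q = 1 - 1 / \<chi>\<close> and \<open>S = Q (1 - Q) / x - 1\<close> one gets
  \<open>\<hbar>\<^sub>r\<^sub>e\<^sub>n = x\<^sup>2 S\<^sup>2 / ((1 - Q) Q\<^sup>3)\<close> and \<open>z = S / \<hbar>\<^sub>r\<^sub>e\<^sub>n\<close>, so the coefficients of \<open>z\<close> follow by Lagrange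
  inversion from those of \<open>S\<close> and \<open>B = x / \<hbar>\<^sub>r\<^sub>e\<^sub>n = 1 - 7 x + \<dots>\<close>.

  Series whose coefficients have an expansion in shifted odd double factorials form a ring on which
  the map to the series of expansion coefficients is a derivation. In \<open>[x\<^sup>n] S' B\<^sup>n\<^sup>+\<^sup>1\<close> the factor
  \<open>(1 - 7 x)\<^sup>n\<^sup>+\<^sup>1\<close> of \<open>B\<^sup>n\<^sup>+\<^sup>1\<close> acts on such expansions by an exponential series and contributes \<open>e\<^sup>-\<^sup>7\<^sup>/\<^sup>2\<close>,
  while the remaining factor is \<open>1 + O(x\<^sup>2)\<close>, and its binomial series is again an expansion of the
  same kind. This gives existence and the leading coefficient. Applying the derivation to the
  first-order algebraic differential equation of \<open>z\<close> yields a linear equation that determines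
  the other coefficients.
\<close>

text \<open>Consecutive values of \<open>odf\<close> differ by a factor of order n, so in a
  convolution only the two ends matter; this is why expansions obey a product rule. The obstacle is
  Lagrange's formula: the exponent of B^(n+1) grows with the index, so no fixed product applies. It
  is overcome by the exact identity binom(m - 1/2, j) odf(m - j) = odf(m) / (2^j j!): multiplying by
  (1 + b x)^(m - 1/2) produces partial sums of exp(b/2), and b = -7 is the linear coefficient of B.
  The linear term of B has to be split off, because a factor x^2 lowers the order by two while the
  factor n from the binomial coefficient raises it by only one. Hence the i-th term of the remaining
  binomial series starts at order i, and each expansion coefficient is a finite sum. Only the
  leading one is evaluated in this way. The linear equation obtained from the differential equation
  is homogeneous, so it can give ratios to the leading coefficient but not that coefficient
  itself.\<close>

section \<open>Growth bounds by odd double factorials\<close>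

text \<open>\<open>odf m = (2 m - 1)!!\<close>, continued to negative \<open>m\<close> so that \<open>odf (m + 1) = (2 m + 1) odf m\<close> holds
  and \<open>odf\<close> never vanishes; no estimate then has to exclude small indices.\<close>

definition odf :: "int \<Rightarrow> real" where
  "odf m = (if m \<ge> 0 then (\<Prod>i<nat m. 2 * real i + 1)
            else 1 / (\<Prod>i<nat (- m). - (2 * real i + 1)))"

lemma odf_0 [simp]: "odf 0 = 1"
  by (simp add: odf_def)

lemma odf_plus_one: "odf (m + 1) = (2 * of_int m + 1) * odf m"
proof (cases "m \<ge> 0")
  case True
  then have "nat (m + 1) = Suc (nat m)" by simp
  then show ?thesis using True by (simp add: odf_def)
next
  case False
  then obtain k where k: "m = - int (Suc k)"
    by (metis negD not_le)
  let ?P = "\<Prod>i<k. - (2 * real i + 1)"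
  have "?P \<noteq> 0" by (auto simp: prod_zero_iff add_nonneg_eq_0_iff)
  have 1: "odf (m + 1) = 1 / ?P" by (cases "k = 0") (auto simp: odf_def k)
  have "nat (- m) = Suc k" "\<not> m \<ge> 0" by (auto simp: k)
  then have 2: "odf m = 1 / (?P * - (2 * real k + 1))" by (simp only: odf_def prod.lessThan_Suc if_False)
  have 3: "2 * of_int m + 1 = - (2 * real k + 1)" by (simp add: k)
  have "- (2 * real k + 1) \<noteq> 0" by (metis add_nonneg_eq_0_iff neg_equal_0_iff_equal of_nat_0_le_iff zero_le_mult_iff zero_le_numeral zero_le_one zero_neq_one)
  moreover have "1 / p = a * (1 / (p * a))" if "a \<noteq> 0" for a p :: real using that by simp
  ultimately show ?thesis unfolding 1 2 3 by blast
qed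

lemma odf_nonzero [simp]: "odf m \<noteq> 0"
  by (auto simp: odf_def prod_zero_iff add_nonneg_eq_0_iff)

lemma odf_pos: "m \<ge> 0 \<Longrightarrow> odf m > 0"
  by (auto simp: odf_def intro!: prod_pos add_nonneg_pos)

lemma odf_dfact: "odf (int m) = real (dfact (2 * m - 1))"
proof (induction m)
  case (Suc m)
  have "dfact (2 * Suc m - 1) = (2 * m + 1) * dfact (2 * m - 1)"
    by (cases m) auto
  then show ?case using Suc odf_plus_one[of "int m"] by (simp add: add.commute algebra_simps)
qed simp

lemma odd_abs_ge_1: "\<bar>2 * real_of_int m + 1\<bar> \<ge> 1"
proof -
  have "\<bar>2 * m + 1\<bar> \<ge> 1" by arith
  then have "real_of_int \<bar>2 * m + 1\<bar> \<ge> 1" by linarith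
  then show ?thesis by simp
qed

text \<open>Each step multiplies by an odd integer, whose modulus is at least 1, so monotonicity
  extends over the negative indices.\<close>

lemma odf_abs_mono: "m \<le> n \<Longrightarrow> \<bar>odf m\<bar> \<le> \<bar>odf n\<bar>"
proof (induction n rule: int_ge_induct)
  case (step n)
  have "1 * \<bar>odf n\<bar> \<le> \<bar>2 * real_of_int n + 1\<bar> * \<bar>odf n\<bar>"
    by (intro mult_right_mono odd_abs_ge_1) auto
  then have "\<bar>odf n\<bar> \<le> \<bar>odf (n + 1)\<bar>" by (simp only: odf_plus_one abs_mult mult_1)
  then show ?case using step.IH by linarith
qed simp

text \<open>The bound is demanded for all \<open>n\<close>, not just eventually. As
  \<open>odf\<close> has no zeros, a larger constant absorbs finitely many terms, so both versions
  agree (\<open>dominated_eventually\<close>).\<close>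

definition dominated :: "int \<Rightarrow> (nat \<Rightarrow> real) \<Rightarrow> bool" where
  "dominated s f \<longleftrightarrow> (\<exists>K. \<forall>n. \<bar>f n\<bar> \<le> K * \<bar>odf (int n + s)\<bar>)"

lemma dominatedI: "(\<And>n. \<bar>f n\<bar> \<le> K * \<bar>odf (int n + s)\<bar>) \<Longrightarrow> dominated s f"
  unfolding dominated_def by blast

lemma dominatedE:
  assumes "dominated s f"
  obtains K where "K > 0" "\<And>n. \<bar>f n\<bar> \<le> K * \<bar>odf (int n + s)\<bar>"
proof -
  obtain K where K: "\<And>n. \<bar>f n\<bar> \<le> K * \<bar>odf (int n + s)\<bar>"
    using assms unfolding dominated_def by blast
  have "\<bar>f n\<bar> \<le> max K 1 * \<bar>odf (int n + s)\<bar>" for n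
    by (rule order_trans[OF K]) (intro mult_right_mono, auto)
  then show ?thesis by (intro that[of "max K 1"]) auto
qed

lemma dominated_eventually:
  assumes "\<And>n. n \<ge> n0 \<Longrightarrow> \<bar>f n\<bar> \<le> K * \<bar>odf (int n + s)\<bar>"
  shows "dominated s f"
proof (rule dominatedI)
  fix n
  let ?q = "\<lambda>n. \<bar>f n\<bar> / \<bar>odf (int n + s)\<bar>"
  let ?K = "max K 0 + (\<Sum>i<n0. ?q i)"
  have q0: "(\<Sum>i<n0. ?q i) \<ge> 0" by (intro sum_nonneg) auto
  show "\<bar>f n\<bar> \<le> ?K * \<bar>odf (int n + s)\<bar>"
  proof (cases "n < n0")
    case True
    have "?q n \<le> (\<Sum>i<n0. ?q i)" by (rule member_le_sum) (use True in auto)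
    then have "?q n \<le> ?K" by linarith
    then show ?thesis by (simp add: field_simps)
  next
    case False
    then have "\<bar>f n\<bar> \<le> K * \<bar>odf (int n + s)\<bar>" using assms by simp
    also have "\<dots> \<le> ?K * \<bar>odf (int n + s)\<bar>" by (intro mult_right_mono) (use q0 in auto)
    finally show ?thesis .
  qed
qed

lemma dominated_mono: "dominated s f \<Longrightarrow> s \<le> t \<Longrightarrow> dominated t f"
proof -
  assume a: "dominated s f" "s \<le> t"
  from a(1) obtain K where K: "K > 0" "\<And>n. \<bar>f n\<bar> \<le> K * \<bar>odf (int n + s)\<bar>" by (rule dominatedE) blast
  show "dominated t f"
  proof (rule dominatedI)
    fix n show "\<bar>f n\<bar> \<le> K * \<bar>odf (int n + t)\<bar>"
      by (rule order_trans[OF K(2)]) (use K(1) a(2) in \<open>auto intro!: mult_left_mono odf_abs_mono\<close>)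
  qed
qed

lemma dominated_zero [simp]: "dominated s (\<lambda>_. 0)"
  by (rule dominatedI[of _ 0]) simp

lemma dominated_add:
  assumes "dominated s f" "dominated s g"
  shows "dominated s (\<lambda>n. f n + g n)"
proof -
  obtain K where K: "\<And>n. \<bar>f n\<bar> \<le> K * \<bar>odf (int n + s)\<bar>" using assms(1) unfolding dominated_def by blast
  obtain L where L: "\<And>n. \<bar>g n\<bar> \<le> L * \<bar>odf (int n + s)\<bar>" using assms(2) unfolding dominated_def by blast
  show ?thesis
  proof (rule dominatedI)
    fix n show "\<bar>f n + g n\<bar> \<le> (K + L) * \<bar>odf (int n + s)\<bar>"
      using K[of n] L[of n] abs_triangle_ineq[of "f n" "g n"] by (simp add: distrib_right)
  qed
qed

lemma dominated_cmult:
  assumes "dominated s f"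
  shows "dominated s (\<lambda>n. c * f n)"
proof -
  obtain K where K: "\<And>n. \<bar>f n\<bar> \<le> K * \<bar>odf (int n + s)\<bar>" using assms(1) unfolding dominated_def by blast
  show ?thesis
    by (rule dominatedI[of _ "\<bar>c\<bar> * K"]) (use K in \<open>auto simp: abs_mult mult.assoc intro!: mult_left_mono\<close>)
qed

lemma dominated_minus: "dominated s f \<Longrightarrow> dominated s (\<lambda>n. - f n)"
  using dominated_cmult[of s f "-1"] by simp

lemma dominated_diff: "dominated s f \<Longrightarrow> dominated s g \<Longrightarrow> dominated s (\<lambda>n. f n - g n)"
  using dominated_add[of s f "\<lambda>n. - g n"] dominated_minus[of s g] by simp

lemma dominated_sum: "(\<And>i. i \<in> A \<Longrightarrow> dominated s (f i)) \<Longrightarrow> dominated s (\<lambda>n. \<Sum>i\<in>A. f i n)"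
  by (induction A rule: infinite_finite_induct) (auto intro: dominated_add)

lemma dominated_eventually_eq:
  assumes "dominated s f" "\<And>n. n \<ge> n0 \<Longrightarrow> g n = f n"
  shows "dominated s g"
proof -
  obtain K where K: "\<And>n. \<bar>f n\<bar> \<le> K * \<bar>odf (int n + s)\<bar>" using assms(1) unfolding dominated_def by blast
  show ?thesis by (rule dominated_eventually[of n0 _ K]) (use assms(2) K in auto)
qed

lemma dominated_finite: "(\<And>n. n \<ge> n0 \<Longrightarrow> f n = 0) \<Longrightarrow> dominated s f"
  by (rule dominated_eventually_eq[of s "\<lambda>_. 0" n0]) auto

lemma dominated_odf: "dominated s (\<lambda>n. odf (int n + s))"
  by (rule dominatedI[of _ 1]) simp

lemma dominated_n_mult:
  assumes "dominated s f"
  shows "dominated (s + 1) (\<lambda>n. real n * f n)"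
proof -
  obtain K where K: "K > 0" "\<And>n. \<bar>f n\<bar> \<le> K * \<bar>odf (int n + s)\<bar>" using assms(1) by (rule dominatedE) blast
  have n: "real n \<le> (1 + \<bar>real_of_int s\<bar>) * \<bar>2 * real_of_int (int n + s) + 1\<bar>" (is "_ \<le> _ * ?q") for n
  proof -
    have "real n \<le> \<bar>real_of_int (int n + s)\<bar> + \<bar>real_of_int s\<bar>" by simp
    also have "\<bar>real_of_int (int n + s)\<bar> \<le> ?q"
    proof -
      have "\<bar>int n + s\<bar> \<le> \<bar>2 * (int n + s) + 1\<bar>" by arith
      then have "real_of_int \<bar>int n + s\<bar> \<le> real_of_int \<bar>2 * (int n + s) + 1\<bar>" by linarith
      then show ?thesis by simp
    qed
    also have "\<bar>real_of_int s\<bar> \<le> \<bar>real_of_int s\<bar> * ?q"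
      using mult_left_mono[OF odd_abs_ge_1[of "int n + s"], of "\<bar>real_of_int s\<bar>"] by simp
    finally show ?thesis by (simp add: algebra_simps)
  qed
  show ?thesis
  proof (rule dominatedI)
    fix n
    have "\<bar>real n * f n\<bar> = real n * \<bar>f n\<bar>" by (simp add: abs_mult)
    also have "\<dots> \<le> ((1 + \<bar>real_of_int s\<bar>) * \<bar>2 * real_of_int (int n + s) + 1\<bar>) * (K * \<bar>odf (int n + s)\<bar>)"
      by (intro mult_mono n K) auto
    also have "\<dots> = ((1 + \<bar>real_of_int s\<bar>) * K) * \<bar>odf (int n + (s + 1))\<bar>"
      using odf_plus_one[of "int n + s"] by (simp add: abs_mult add.assoc mult_ac)
    finally show "\<bar>real n * f n\<bar> \<le> ((1 + \<bar>real_of_int s\<bar>) * K) * \<bar>odf (int n + (s + 1))\<bar>" .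
  qed
qed

lemma dominated_linear_mult: "dominated s f \<Longrightarrow> dominated (s + 1) (\<lambda>n. (real n + \<beta>) * f n)"
  using dominated_add[OF dominated_n_mult[of s f] dominated_mono[OF dominated_cmult[of s f \<beta>], of "s + 1"]]
  by (simp add: algebra_simps)

text \<open>The ratio of consecutive values of \<open>odf\<close> eventually exceeds any
  \<open>L\<close>, so such sequences lie in every class, whatever the shift.\<close>

lemma dominated_geometric:
  fixes L :: real
  assumes "\<And>n. \<bar>f n\<bar> \<le> K * L ^ n" "L \<ge> 0"
  shows "dominated s f"
proof -
  obtain n0 :: nat where n0: "real n0 \<ge> L + \<bar>real_of_int s\<bar> + 1" using real_arch_simple by blast
  define C where "C = L ^ n0 / \<bar>odf (int n0 + s)\<bar>"
  have C0: "C \<ge> 0" using assms(2) by (simp add: C_def)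
  have K0: "K \<ge> 0" using assms(1)[of 0] by simp
  have *: "L ^ n \<le> C * \<bar>odf (int n + s)\<bar>" if "n \<ge> n0" for n
    using that
  proof (induction n rule: dec_induct)
    case base then show ?case by (simp add: C_def)
  next
    case (step n)
    have L: "L \<le> \<bar>2 * real_of_int (int n + s) + 1\<bar>" using n0 step(1) by simp
    have "int (Suc n) + s = int n + s + 1" by simp
    then have o: "odf (int (Suc n) + s) = (2 * of_int (int n + s) + 1) * odf (int n + s)" by (simp only: odf_plus_one)
    have "L * L ^ n \<le> \<bar>2 * real_of_int (int n + s) + 1\<bar> * (C * \<bar>odf (int n + s)\<bar>)"
      by (intro mult_mono L step.IH) (use assms(2) in auto)
    then show ?case
      unfolding o abs_mult by (simp only: power_Suc mult_ac)
  qed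
  show ?thesis
  proof (rule dominated_eventually[of n0 _ "K * C"])
    fix n assume "n \<ge> n0"
    from mult_left_mono[OF *[OF this] K0] assms(1)[of n]
    show "\<bar>f n\<bar> \<le> K * C * \<bar>odf (int n + s)\<bar>" by (simp add: mult.assoc)
  qed
qed

lemma dominated_shift_right:
  assumes "dominated s f"
  shows "dominated (s - int k) (\<lambda>n. if n < k then 0 else f (n - k))"
proof -
  obtain K where K: "\<And>n. \<bar>f n\<bar> \<le> K * \<bar>odf (int n + s)\<bar>" using assms unfolding dominated_def by blast
  show ?thesis
  proof (rule dominated_eventually[of k _ K])
    fix n assume "n \<ge> k"
    then show "\<bar>if n < k then 0 else f (n - k)\<bar> \<le> K * \<bar>odf (int n + (s - int k))\<bar>"
      using K[of "n - k"] by (simp add: of_nat_diff algebra_simps)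
  qed
qed

lemma dominated_shift_left:
  assumes "dominated s f"
  shows "dominated (s + int k) (\<lambda>n. f (n + k))"
proof -
  obtain K where K: "\<And>n. \<bar>f n\<bar> \<le> K * \<bar>odf (int n + s)\<bar>" using assms unfolding dominated_def by blast
  show ?thesis
  proof (rule dominatedI[of _ K])
    fix n show "\<bar>f (n + k)\<bar> \<le> K * \<bar>odf (int n + (s + int k))\<bar>"
      using K[of "n + k"] by (simp add: algebra_simps)
  qed
qed

section \<open>Convolutions of odd double factorials\<close>

text \<open>Moving the arguments one step further apart trades the factor 2 (a - k) - 1 for the
  larger 2 (b + k) + 1. The second disjunct excludes negative arguments, where signs alternate, and
  lets the induction run over all \<open>k\<close>.\<close>

lemma odf_log_convex:
  assumes "0 \<le> a" "a \<le> b"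
  shows "odf a * odf b \<le> odf (a - int k) * odf (b + int k) \<or> a < int k"
proof (induction k)
  case (Suc k)
  show ?case
  proof (cases "a < int (Suc k)")
    case False
    then have IH: "odf a * odf b \<le> odf (a - int k) * odf (b + int k)" using Suc by simp
    have 1: "odf (a - int k) = (2 * of_int (a - int (Suc k)) + 1) * odf (a - int (Suc k))"
      using odf_plus_one[of "a - int (Suc k)"] by simp
    have 2: "odf (b + int (Suc k)) = (2 * of_int (b + int k) + 1) * odf (b + int k)"
      using odf_plus_one[of "b + int k"] by (simp add: add_ac)
    have p: "odf (a - int (Suc k)) > 0" "odf (b + int k) > 0" using False assms by (auto intro: odf_pos)
    have "(2 * of_int (a - int (Suc k)) + 1) * (odf (a - int (Suc k)) * odf (b + int k))
        \<le> (2 * of_int (b + int k) + 1) * (odf (a - int (Suc k)) * odf (b + int k))"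
      by (intro mult_right_mono) (use p assms in auto)
    then have "odf (a - int k) * odf (b + int k) \<le> odf (a - int (Suc k)) * odf (b + int (Suc k))"
      unfolding 1 2 by (simp only: mult_ac)
    then show ?thesis using IH by linarith
  qed simp
qed simp

lemma odf_conv_term:
  assumes "1 \<le> j" "j < n"
  shows "odf (int j + int s) * odf (int (n - j) + int s) \<le> odf (int s + 1) * odf (int n - 1 + int s)"
proof -
  have *: "odf (int i + int s) * odf (int l + int s) \<le> odf (int s + 1) * odf (int i + int l - 1 + int s)"
    if "1 \<le> i" "i \<le> l" for i l :: nat
    using odf_log_convex[of "int i + int s" "int l + int s" "i - 1"] that
    by (auto simp: of_nat_diff algebra_simps)
  show ?thesis
  proof (cases "j \<le> n - j")
    case True
    then show ?thesis using *[of j "n - j"] assms by (simp add: of_nat_diff)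
  next
    case False
    then show ?thesis using *[of "n - j" j] assms by (simp add: of_nat_diff mult.commute)
  qed
qed

text \<open>The two end terms give 2 odf(s) odf(n + s). Each of the n - 1 interior terms is at most
  odf(s + 1) odf(n - 1 + s), and the number n - 1 of them is absorbed by one step of
  \<open>odf\<close>.\<close>

lemma odf_conv_bound:
  obtains C where "C > 0"
    "\<And>n. (\<Sum>j\<le>n. odf (int j + int s) * odf (int (n - j) + int s)) \<le> C * odf (int n + int s)"
proof -
  define C where "C = odf (int s) * odf (int s) + 2 * odf (int s) + odf (int s + 1)"
  have pos: "odf (int i + int s) > 0" "odf (int s) > 0" "odf (int s + 1) > 0" for i
    by (auto intro: odf_pos)
  have "(\<Sum>j\<le>n. odf (int j + int s) * odf (int (n - j) + int s)) \<le> C * odf (int n + int s)" for n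
  proof (cases n)
    case 0
    have "odf (int s) \<le> C" using pos(2,3) by (simp add: C_def add_increasing)
    then have "odf (int s) * odf (int s) \<le> C * odf (int s)"
      by (rule mult_right_mono) (use pos(2) in simp)
    then show ?thesis using 0 by simp
  next
    case (Suc m)
    have S: "{..n} = insert 0 (insert n {1..<n})" using Suc by auto
    have "(\<Sum>j\<le>n. odf (int j + int s) * odf (int (n - j) + int s))
        = 2 * odf (int s) * odf (int n + int s)
          + (\<Sum>j\<in>{1..<n}. odf (int j + int s) * odf (int (n - j) + int s))"
      unfolding S using Suc by simp
    also have "(\<Sum>j\<in>{1..<n}. odf (int j + int s) * odf (int (n - j) + int s))
        \<le> (\<Sum>j\<in>{1..<n}. odf (int s + 1) * odf (int n - 1 + int s))"
      by (intro sum_mono odf_conv_term) auto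
    also have "\<dots> = odf (int s + 1) * (real m * odf (int m + int s))"
      using Suc by simp
    also have "\<dots> \<le> odf (int s + 1) * odf (int n + int s)"
    proof -
      have "real m * odf (int m + int s) \<le> (2 * of_int (int m + int s) + 1) * odf (int m + int s)"
        by (intro mult_right_mono) (use pos(1)[of m] in auto)
      also have "\<dots> = odf (int n + int s)" using odf_plus_one[of "int m + int s"] Suc by (simp add: add_ac)
      finally show ?thesis using pos by (intro mult_left_mono) auto
    qed
    finally have "(\<Sum>j\<le>n. odf (int j + int s) * odf (int (n - j) + int s))
      \<le> (2 * odf (int s) + odf (int s + 1)) * odf (int n + int s)" by (simp add: algebra_simps)
    also have "\<dots> \<le> C * odf (int n + int s)"
      by (intro mult_right_mono) (use pos in \<open>auto simp: C_def less_imp_le\<close>)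
    finally show ?thesis .
  qed
  moreover have "C > 0" using pos by (auto simp: C_def intro!: add_pos_pos)
  ultimately show ?thesis by (intro that[of C])
qed

lemma fps_mult_nth_abs_le:
  fixes f g :: "real fps"
  assumes "\<And>n. \<bar>f $ n\<bar> \<le> K * F n" "\<And>n. \<bar>g $ n\<bar> \<le> L * G n" "\<And>n. F n \<ge> 0" "K \<ge> 0"
  shows "\<bar>(f * g) $ n\<bar> \<le> K * L * (\<Sum>j\<le>n. F j * G (n - j))"
proof -
  have "\<bar>(f * g) $ n\<bar> \<le> (\<Sum>j\<le>n. \<bar>f $ j * g $ (n - j)\<bar>)"
    by (simp add: fps_mult_nth atLeast0AtMost)
  also have "\<dots> \<le> (\<Sum>j\<le>n. (K * F j) * (L * G (n - j)))"
    unfolding abs_mult by (intro sum_mono mult_mono assms) (use assms(3,4) in auto)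
  also have "\<dots> = K * L * (\<Sum>j\<le>n. F j * G (n - j))"
    by (simp add: sum_distrib_left mult_ac)
  finally show ?thesis .
qed

lemma dominated_mult:
  assumes "dominated (int s) (fps_nth f)" "dominated (int s) (fps_nth g)"
  shows "dominated (int s) (fps_nth (f * g))"
proof -
  obtain K where K: "K > 0" "\<And>n. \<bar>f $ n\<bar> \<le> K * \<bar>odf (int n + int s)\<bar>" using assms(1) by (rule dominatedE) blast
  obtain L where L: "L > 0" "\<And>n. \<bar>g $ n\<bar> \<le> L * \<bar>odf (int n + int s)\<bar>" using assms(2) by (rule dominatedE) blast
  obtain C where C: "C > 0"
    "\<And>n. (\<Sum>j\<le>n. odf (int j + int s) * odf (int (n - j) + int s)) \<le> C * odf (int n + int s)"
    using odf_conv_bound[of s] by blast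
  have pos: "\<bar>odf (int i + int s)\<bar> = odf (int i + int s)" for i using odf_pos[of "int i + int s"] by simp
  show ?thesis
  proof (rule dominatedI)
    fix n
    have "\<bar>(f * g) $ n\<bar> \<le> K * L * (\<Sum>j\<le>n. \<bar>odf (int j + int s)\<bar> * \<bar>odf (int (n - j) + int s)\<bar>)"
      by (rule fps_mult_nth_abs_le) (use K L in auto)
    also have "\<dots> \<le> K * L * (C * \<bar>odf (int n + int s)\<bar>)"
      unfolding pos by (intro mult_left_mono C) (use K L in auto)
    finally show "\<bar>(f * g) $ n\<bar> \<le> K * L * C * \<bar>odf (int n + int s)\<bar>" by simp
  qed
qed

section \<open>Asymptotic expansions in shifted odd double factorials\<close>

lemma fps_nth_ops:
  "fps_nth (f + g) = (\<lambda>n. f $ n + g $ n)" "fps_nth (h - k) = (\<lambda>n. h $ n - k $ n)"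
  "fps_nth (- k) = (\<lambda>n. - (k $ n))" "fps_nth (fps_shift i f) = (\<lambda>n. f $ (n + i))"
  for f g :: "'a::monoid_add fps" and h k :: "'b::group_add fps"
  by (auto simp: fun_eq_iff)

lemma dominated_X_power:
  assumes "dominated s (fps_nth f)"
  shows "dominated (s - int k) (fps_nth (fps_X ^ k * f))"
proof -
  have "fps_nth (fps_X ^ k * f) = (\<lambda>n. if n < k then 0 else f $ (n - k))"
    by (auto simp: fps_X_power_mult_nth)
  then show ?thesis using dominated_shift_right[OF assms, of k] by simp
qed

text \<open>Unlike \<open>dominated_mult\<close>, this covers every shift, including the negative
  ones that belong to remainders of high order.\<close>

lemma dominated_poly_mult:
  fixes p f :: "real fps"
  assumes "\<And>n. n \<ge> d \<Longrightarrow> p $ n = 0" "dominated s (fps_nth f)"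
  shows "dominated s (fps_nth (p * f))"
proof -
  have "p * f = (\<Sum>k<d. fps_const (p $ k) * (fps_X ^ k * f))"
  proof -
    have "p = (\<Sum>k<d. fps_const (p $ k) * fps_X ^ k)"
      by (rule fps_ext) (use assms(1) in \<open>auto simp: fps_sum_nth fps_X_power_nth if_distrib cong: if_cong\<close>)
    then have "p * f = (\<Sum>k<d. fps_const (p $ k) * fps_X ^ k) * f" by simp
    then show ?thesis by (simp add: sum_distrib_right mult.assoc)
  qed
  then have "fps_nth (p * f) = (\<lambda>n. \<Sum>k<d. p $ k * (fps_X ^ k * f) $ n)"
    by (auto simp: fps_sum_nth)
  moreover have "dominated s (fps_nth (fps_X ^ k * f))" for k
    by (rule dominated_mono[OF dominated_X_power[OF assms(2)]]) simp
  ultimately show ?thesis by (auto intro!: dominated_sum dominated_cmult)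
qed

lemma dominated_fps_add: "dominated s (fps_nth f) \<Longrightarrow> dominated s (fps_nth g) \<Longrightarrow> dominated s (fps_nth (f + g))"
  using dominated_add[of s "fps_nth f" "fps_nth g"] by (simp only: fps_nth_ops)

lemma dominated_fps_diff: "dominated s (fps_nth f) \<Longrightarrow> dominated s (fps_nth g) \<Longrightarrow> dominated s (fps_nth (f - g))"
  using dominated_diff[of s "fps_nth f" "fps_nth g"] by (simp only: fps_nth_ops)

lemma dominated_fps_minus: "dominated s (fps_nth f) \<Longrightarrow> dominated s (fps_nth (- f))"
  using dominated_minus[of s "fps_nth f"] by (simp only: fps_nth_ops)

text \<open>The model series of the scale: from index k on, the coefficients of x^k times it are the
  k-th scale function odf(n + 2 - k).\<close>

definition odf2 :: "real fps" where
  "odf2 = Abs_fps (\<lambda>n. odf (int n + 2))"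

lemma dominated_odf2: "dominated 2 (fps_nth odf2)"
  using dominated_odf[of 2] by (simp add: odf2_def Abs_fps_inverse)

text \<open>The coefficients are packed into a power series \<open>c\<close>, so that rules for
  expansions become identities of series. The scale starts at odf(n + 2) = (2 n + 3)!!, the growth
  claimed for z.\<close>

definition expands :: "(nat \<Rightarrow> real) \<Rightarrow> real fps \<Rightarrow> bool" where
  "expands a c \<longleftrightarrow>
     (\<forall>R. dominated (2 - int R) (\<lambda>n. a n - (\<Sum>k<R. c $ k * odf (int n + 2 - int k))))"

lemma expandsD:
  "expands a c \<Longrightarrow> dominated (2 - int R) (\<lambda>n. a n - (\<Sum>k<R. c $ k * odf (int n + 2 - int k)))"
  by (simp add: expands_def)

lemma expands_dominated: "expands a c \<Longrightarrow> dominated 2 a"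
  using expandsD[of a c 0] by simp

lemma expands_zero: "(\<And>s. dominated s a) \<Longrightarrow> expands a 0"
  by (simp add: expands_def)

lemma expands_add: "expands a c \<Longrightarrow> expands b d \<Longrightarrow> expands (\<lambda>n. a n + b n) (c + d)"
  unfolding expands_def
proof
  fix R
  assume a: "\<forall>R. dominated (2 - int R) (\<lambda>n. a n - (\<Sum>k<R. c $ k * odf (int n + 2 - int k)))"
    and b: "\<forall>R. dominated (2 - int R) (\<lambda>n. b n - (\<Sum>k<R. d $ k * odf (int n + 2 - int k)))"
  show "dominated (2 - int R) (\<lambda>n. a n + b n - (\<Sum>k<R. (c + d) $ k * odf (int n + 2 - int k)))"
    using dominated_add[OF a[rule_format, of R] b[rule_format, of R]]
    by (simp add: algebra_simps sum.distrib)
qed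

lemma expands_cmult: "expands a c \<Longrightarrow> expands (\<lambda>n. r * a n) (fps_const r * c)"
  unfolding expands_def
proof
  fix R
  assume a: "\<forall>R. dominated (2 - int R) (\<lambda>n. a n - (\<Sum>k<R. c $ k * odf (int n + 2 - int k)))"
  show "dominated (2 - int R) (\<lambda>n. r * a n - (\<Sum>k<R. (fps_const r * c) $ k * odf (int n + 2 - int k)))"
    using dominated_cmult[OF a[rule_format, of R], of r]
    by (simp add: algebra_simps sum_distrib_left)
qed

lemma expands_eventually_eq:
  assumes "expands a c" "\<And>n. n \<ge> n0 \<Longrightarrow> b n = a n"
  shows "expands b c"
  unfolding expands_def
proof
  fix R
  show "dominated (2 - int R) (\<lambda>n. b n - (\<Sum>k<R. c $ k * odf (int n + 2 - int k)))"
    by (rule dominated_eventually_eq[OF expandsD[OF assms(1), of R], of n0]) (simp add: assms(2))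
qed

text \<open>The first nonzero coefficient of the difference would force |2 (n + 1 - k) + 1|, the
  ratio of two consecutive scale functions, to stay bounded.\<close>

lemma expands_unique:
  assumes "expands a c" "expands a d"
  shows "c = d"
proof -
  define e where "e = c - d"
  have "expands (\<lambda>n. a n + (-1) * a n) (c + fps_const (-1) * d)"
    by (intro expands_add expands_cmult assms)
  moreover have "c + fps_const (-1) * d = e" unfolding e_def by (rule fps_ext) simp
  ultimately have e: "expands (\<lambda>_. 0) e" by simp
  have "e $ k = 0" for k
  proof (induction k rule: less_induct)
    case (less k)
    have "dominated (2 - int (Suc k)) (\<lambda>n. - (e $ k * odf (int n + 2 - int k)))"
      using expandsD[OF e, of "Suc k"] less by simp
    then obtain K where K: "\<And>n. \<bar>- (e $ k * odf (int n + 2 - int k))\<bar> \<le> K * \<bar>odf (int n + (2 - int (Suc k)))\<bar>"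
      unfolding dominated_def by blast
    have bd: "\<bar>e $ k\<bar> * \<bar>2 * (real n + 1 - real k) + 1\<bar> \<le> K" for n
    proof -
      have "odf (int n + 2 - int k) = (2 * (real n + 1 - real k) + 1) * odf (int n + (2 - int (Suc k)))"
        using odf_plus_one[of "int n + (2 - int (Suc k))"] by (simp add: algebra_simps)
      with K[of n] have "\<bar>e $ k\<bar> * \<bar>2 * (real n + 1 - real k) + 1\<bar> * \<bar>odf (int n + (2 - int (Suc k)))\<bar>
          \<le> K * \<bar>odf (int n + (2 - int (Suc k)))\<bar>" by (simp only: abs_mult abs_minus_cancel mult.assoc)
      then show ?thesis by (rule mult_right_le_imp_le) simp
    qed
    show "e $ k = 0"
    proof (rule ccontr)
      assume nz: "e $ k \<noteq> 0"
      obtain n :: nat where n: "real n > K / \<bar>e $ k\<bar> + real k" using reals_Archimedean2 by blast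
      have "K / \<bar>e $ k\<bar> < \<bar>2 * (real n + 1 - real k) + 1\<bar>" 
      proof -
        have "K / \<bar>e $ k\<bar> \<ge> 0"
          using order_trans[OF _ bd[of 0], of 0] by auto
        moreover define q where "q = K / \<bar>e $ k\<bar>"
        ultimately have "q \<ge> 0" "real n > q + real k" using n by simp_all
        then have "q < 2 * (real n + 1 - real k) + 1" by simp
        also have "\<dots> \<le> \<bar>2 * (real n + 1 - real k) + 1\<bar>" by (rule abs_ge_self)
        finally show ?thesis by (simp only: q_def)
      qed
      then have "K < \<bar>e $ k\<bar> * \<bar>2 * (real n + 1 - real k) + 1\<bar>" using nz by (simp add: field_simps)
      then show False using bd[of n] by linarith
    qed
  qed
  then have "e = 0" by (intro fps_ext) simp
  then show ?thesis by (simp add: e_def)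
qed

lemma poly_mult_odf2_nth:
  assumes "n \<ge> R"
  shows "(fps_cutoff R c * odf2) $ n = (\<Sum>k<R. c $ k * odf (int n + 2 - int k))"
proof -
  have "(fps_cutoff R c * odf2) $ n = (\<Sum>k\<le>n. (if k < R then c $ k else 0) * odf (int (n - k) + 2))"
    by (simp add: fps_mult_nth odf2_def atLeast0AtMost)
  also have "\<dots> = (\<Sum>k<R. c $ k * odf (int n + 2 - int k))"
    by (rule sum.mono_neutral_cong_right) (use assms in \<open>auto simp: of_nat_diff algebra_simps\<close>)
  finally show ?thesis .
qed

lemma expands_cutoff_iff:
  "expands (fps_nth f) c \<longleftrightarrow> (\<forall>R. dominated (2 - int R) (fps_nth (f - fps_cutoff R c * odf2)))"
proof -
  have "dominated (2 - int R) (\<lambda>n. f $ n - (\<Sum>k<R. c $ k * odf (int n + 2 - int k)))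
    \<longleftrightarrow> dominated (2 - int R) (fps_nth (f - fps_cutoff R c * odf2))" for R
    by (rule iffI; erule dominated_eventually_eq[of _ _ R]) (simp_all add: poly_mult_odf2_nth)
  then show ?thesis by (simp add: expands_def)
qed

text \<open>Any polynomial that agrees with \<open>c\<close> below order R can replace the
  truncation, since a multiple of x^R times \<open>odf2\<close> lies in class 2 - R. Products of
  truncations, whose degree may exceed R, can thus be used as they are.\<close>

lemma expands_by_fps:
  fixes f c :: "real fps"
  assumes "\<And>R. \<exists>p. (\<forall>k<R. p $ k = c $ k)
     \<and> (\<exists>d. \<forall>n\<ge>d. p $ n = 0) \<and> dominated (2 - int R) (fps_nth (f - p * odf2))"
  shows "expands (fps_nth f) c"
  unfolding expands_cutoff_iff
proof
  fix R
  obtain p d where p: "\<And>k. k < R \<Longrightarrow> p $ k = c $ k" "\<And>n. n \<ge> d \<Longrightarrow> p $ n = 0"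
    "dominated (2 - int R) (fps_nth (f - p * odf2))" using assms[of R] by blast
  define q where "q = fps_shift R p"
  have pq: "p = fps_cutoff R c + fps_X ^ R * q"
    by (rule fps_ext) (auto simp: q_def fps_X_power_mult_nth p)
  have "dominated 2 (fps_nth (q * odf2))"
    by (rule dominated_poly_mult[OF _ dominated_odf2, of d]) (simp add: q_def p)
  then have "dominated (2 - int R) (fps_nth (fps_X ^ R * (q * odf2)))" by (rule dominated_X_power)
  then have "dominated (2 - int R) (fps_nth ((f - p * odf2) + fps_X ^ R * (q * odf2)))"
    by (intro dominated_fps_add p)
  then show "dominated (2 - int R) (fps_nth (f - fps_cutoff R c * odf2))"
    by (simp add: pq algebra_simps)
qed

section \<open>The product rule for expansions\<close>

lemma fps_split: "f = fps_cutoff R f + fps_X ^ R * fps_shift R (f :: real fps)"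
  by (rule fps_ext) (auto simp: fps_X_power_mult_nth)

lemma dominated_cutoff: "dominated s (fps_nth (fps_cutoff R f))"
  by (rule dominated_finite[of R]) simp

text \<open>Write f = f_R + x^R F and g = g_R + x^R G with polynomials f_R, g_R. Then F, G and hence
  F G lie in class 2 + R, and x^(2R) lowers this to 2 - R; the difference in the claim is x^(2R) F G
  - f_R g_R.\<close>

lemma dominated_product:
  assumes "dominated 2 (fps_nth f)" "dominated 2 (fps_nth g)"
  shows "dominated (2 - int R) (fps_nth (f * g - (fps_cutoff R f * g + fps_cutoff R g * f)))"
proof -
  have s: "dominated (int (2 + R)) (fps_nth (fps_shift R h))" if "dominated 2 (fps_nth h)" for h :: "real fps"
    using dominated_shift_left[OF that, of R] by (simp only: fps_nth_ops of_nat_add of_nat_numeral)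
  let ?f = "fps_shift R f" and ?g = "fps_shift R g"
  have "dominated (int (2 + R) - int (R + R)) (fps_nth (fps_X ^ (R + R) * (?f * ?g)))"
    by (intro dominated_X_power dominated_mult s assms)
  then have "dominated (2 - int R) (fps_nth (fps_X ^ (R + R) * (?f * ?g)))" by simp
  moreover have "dominated (2 - int R) (fps_nth (fps_cutoff R f * fps_cutoff R g))"
    by (rule dominated_poly_mult[of R, OF _ dominated_cutoff]) simp
  ultimately have "dominated (2 - int R) (fps_nth (fps_X ^ (R + R) * (?f * ?g) - fps_cutoff R f * fps_cutoff R g))"
    by (rule dominated_fps_diff)
  also have "fps_X ^ (R + R) * (?f * ?g) - fps_cutoff R f * fps_cutoff R g
    = f * g - (fps_cutoff R f * g + fps_cutoff R g * f)"
  proof -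
    have "fps_X ^ R * ?f = f - fps_cutoff R f" "fps_X ^ R * ?g = g - fps_cutoff R g"
      using fps_split[of f R] fps_split[of g R] by (simp_all add: algebra_simps)
    moreover have "fps_X ^ (R + R) * (?f * ?g) = (fps_X ^ R * ?f) * (fps_X ^ R * ?g)"
      by (simp only: power_add mult_ac)
    ultimately have e: "fps_X ^ (R + R) * (?f * ?g) = (f - fps_cutoff R f) * (g - fps_cutoff R g)" by (simp only:)
    show ?thesis unfolding e by (simp add: algebra_simps)
  qed
  finally show ?thesis .
qed

lemma fps_mult_nth_cong:
  fixes f g :: "real fps"
  assumes "\<And>k. k < R \<Longrightarrow> f $ k = f' $ k" "\<And>k. k < R \<Longrightarrow> g $ k = g' $ k" "n < R"
  shows "(f * g) $ n = (f' * g') $ n"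
  using assms by (auto simp: fps_mult_nth intro!: sum.cong)

lemma fps_mult_finite_support:
  fixes p q :: "real fps"
  assumes "\<forall>n\<ge>d. p $ n = 0" "\<forall>n\<ge>e. q $ n = 0"
  shows "\<forall>n\<ge>d + e. (p * q) $ n = 0"
proof (intro allI impI)
  fix n assume n: "n \<ge> d + e"
  have "p $ i * q $ (n - i) = 0" for i
    by (cases "i < d") (use n assms in auto)
  then show "(p * q) $ n = 0" unfolding fps_mult_nth by (intro sum.neutral) blast
qed

text \<open>Modulo class 2 - R the product is f_R g + g_R f, so only polynomial multiples of the two
  given expansions remain.\<close>

lemma expands_mult:
  assumes "expands (fps_nth f) c" "expands (fps_nth g) d"
  shows "expands (fps_nth (f * g)) (f * d + g * c)"
proof (rule expands_by_fps)
  fix R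
  let ?t = "fps_cutoff R"
  let ?p = "?t f * ?t d + ?t g * ?t c"
  have df: "dominated 2 (fps_nth f)" and dg: "dominated 2 (fps_nth g)"
    using assms by (auto dest: expands_dominated)
  have "\<forall>k<R. ?p $ k = (f * d + g * c) $ k"
  proof (intro allI impI)
    fix k assume "k < R"
    then have "(?t f * ?t d) $ k = (f * d) $ k" "(?t g * ?t c) $ k = (g * c) $ k"
      by (auto intro!: fps_mult_nth_cong[of R])
    then show "?p $ k = (f * d + g * c) $ k" by simp
  qed
  moreover have fin: "\<forall>n\<ge>R + R. ?p $ n = 0"
    using fps_mult_finite_support[of R "?t f" R "?t d"] fps_mult_finite_support[of R "?t g" R "?t c"] by simp
  moreover have "dominated (2 - int R) (fps_nth (f * g - ?p * odf2))"
  proof -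
    have 1: "dominated (2 - int R) (fps_nth (?t f * (g - ?t d * odf2)))"
      by (rule dominated_poly_mult[of R]) (use assms in \<open>auto simp: expands_cutoff_iff simp del: fps_sub_nth\<close>)
    have 2: "dominated (2 - int R) (fps_nth (?t g * (f - ?t c * odf2)))"
      by (rule dominated_poly_mult[of R]) (use assms in \<open>auto simp: expands_cutoff_iff simp del: fps_sub_nth\<close>)
    have "f * g - ?p * odf2 = (f * g - (?t f * g + ?t g * f))
        + (?t f * (g - ?t d * odf2) + ?t g * (f - ?t c * odf2))"
      by (simp add: algebra_simps)
    then show ?thesis
      using dominated_fps_add[OF dominated_product[OF df dg, of R] dominated_fps_add[OF 1 2]] by (simp only:)
  qed
  ultimately show "\<exists>p. (\<forall>k<R. p $ k = (f * d + g * c) $ k)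
     \<and> (\<exists>d. \<forall>n\<ge>d. p $ n = 0) \<and> dominated (2 - int R) (fps_nth (f * g - p * odf2))"
    by blast
qed

lemma expands_fps_add: "expands (fps_nth f) c \<Longrightarrow> expands (fps_nth g) d \<Longrightarrow> expands (fps_nth (f + g)) (c + d)"
  using expands_add[of "fps_nth f" c "fps_nth g" d] by (simp only: fps_nth_ops)

lemma expands_fps_minus: "expands (fps_nth f) c \<Longrightarrow> expands (fps_nth (- f)) (- c)"
proof -
  assume "expands (fps_nth f) c"
  then have "expands (\<lambda>n. (-1) * f $ n) (fps_const (-1) * c)" by (rule expands_cmult)
  moreover have "fps_const (-1) * c = - c" by (rule fps_ext) simp
  ultimately show ?thesis by (simp add: fps_nth_ops)
qed

lemma expands_fps_diff: "expands (fps_nth f) c \<Longrightarrow> expands (fps_nth g) d \<Longrightarrow> expands (fps_nth (f - g)) (c - d)"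
  using expands_fps_add[of f c "- g" "- d"] expands_fps_minus[of g d] by simp

lemma expands_finite: "(\<And>n. n \<ge> d \<Longrightarrow> p $ n = 0) \<Longrightarrow> expands (fps_nth p) 0"
  by (intro expands_zero dominated_finite)

lemma expands_const: "expands (fps_nth (fps_const r)) 0"
  by (rule expands_finite[of 1]) simp

lemma expands_1: "expands (fps_nth 1) 0"
  using expands_const[of 1] by simp

lemma expands_numeral: "expands (fps_nth (numeral k)) 0"
  using expands_const[of "numeral k"] by (simp add: fps_numeral_fps_const)

lemma expands_X: "expands (fps_nth fps_X) 0"
  by (rule expands_finite[of 2]) (simp add: fps_X_def)

lemma expands_X_power: "expands (fps_nth (fps_X ^ k)) 0"
  by (rule expands_finite[of "Suc k"]) (simp add: fps_X_power_nth)

lemma expands_power: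
  assumes "expands (fps_nth f) c"
  shows "expands (fps_nth (f ^ n)) (of_nat n * f ^ (n - 1) * c)"
proof (induction n)
  case 0 then show ?case using expands_1 by (simp del: fps_one_nth)
next
  case (Suc n)
  have "f * (of_nat n * f ^ (n - 1) * c) + f ^ n * c = of_nat (Suc n) * f ^ (Suc n - 1) * c"
    by (cases n) (simp_all add: algebra_simps)
  then show ?case using expands_mult[OF assms Suc] by simp
qed

text \<open>The recursion from f g = 1 is estimated by induction with a constant K. Its interior sum
  is at most F K C odf(n + 1), which for n beyond F C is at most half of K odf(n + 2); the term f_n
  takes the other half.\<close>

lemma dominated_inverse:
  assumes "dominated 2 (fps_nth f)" "f $ 0 = (1::real)"
  shows "dominated 2 (fps_nth (inverse f))"
proof -
  define g where "g = inverse f"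
  obtain F where F: "F > 0" "\<And>n. \<bar>f $ n\<bar> \<le> F * \<bar>odf (int n + 2)\<bar>" using assms(1) by (rule dominatedE) blast
  \<comment> \<open>Shift 3 instead of 2: without its ends the convolution runs over n - 2 with both
    arguments raised by 1, and is bounded by C odf((n - 2) + 3) = C odf(n + 1).\<close>
  obtain C where C: "C > 0" "\<And>n. (\<Sum>j\<le>n. odf (int j + int 3) * odf (int (n - j) + int 3)) \<le> C * odf (int n + int 3)"
    using odf_conv_bound[of 3] by blast
  obtain n0 :: nat where n0: "real n0 > F * C" using reals_Archimedean2 by blast
  define K where "K = 2 * F + (\<Sum>i\<le>n0. \<bar>g $ i\<bar>)"
  have s0: "(\<Sum>i\<le>n0. \<bar>g $ i\<bar>) \<ge> 0" by (intro sum_nonneg) auto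
  have K: "K > 0" "2 * F \<le> K" using F(1) s0 unfolding K_def by linarith+
  have pos: "odf (int n + 2) \<ge> 1" "odf (int n + 3) \<ge> 1" for n
    using odf_abs_mono[of 0 "int n + 2"] odf_pos[of "int n + 2"] odf_abs_mono[of 0 "int n + 3"] odf_pos[of "int n + 3"] by auto
  have "\<bar>g $ n\<bar> \<le> K * odf (int n + 2)" for n
  proof (induction n rule: less_induct)
    case (less n)
    show ?case
    proof (cases "n \<le> n0")
      case True
      have "\<bar>g $ n\<bar> \<le> (\<Sum>i\<le>n0. \<bar>g $ i\<bar>)" by (rule member_le_sum) (use True in auto)
      also have "\<dots> \<le> K * 1" using F(1) by (simp add: K_def)
      also have "\<dots> \<le> K * odf (int n + 2)" by (intro mult_left_mono pos) (use K in auto)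
      finally show ?thesis .
    next
      case False
      then obtain m where m: "n = Suc (Suc m) \<or> n = Suc 0" by (metis nat.exhaust not_le le0)
      have fg: "f * g = 1" unfolding g_def by (rule inverse_mult_eq_1') (simp add: assms)
      have "(f * g) $ n = 0" using fg False by simp
      moreover have "(f * g) $ n = f $ 0 * g $ n + (\<Sum>k\<in>{1..n}. f $ k * g $ (n - k))"
        unfolding fps_mult_nth by (subst sum.atLeast_Suc_atMost) auto
      ultimately have gn: "g $ n = - (\<Sum>k\<in>{1..n}. f $ k * g $ (n - k))" using assms(2) by simp
      have g0: "g $ 0 = 1" by (simp add: g_def assms)
      have "{1..n} = insert n {1..<n}" using False by auto
      then have "\<bar>g $ n\<bar> = \<bar>f $ n + (\<Sum>k\<in>{1..<n}. f $ k * g $ (n - k))\<bar>" using gn g0 by simp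
      also have "\<dots> \<le> \<bar>f $ n\<bar> + (\<Sum>k\<in>{1..<n}. \<bar>f $ k * g $ (n - k)\<bar>)"
        by (rule order_trans[OF abs_triangle_ineq]) (intro add_left_mono sum_abs)
      also have "(\<Sum>k\<in>{1..<n}. \<bar>f $ k * g $ (n - k)\<bar>)
          \<le> (\<Sum>k\<in>{1..<n}. (F * odf (int k + 2)) * (K * odf (int (n - k) + 2)))"
        unfolding abs_mult
      proof (intro sum_mono mult_mono)
        fix k assume k: "k \<in> {1..<n}"
        show "\<bar>f $ k\<bar> \<le> F * odf (int k + 2)" using F(2)[of k] pos(1)[of k] by simp
        show "\<bar>g $ (n - k)\<bar> \<le> K * odf (int (n - k) + 2)" using less[of "n - k"] k by auto
      qed (use F(1) pos(1) in \<open>auto intro!: mult_nonneg_nonneg simp: order_trans[OF zero_le_one]\<close>)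
      also have "\<dots> = F * K * (\<Sum>k\<in>{1..<n}. odf (int k + 2) * odf (int (n - k) + 2))"
        by (simp add: sum_distrib_left mult_ac)
      also have "\<dots> \<le> F * K * (C * odf (int n + 1))"
      proof (cases "n = Suc 0")
        case True then show ?thesis using F(1) K(1) C(1) odf_pos[of 2] by (simp add: less_imp_le)
      next
        case False
        then have n: "n = Suc (Suc m)" using m by simp
        have "(\<Sum>k\<in>{1..<n}. odf (int k + 2) * odf (int (n - k) + 2))
            = (\<Sum>j\<le>m. odf (int j + int 3) * odf (int (m - j) + int 3))"
          by (rule sum.reindex_bij_witness[of _ Suc "\<lambda>k. k - 1"]) (auto simp: n of_nat_diff algebra_simps)
        also have "\<dots> \<le> C * odf (int m + int 3)" by (rule C)
        finally have "(\<Sum>k\<in>{1..<n}. odf (int k + 2) * odf (int (n - k) + 2)) \<le> C * odf (int n + 1)"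
          using n by (simp add: algebra_simps)
        then show ?thesis by (intro mult_left_mono) (use F(1) K(1) in auto)
      qed
      also have "\<dots> \<le> K / 2 * odf (int n + 2)"
      proof -
        have o: "odf (int n + 2) = (2 * real n + 3) * odf (int n + 1)"
          using odf_plus_one[of "int n + 1"] by (simp add: algebra_simps)
        have "F * C \<le> (2 * real n + 3) / 2" using n0 False by simp
        then have "(K * odf (int n + 1)) * (F * C) \<le> (K * odf (int n + 1)) * ((2 * real n + 3) / 2)"
          by (intro mult_left_mono) (use K(1) odf_pos[of "int n + 1"] in auto)
        then show ?thesis unfolding o by (simp add: algebra_simps)
      qed
      also have "\<bar>f $ n\<bar> \<le> K / 2 * odf (int n + 2)"
      proof -
        have "F * odf (int n + 2) \<le> K / 2 * odf (int n + 2)"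
          by (intro mult_right_mono) (use K(2) pos(1)[of n] in auto)
        moreover have "\<bar>odf (int n + 2)\<bar> = odf (int n + 2)" using pos(1)[of n] by simp
        ultimately show ?thesis using F(2)[of n] by linarith
      qed
      finally show ?thesis by simp
    qed
  qed
  then show ?thesis
    unfolding g_def[symmetric] by (intro dominatedI[of _ K]) (use pos(1) in \<open>smt (verit)\<close>)
qed

text \<open>By the product rule applied to f g = 1, the series f_R g + g_R f is itself a remainder.
  Multiplying by g_R and using that f_R g_R is 1 up to x^R solves this for g with main term -g_R^2
  f. Remainders are only ever multiplied by polynomials.\<close>

lemma expands_inverse:
  assumes "expands (fps_nth f) c" "f $ 0 = (1::real)"
  shows "expands (fps_nth (inverse f)) (- (inverse f ^ 2 * c))"
proof (rule expands_by_fps)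
  fix R
  let ?t = "fps_cutoff R" and ?g = "inverse f"
  let ?p = "- (?t ?g * ?t ?g * ?t c)"
  have df: "dominated 2 (fps_nth f)" using assms by (auto dest: expands_dominated)
  then have dg: "dominated 2 (fps_nth ?g)" using dominated_inverse assms by blast
  have fg: "f * ?g = 1" by (rule inverse_mult_eq_1') (simp add: assms)
  have a: "\<forall>k<R. ?p $ k = (- (?g ^ 2 * c)) $ k"
    by (auto simp: power2_eq_square intro!: fps_mult_nth_cong[of R])
  have fin: "\<forall>n\<ge>R + R + R. ?p $ n = 0"
    using fps_mult_finite_support[OF fps_mult_finite_support, of R "?t ?g" R "?t ?g" R "?t c"] by simp
  define q where "q = fps_shift R (?t f * ?t ?g)"
  have q: "?t f * ?t ?g = fps_cutoff R 1 + fps_X ^ R * q"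
  proof -
    have "fps_cutoff R (?t f * ?t ?g) = fps_cutoff R (f * ?g)"
      by (rule fps_ext) (auto intro!: fps_mult_nth_cong[of R])
    then show ?thesis using fps_split[of "?t f * ?t ?g" R] by (simp add: fg q_def)
  qed
  have qg: "dominated (2 - int R) (fps_nth (fps_X ^ R * (q * ?g)))"
  proof (rule dominated_X_power, rule dominated_poly_mult[OF _ dg, of "R + R"])
    fix n assume "n \<ge> R + R"
    then show "q $ n = 0" using fps_mult_finite_support[of R "?t f" R "?t ?g"] by (simp add: q_def)
  qed
  \<comment> \<open>\<open>fps_cutoff R 1\<close> is 1 except for R = 0, where it is 0.\<close>
  have c1: "dominated (2 - int R) (fps_nth (fps_cutoff R 1 * ?g - ?g))"
  proof (cases "R = 0")
    case True then show ?thesis using dominated_fps_minus[OF dg] by simp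
    qed (auto simp: fps_cutoff_one intro: dominated_finite)
  have pr: "dominated (2 - int R) (fps_nth (f * ?g - (?t f * ?g + ?t ?g * f)))"
    by (rule dominated_product[OF df dg])
  have "dominated (2 - int R) (fps_nth (1 :: real fps))" by (rule dominated_finite[of 1]) simp
  then have "dominated (2 - int R) (fps_nth (1 - (f * ?g - (?t f * ?g + ?t ?g * f))))"
    by (rule dominated_fps_diff[OF _ pr])
  then have e1: "dominated (2 - int R) (fps_nth (?t ?g * (?t f * ?g + ?t ?g * f)))"
    by (intro dominated_poly_mult[of R]) (simp_all add: fg)
  have e2: "dominated (2 - int R) (fps_nth (?t ?g * ?t ?g * (f - ?t c * odf2)))"
    using fps_mult_finite_support[of R "?t ?g" R "?t ?g"] assms(1)
    by (intro dominated_poly_mult[of "R + R"]) (auto simp: expands_cutoff_iff simp del: fps_sub_nth)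
  have "?g - ?p * odf2 = ?t ?g * (?t f * ?g + ?t ?g * f) - ?t ?g * ?t ?g * (f - ?t c * odf2)
     - fps_X ^ R * (q * ?g) - (fps_cutoff R 1 * ?g - ?g)"
  proof -
    have "?t ?g * (?t f * ?g) = (fps_cutoff R 1 + fps_X ^ R * q) * ?g" unfolding q[symmetric] by (simp add: mult_ac)
    then show ?thesis by (simp add: algebra_simps)
  qed
  then have "dominated (2 - int R) (fps_nth (?g - ?p * odf2))"
    using dominated_fps_diff[OF dominated_fps_diff[OF dominated_fps_diff[OF e1 e2] qg] c1] by (simp only:)
  then show "\<exists>p. (\<forall>k<R. p $ k = (- (?g ^ 2 * c)) $ k)
     \<and> (\<exists>d. \<forall>n\<ge>d. p $ n = 0) \<and> dominated (2 - int R) (fps_nth (?g - p * odf2))"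
    using a fin by blast
qed

text \<open>One factor n raises the order by one: n odf(m) = odf(m + 1) / 2 + (k - 5/2) odf(m) for m
  = n + 2 - k. The leading coefficient has to vanish, or the result would leave the scale.\<close>

lemma expands_linear_mult:
  assumes "expands a c" "c $ 0 = 0"
  shows "expands (\<lambda>n. (real n + \<beta>) * a n)
    (Abs_fps (\<lambda>k. c $ Suc k / 2 + (real k - 5 / 2 + \<beta>) * c $ k))"
  unfolding expands_def
proof
  fix R
  have 1: "dominated (2 - int R) (\<lambda>n. (real n + \<beta>) * (a n - (\<Sum>k<Suc R. c $ k * odf (int n + 2 - int k))))"
    using dominated_linear_mult[OF expandsD[OF assms(1), of "Suc R"], of \<beta>] by simp
  have 2: "dominated (2 - int R) (\<lambda>n. (real R - 5 / 2 + \<beta>) * c $ R * odf (int n + (2 - int R)))"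
    by (intro dominated_cmult dominated_odf)
  have "(real n + \<beta>) * (\<Sum>k<Suc R. c $ k * odf (int n + 2 - int k)) =
     (\<Sum>k<R. (c $ Suc k / 2 + (real k - 5 / 2 + \<beta>) * c $ k) * odf (int n + 2 - int k))
     + (real R - 5 / 2 + \<beta>) * c $ R * odf (int n + (2 - int R))" for n
  proof -
    have o: "(real n + \<beta>) * odf (int n + 2 - int k) =
       odf (int n + 3 - int k) / 2 + (real k - 5 / 2 + \<beta>) * odf (int n + 2 - int k)" for k
      using odf_plus_one[of "int n + 2 - int k"] by (simp add: field_simps)
    have "(real n + \<beta>) * (\<Sum>k<Suc R. c $ k * odf (int n + 2 - int k)) =
      (\<Sum>k<Suc R. c $ k * ((real n + \<beta>) * odf (int n + 2 - int k)))"
      by (simp only: sum_distrib_left mult.left_commute)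
    also have "\<dots> = (\<Sum>k<Suc R. c $ k / 2 * odf (int n + 3 - int k))
       + (\<Sum>k<Suc R. (real k - 5 / 2 + \<beta>) * c $ k * odf (int n + 2 - int k))"
      unfolding o by (simp only: distrib_left sum.distrib) (simp add: mult_ac)
    also have "(\<Sum>k<Suc R. c $ k / 2 * odf (int n + 3 - int k)) = (\<Sum>k<R. c $ Suc k / 2 * odf (int n + 2 - int k))"
      by (subst sum.lessThan_Suc_shift) (simp add: assms(2) algebra_simps)
    finally show ?thesis
      by (simp only: sum.lessThan_Suc sum.distrib distrib_right add_diff_eq add.assoc)
  qed
  then have eq: "(real n + \<beta>) * a n - (\<Sum>k<R. Abs_fps (\<lambda>k. c $ Suc k / 2 + (real k - 5 / 2 + \<beta>) * c $ k) $ k * odf (int n + 2 - int k))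
     = (real n + \<beta>) * (a n - (\<Sum>k<Suc R. c $ k * odf (int n + 2 - int k)))
      + (real R - 5 / 2 + \<beta>) * c $ R * odf (int n + (2 - int R))" for n
    by (simp only: right_diff_distrib fps_nth_Abs_fps)
  show "dominated (2 - int R) (\<lambda>n. (real n + \<beta>) * a n -
      (\<Sum>k<R. Abs_fps (\<lambda>k. c $ Suc k / 2 + (real k - 5 / 2 + \<beta>) * c $ k) $ k * odf (int n + 2 - int k)))"
    unfolding eq by (rule dominated_add[OF 1 2])
qed

text \<open>The n-th coefficient of x^2 f' is n - 1 times that of x f, whose expansion has no
  leading term. The weight x^2 is what keeps the derivative within the scale: f' alone gains two
  orders, one from the factor n and one from the index shift.\<close>

lemma expands_X2_deriv:
  assumes "expands (fps_nth f) c"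
  shows "expands (fps_nth (fps_X ^ 2 * fps_deriv f))
    (fps_const (1/2) * c + fps_X ^ 2 * fps_deriv c - fps_const (5/2) * (fps_X * c))"
proof -
  have "expands (fps_nth (fps_X * f)) (fps_X * c)"
    using expands_mult[OF expands_X assms] by simp
  from expands_linear_mult[OF this, of "-1"]
  have "expands (\<lambda>n. (real n + - 1) * (fps_X * f) $ n)
     (Abs_fps (\<lambda>k. (fps_X * c) $ Suc k / 2 + (real k - 5 / 2 + - 1) * (fps_X * c) $ k))" by simp
  moreover have "(\<lambda>n. (real n + - 1) * (fps_X * f) $ n) = fps_nth (fps_X ^ 2 * fps_deriv f)"
  proof
    fix n
    have e: "fps_X ^ 2 * fps_deriv f = fps_X * (fps_X * fps_deriv f)" by (simp only: power2_eq_square mult.assoc)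
    show "(real n + - 1) * (fps_X * f) $ n = (fps_X ^ 2 * fps_deriv f) $ n"
      unfolding e by (cases n; cases "n - 1") auto
  qed
  moreover have "Abs_fps (\<lambda>k. (fps_X * c) $ Suc k / 2 + (real k - 5 / 2 + - 1) * (fps_X * c) $ k)
     = fps_const (1/2) * c + fps_X ^ 2 * fps_deriv c - fps_const (5/2) * (fps_X * c)"
  proof (rule fps_ext)
    fix k show "Abs_fps (\<lambda>k. (fps_X * c) $ Suc k / 2 + (real k - 5 / 2 + - 1) * (fps_X * c) $ k) $ k
     = (fps_const (1/2) * c + fps_X ^ 2 * fps_deriv c - fps_const (5/2) * (fps_X * c)) $ k"
      by (cases k; cases "k - 1") (auto simp: fps_X_power_mult_nth numeral_2_eq_2 algebra_simps)
  qed
  ultimately show ?thesis by simp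
qed

lemma expands_shift:
  assumes "expands (fps_nth f) c" "c $ 0 = 0"
  shows "expands (fps_nth (fps_shift 1 f)) (fps_shift 1 c)"
  unfolding expands_def
proof
  fix R
  have "dominated (2 - int (Suc R) + int 1) (\<lambda>n. f $ (n + 1) - (\<Sum>k<Suc R. c $ k * odf (int (n + 1) + 2 - int k)))"
    using dominated_shift_left[OF expandsD[OF assms(1), of "Suc R"], of 1] by simp
  then show "dominated (2 - int R) (\<lambda>n. fps_shift 1 f $ n - (\<Sum>k<R. fps_shift 1 c $ k * odf (int n + 2 - int k)))"
    by (subst (asm) sum.lessThan_Suc_shift) (simp add: assms(2) algebra_simps)
qed

section \<open>Composition with a Moebius map\<close>

text \<open>The factors m - 1/2 - i of the binomial coefficient are halves of the odd numbers 2 (m -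
  i) - 1 by which \<open>odf\<close> decreases, so the product telescopes exactly.\<close>

lemma gbinomial_odf:
  "((of_int m - 1/2) gchoose j) * odf (m - int j) = odf m / (2 ^ j * fact j)"
proof (induction j)
  case (Suc j)
  have "odf (m - int j) = (2 * of_int (m - int (Suc j)) + 1) * odf (m - int (Suc j))"
    using odf_plus_one[of "m - int (Suc j)"] by simp
  then have o: "(2 * (of_int m - real j) - 1) * odf (m - int (Suc j)) = odf (m - int j)"
    by (simp add: algebra_simps)
  define G G' where "G = ((of_int m - 1/2 :: real) gchoose j)" and "G' = ((of_int m - 1/2 :: real) gchoose Suc j)"
  have "real (Suc j) * G' = (of_int m - 1/2 - real j) * G"
    unfolding G_def G'_def by (metis gbinomial_absorb_comp gbinomial_absorption)
  then have "2 * (real (Suc j) * G') * odf (m - int (Suc j)) = 2 * ((of_int m - 1/2 - real j) * G) * odf (m - int (Suc j))"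
    by (simp only:)
  then have "2 * (real (Suc j) * G') * odf (m - int (Suc j))
      = G * ((2 * (of_int m - real j) - 1) * odf (m - int (Suc j)))"
    by (simp add: algebra_simps)
  also have "\<dots> = odf m / (2 ^ j * fact j)" by (simp only: o Suc G_def)
  finally have e: "2 * (real (Suc j) * G') * odf (m - int (Suc j)) = odf m / (2 ^ j * fact j)" .
  have "g * o' = q / ((2 * p) * (r * f))" if "2 * (r * g) * o' = q / (p * f)" "r > 0" "p > 0" "f > 0"
    for g o' p q r f :: real
    using that by (simp add: field_simps)
  from this[OF e] show ?case unfolding G'_def[symmetric] by simp
qed simp

text \<open>The series (1 + b x)^a for real \<open>a\<close>; half-integer exponents are the ones
  that match \<open>gbinomial_odf\<close>.\<close>

definition bin :: "real \<Rightarrow> real \<Rightarrow> real fps" where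
  "bin b a = fps_binomial a oo (fps_const b * fps_X)"

lemma bin_nth: "bin b a $ n = b ^ n * (a gchoose n)"
  by (simp add: bin_def)

lemma bin_add: "bin b (a + c) = bin b a * bin b c"
  by (simp add: bin_def fps_binomial_add_mult fps_compose_mult_distrib)

lemma bin_0 [simp]: "bin b 0 = 1"
  by (simp add: bin_def)

lemma bin_power: "bin b a ^ n = bin b (real n * a)"
  by (induction n) (simp_all add: bin_add[symmetric] algebra_simps)

lemma abs_gbinomial_le: "\<bar>a gchoose n\<bar> \<le> (\<bar>a\<bar> + 1) ^ n" for a :: real
proof (induction n)
  case (Suc n)
  have e: "(a gchoose Suc n) = (a gchoose n) * ((a - real n) / (real n + 1))"
    by (simp add: gbinomial_prod_rev atLeast0_lessThan_Suc field_simps)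
  have "\<bar>(a - real n) / (real n + 1)\<bar> \<le> \<bar>a\<bar> + 1"
  proof -
    have "\<bar>a - real n\<bar> \<le> \<bar>a\<bar> + real n" using abs_triangle_ineq4[of a "real n"] by simp
    also have "\<dots> \<le> (\<bar>a\<bar> + 1) * (real n + 1)" by (simp add: algebra_simps)
    finally show ?thesis by (simp add: abs_divide pos_divide_le_eq)
  qed
  then show ?case unfolding e abs_mult power_Suc2 by (intro mult_mono Suc) auto
qed simp

lemma dominated_bin: "dominated s (fps_nth (bin b a))"
proof (rule dominated_geometric[of _ 1 "\<bar>b\<bar> * (\<bar>a\<bar> + 1)"])
  fix n
  show "\<bar>bin b a $ n\<bar> \<le> 1 * (\<bar>b\<bar> * (\<bar>a\<bar> + 1)) ^ n"
    using abs_gbinomial_le[of a n]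
    by (auto simp: bin_nth abs_mult power_abs power_mult_distrib intro!: mult_left_mono)
qed auto

lemma expands_bin: "expands (fps_nth (bin b a)) 0"
  by (intro expands_zero dominated_bin)

lemma partial_exp_le:
  assumes "x \<ge> (0 :: real)"
  shows "(\<Sum>j<n. x ^ j / fact j) \<le> exp x"
proof -
  obtain t where "exp x = (\<Sum>m<n. x ^ m / fact m) + exp t / fact n * x ^ n"
    using Maclaurin_exp_le[of x n] by blast
  moreover have "exp t / fact n * x ^ n \<ge> 0" using assms by simp
  ultimately show ?thesis by linarith
qed

text \<open>The exponents are matched so that each product of a binomial coefficient with the bound
  on \<open>e\<close> collapses by \<open>gbinomial_odf\<close> to a term of the exponential series.\<close>

lemma mult_bin_bound:
  assumes "\<And>k. \<bar>e $ k\<bar> \<le> K * \<bar>odf (int k + s)\<bar>" "K \<ge> 0"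
  shows "\<bar>(e * bin b (real n + of_int s - 1/2)) $ n\<bar> \<le> K * exp (\<bar>b\<bar> / 2) * \<bar>odf (int n + s)\<bar>"
proof -
  let ?a = "real n + of_int s - 1/2"
  have "\<bar>(e * bin b ?a) $ n\<bar> = \<bar>\<Sum>j\<le>n. bin b ?a $ j * e $ (n - j)\<bar>"
    by (subst mult.commute) (simp add: fps_mult_nth atLeast0AtMost)
  also have "\<dots> \<le> (\<Sum>j\<le>n. \<bar>bin b ?a $ j * e $ (n - j)\<bar>)" by (rule sum_abs)
  also have "\<dots> \<le> (\<Sum>j\<le>n. K * \<bar>odf (int n + s)\<bar> * ((\<bar>b\<bar> / 2) ^ j / fact j))"
  proof (rule sum_mono)
    fix j assume j: "j \<in> {..n}"
    have "\<bar>bin b ?a $ j * e $ (n - j)\<bar> \<le> \<bar>b\<bar> ^ j * \<bar>?a gchoose j\<bar> * (K * \<bar>odf (int (n - j) + s)\<bar>)"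
      unfolding abs_mult bin_nth power_abs by (intro mult_left_mono assms) auto
    also have "int (n - j) + s = int n + s - int j" using j by (simp add: of_nat_diff)
    also have "\<bar>b\<bar> ^ j * \<bar>?a gchoose j\<bar> * (K * \<bar>odf (int n + s - int j)\<bar>)
        = K * \<bar>b\<bar> ^ j * \<bar>(?a gchoose j) * odf (int n + s - int j)\<bar>" by (simp add: abs_mult)
    also have "(?a gchoose j) * odf (int n + s - int j) = odf (int n + s) / (2 ^ j * fact j)"
      using gbinomial_odf[of "int n + s" j] by simp
    also have "K * \<bar>b\<bar> ^ j * \<bar>odf (int n + s) / (2 ^ j * fact j)\<bar>
        = K * \<bar>odf (int n + s)\<bar> * ((\<bar>b\<bar> / 2) ^ j / fact j)"
      by (simp add: abs_mult power_divide)
    finally show "\<bar>bin b ?a $ j * e $ (n - j)\<bar> \<le> K * \<bar>odf (int n + s)\<bar> * ((\<bar>b\<bar> / 2) ^ j / fact j)" .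
  qed
  also have "\<dots> = K * \<bar>odf (int n + s)\<bar> * (\<Sum>j<Suc n. (\<bar>b\<bar> / 2) ^ j / fact j)"
    by (simp only: sum_distrib_left lessThan_Suc_atMost)
  also have "\<dots> \<le> K * \<bar>odf (int n + s)\<bar> * exp (\<bar>b\<bar> / 2)"
    by (intro mult_left_mono partial_exp_le) (use assms in auto)
  finally show ?thesis by (simp add: mult_ac)
qed

text \<open>Up to the exact powers of \<open>1 + b x\<close>, this is the action of \<open>(1 + b x)\<^sup>n\<close> in Lagrange's formula.
  The half-integer exponent is the one matching \<open>odf (n + 2)\<close>, the leading term of an expansion.\<close>

definition binconv :: "real \<Rightarrow> real fps \<Rightarrow> nat \<Rightarrow> real" where
  "binconv b f n = (f * bin b (real n + 3/2)) $ n"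

lemma bin_of_nat_finite: "n \<ge> Suc R \<Longrightarrow> bin b (real R) $ n = 0"
  by (simp add: bin_nth binomial_gbinomial[symmetric])

text \<open>For a remainder of class 2 - R the matching exponent is n + 3/2 - R. The surplus (1 + b
  x)^R is a polynomial and is moved to \<open>f\<close>.\<close>

lemma binconv_dominated:
  assumes "dominated (2 - int R) (fps_nth f)"
  shows "dominated (2 - int R) (binconv b f)"
proof -
  have "dominated (2 - int R) (fps_nth (bin b (real R) * f))"
    by (rule dominated_poly_mult[OF bin_of_nat_finite assms])
  then obtain K where K: "K > 0" "\<And>n. \<bar>(bin b (real R) * f) $ n\<bar> \<le> K * \<bar>odf (int n + (2 - int R))\<bar>"
    by (rule dominatedE) blast
  show ?thesis
  proof (rule dominatedI)
    fix n
    have "real n + 3/2 = real R + (real n + of_int (2 - int R) - 1/2)" by simp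
    then have "bin b (real n + 3/2) = bin b (real R + (real n + of_int (2 - int R) - 1/2))" by (simp only:)
    also have "\<dots> = bin b (real R) * bin b (real n + of_int (2 - int R) - 1/2)" by (rule bin_add)
    finally have "binconv b f n = ((bin b (real R) * f) * bin b (real n + of_int (2 - int R) - 1/2)) $ n"
      unfolding binconv_def by (simp only: mult_ac)
    then show "\<bar>binconv b f n\<bar> \<le> K * exp (\<bar>b\<bar> / 2) * \<bar>odf (int n + (2 - int R))\<bar>"
      using mult_bin_bound[OF K(2), where b = b and n = n] K(1) by simp
  qed
qed

lemma odf_le_fact: "\<bar>odf (int n)\<bar> \<le> 2 ^ n * fact n"
proof (induction n)
  case (Suc n)
  have "\<bar>odf (int (Suc n))\<bar> = (2 * real n + 1) * \<bar>odf (int n)\<bar>"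
    using odf_plus_one[of "int n"] by (simp add: abs_mult add.commute)
  also have "\<dots> \<le> (2 * real (Suc n)) * (2 ^ n * fact n)" by (intro mult_mono Suc) auto
  finally show ?case by (simp add: algebra_simps)
qed simp

text \<open>The tail of the exponential series is of size |x|^(n + 1) / (n + 1)!, which cancels the
  factorial in odf(n + 2) \<le> 2^(n + 2) (n + 2)!. What is left grows geometrically and lies in
  every class.\<close>

lemma dominated_exp_tail:
  "dominated s (\<lambda>n. odf (int n + 2) * (\<Sum>j\<le>n. x ^ j / fact j) - exp x * odf (int n + 2))"
proof (rule dominated_geometric[of _ "8 * \<bar>x\<bar> * exp \<bar>x\<bar>" "4 * \<bar>x\<bar>"])
  fix n
  obtain t where t: "\<bar>t\<bar> \<le> \<bar>x\<bar>"
    "exp x = (\<Sum>m<Suc n. x ^ m / fact m) + exp t / fact (Suc n) * x ^ Suc n"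
    using Maclaurin_exp_le[of x "Suc n"] by blast
  have "odf (int n + 2) * (\<Sum>j\<le>n. x ^ j / fact j) - exp x * odf (int n + 2)
     = odf (int n + 2) * - (exp t / fact (Suc n) * x ^ Suc n)"
    unfolding t(2) lessThan_Suc_atMost by (simp add: algebra_simps)
  then have "\<bar>odf (int n + 2) * (\<Sum>j\<le>n. x ^ j / fact j) - exp x * odf (int n + 2)\<bar>
     = \<bar>odf (int n + 2)\<bar> * (exp t / fact (Suc n) * \<bar>x\<bar> ^ Suc n)"
    by (simp add: abs_mult power_abs)
  also have "\<dots> \<le> (2 ^ (n + 2) * fact (n + 2)) * (exp \<bar>x\<bar> / fact (Suc n) * \<bar>x\<bar> ^ Suc n)"
    using odf_le_fact[of "n + 2"] t(1) unfolding of_nat_add of_nat_numeral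
    by (intro mult_mono divide_right_mono) auto
  also have "\<dots> = 4 * 2 ^ n * (real n + 2) * exp \<bar>x\<bar> * \<bar>x\<bar> ^ Suc n"
  proof -
    have "(2 ^ 2 * a * (b * f)) * (c / f * d) = 4 * a * b * c * d" if "f > 0" for a b c d f :: real
      using that by simp
    moreover have "fact (n + 2) = (real n + 2) * fact (Suc n)" by simp
    moreover have "(2::real) ^ (n + 2) = 2 ^ 2 * 2 ^ n" by simp
    ultimately show ?thesis by (simp only: fact_gt_zero)
  qed
  also have "\<dots> \<le> 4 * 2 ^ n * (2 * 2 ^ n) * exp \<bar>x\<bar> * \<bar>x\<bar> ^ Suc n"
  proof -
    have "real (n + 2) \<le> 2 * 2 ^ n" 
      by (induction n) auto
    then show ?thesis by (intro mult_right_mono mult_left_mono) auto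
  qed
  also have "\<dots> = 8 * \<bar>x\<bar> * exp \<bar>x\<bar> * (4 * \<bar>x\<bar>) ^ n"
  proof -
    have "(4::real) ^ n = 2 ^ n * 2 ^ n" by (simp add: power_mult_distrib[symmetric])
    then show ?thesis by (simp add: power_mult_distrib)
  qed
  finally show "\<bar>odf (int n + 2) * (\<Sum>j\<le>n. x ^ j / fact j) - exp x * odf (int n + 2)\<bar>
     \<le> 8 * \<bar>x\<bar> * exp \<bar>x\<bar> * (4 * \<bar>x\<bar>) ^ n" .
qed simp

lemma binconv_odf2:
  "(odf2 * bin b (real n + 3/2)) $ n = odf (int n + 2) * (\<Sum>j\<le>n. (b / 2) ^ j / fact j)"
proof -
  have "(odf2 * bin b (real n + 3/2)) $ n = (\<Sum>j\<le>n. bin b (real n + 3/2) $ j * odf2 $ (n - j))"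
    by (subst mult.commute) (simp add: fps_mult_nth atLeast0AtMost)
  also have "\<dots> = (\<Sum>j\<le>n. odf (int n + 2) * ((b / 2) ^ j / fact j))"
  proof (rule sum.cong[OF refl])
    fix j assume j: "j \<in> {..n}"
    have "((real n + 3/2) gchoose j) * odf (int (n - j) + 2) = odf (int n + 2) / (2 ^ j * fact j)"
      using gbinomial_odf[of "int n + 2" j] j by (simp add: of_nat_diff algebra_simps)
    then show "bin b (real n + 3/2) $ j * odf2 $ (n - j) = odf (int n + 2) * ((b / 2) ^ j / fact j)"
      by (simp add: bin_nth odf2_def mult.assoc power_divide)
  qed
  finally show ?thesis by (simp add: sum_distrib_left)
qed

text \<open>The factor (1 + b x)^(-k) lowers the exponent n + 3/2 in step with the index shift by
  x^k, so the case k = 0 recurs at index n - k. In the basis of powers of x / (1 + b x),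
  \<open>binconv\<close> is therefore diagonal up to negligible terms.\<close>

lemma dominated_binconv_moebius:
  "dominated s (\<lambda>n. binconv b ((fps_X * bin b (- 1)) ^ k * odf2) n - exp (b / 2) * odf (int n + 2 - int k))"
proof -
  let ?h = "\<lambda>n. odf (int n + 2) * (\<Sum>j\<le>n. (b / 2) ^ j / fact j) - exp (b / 2) * odf (int n + 2)"
  have "dominated s (\<lambda>n. if n < k then 0 else ?h (n - k))"
    using dominated_shift_right[OF dominated_exp_tail[of "s + int k" "b / 2"], of k] by simp
  then show ?thesis
  proof (rule dominated_eventually_eq[of _ _ k])
    fix n assume n: "n \<ge> k"
    have "bin b (real n + 3/2) = bin b (real k + (real (n - k) + 3/2))" using n by (simp add: of_nat_diff)
    also have "\<dots> = bin b (real k) * bin b (real (n - k) + 3/2)" by (rule bin_add)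
    finally have "bin b (- real k) * bin b (real n + 3/2)
        = (bin b (- real k) * bin b (real k)) * bin b (real (n - k) + 3/2)" by (simp only: mult.assoc)
    also have "bin b (- real k) * bin b (real k) = 1" by (simp add: bin_add[symmetric])
    finally have e: "bin b (- real k) * bin b (real n + 3/2) = bin b (real (n - k) + 3/2)" by simp
    have "(fps_X * bin b (- 1)) ^ k * odf2 * bin b (real n + 3/2)
       = fps_X ^ k * (odf2 * (bin b (- real k) * bin b (real n + 3/2)))"
      by (simp add: power_mult_distrib bin_power mult_ac)
    then have "binconv b ((fps_X * bin b (- 1)) ^ k * odf2) n = (odf2 * bin b (real (n - k) + 3/2)) $ (n - k)"
      unfolding binconv_def e using n by (simp only: fps_X_power_mult_nth not_less[symmetric] if_False)
    moreover have "int n + 2 - int k = int (n - k) + 2" using n by (simp add: of_nat_diff)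
    ultimately show "binconv b ((fps_X * bin b (- 1)) ^ k * odf2) n - exp (b / 2) * odf (int n + 2 - int k)
      = (if n < k then 0 else ?h (n - k))"
      unfolding binconv_odf2 using n by (simp only: not_less[symmetric] if_False)
  qed
qed

lemma fps_nth_power_eq_0: "m $ 0 = 0 \<Longrightarrow> n < k \<Longrightarrow> (m ^ k) $ n = (0 :: real)"
  by (rule startsby_zero_power_prefix[rule_format])

text \<open>The series \<open>c oo fps_inv m\<close> lists the coefficients of \<open>c\<close> in
  powers of the Moebius map m = x / (1 + b x). On each power \<open>binconv\<close> only multiplies
  by exp(b/2), and it preserves the class of the remainder.\<close>

lemma expands_binconv:
  fixes b :: real
  defines "m \<equiv> fps_X * bin b (- 1)"
  assumes "expands (fps_nth f) c"
  shows "expands (binconv b f) (fps_const (exp (b / 2)) * (c oo fps_inv m))"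
  unfolding expands_def
proof
  fix R
  define d where "d = c oo fps_inv m"
  have m: "m $ 0 = 0" "m $ Suc 0 = 1" by (auto simp: m_def bin_nth)
  have "d oo m = c oo (fps_inv m oo m)" 
    unfolding d_def by (rule fps_compose_assoc[symmetric]) (auto simp: m fps_inv_def)
  also have "fps_inv m oo m = fps_X" by (rule fps_inv) (auto simp: m)
  finally have dm: "d oo m = c" by simp
  \<comment> \<open>\<open>p\<close> need not be a polynomial, but it agrees with \<open>c\<close>
    below order R and its coefficients grow at most geometrically.\<close>
  define p where "p = (\<Sum>k<R. fps_const (d $ k) * m ^ k)"
  have pc: "p $ n = c $ n" if "n < R" for n
  proof -
    have "c $ n = (\<Sum>i\<le>n. d $ i * (m ^ i) $ n)"
      unfolding dm[symmetric] by (simp add: fps_compose_nth atLeast0AtMost)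
    also have "\<dots> = (\<Sum>k<R. d $ k * (m ^ k) $ n)"
      by (rule sum.mono_neutral_left) (use that fps_nth_power_eq_0[OF m(1)] in auto)
    finally show ?thesis by (simp add: p_def fps_sum_nth)
  qed
  have dp: "dominated s (fps_nth p)" for s
  proof -
    have "dominated s (fps_nth (m ^ k))" for k
      using dominated_X_power[OF dominated_bin[of "s + int k" b "- real k"], of k]
      by (simp add: m_def power_mult_distrib bin_power)
    then have "dominated s (\<lambda>n. \<Sum>k<R. d $ k * (m ^ k) $ n)" by (intro dominated_sum dominated_cmult) auto
    moreover have "fps_nth p = (\<lambda>n. \<Sum>k<R. d $ k * (m ^ k) $ n)" by (auto simp: p_def fps_sum_nth)
    ultimately show ?thesis by simp
  qed
  define h where "h = fps_shift R (fps_cutoff R c - p)"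
  have h: "fps_cutoff R c - p = fps_X ^ R * h"
    by (rule fps_ext) (auto simp: h_def fps_X_power_mult_nth pc)
  have "dominated (2 - int R) (fps_nth (fps_cutoff R c - p))" 
    by (intro dominated_fps_diff dp dominated_cutoff)
  then have "dominated 2 (fps_nth h)"
    using dominated_shift_left[of "2 - int R" "fps_nth (fps_cutoff R c - p)" R] unfolding h_def fps_nth_ops by simp
  then have "dominated 2 (fps_nth (h * odf2))"
    using dominated_mult[of 2 h odf2] dominated_odf2 by simp
  then have "dominated (2 - int R) (fps_nth (fps_X ^ R * (h * odf2)))" by (rule dominated_X_power)
  moreover have "dominated (2 - int R) (fps_nth (f - fps_cutoff R c * odf2))"
    using assms by (simp only: expands_cutoff_iff)
  ultimately have "dominated (2 - int R) (fps_nth ((f - fps_cutoff R c * odf2) + fps_X ^ R * (h * odf2)))"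
    by (intro dominated_fps_add)
  also have "(f - fps_cutoff R c * odf2) + fps_X ^ R * (h * odf2) = f - p * odf2"
    unfolding mult.assoc[symmetric] h[symmetric] by (simp add: algebra_simps)
  finally have "dominated (2 - int R) (binconv b (f - p * odf2))" by (rule binconv_dominated)
  moreover have "dominated (2 - int R) (\<lambda>n. \<Sum>k<R. d $ k * (binconv b (m ^ k * odf2) n
      - exp (b / 2) * odf (int n + 2 - int k)))"
    unfolding m_def by (intro dominated_sum dominated_cmult dominated_binconv_moebius)
  ultimately have "dominated (2 - int R) (\<lambda>n. binconv b (f - p * odf2) n +
     (\<Sum>k<R. d $ k * (binconv b (m ^ k * odf2) n - exp (b / 2) * odf (int n + 2 - int k))))"
    by (rule dominated_add)
  moreover have "binconv b (f - p * odf2) n +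
     (\<Sum>k<R. d $ k * (binconv b (m ^ k * odf2) n - exp (b / 2) * odf (int n + 2 - int k)))
    = binconv b f n - (\<Sum>k<R. (fps_const (exp (b / 2)) * d) $ k * odf (int n + 2 - int k))" for n
  proof -
    have "(p * odf2) * bin b (real n + 3/2) = (\<Sum>k<R. fps_const (d $ k) * ((m ^ k * odf2) * bin b (real n + 3/2)))"
      by (simp only: p_def sum_distrib_right mult.assoc)
    then have "((p * odf2) * bin b (real n + 3/2)) $ n = (\<Sum>k<R. d $ k * binconv b (m ^ k * odf2) n)"
      by (simp add: fps_sum_nth binconv_def)
    then have "binconv b (f - p * odf2) n = binconv b f n - (\<Sum>k<R. d $ k * binconv b (m ^ k * odf2) n)"
      by (simp add: binconv_def left_diff_distrib)
    then show ?thesis by (simp add: right_diff_distrib sum_subtractf mult_ac)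
  qed
  ultimately show "dominated (2 - int R)
     (\<lambda>n. binconv b f n - (\<Sum>k<R. (fps_const (exp (b / 2)) * (c oo fps_inv m)) $ k * odf (int n + 2 - int k)))"
    by (simp only: d_def)
qed

text \<open>\<open>fps_inv m\<close> is tangent to the identity, so the change of basis preserves
  the first nonzero coefficient. This suffices to follow the leading coefficient through
  \<open>expands_binconv\<close>.\<close>

lemma fps_compose_inv_leading:
  fixes c m :: "real fps"
  assumes "m $ 0 = 0" "m $ 1 = 1" "\<And>k. k < j \<Longrightarrow> c $ k = 0"
  shows "\<And>k. k < j \<Longrightarrow> (c oo fps_inv m) $ k = 0" "(c oo fps_inv m) $ j = c $ j"
proof -
  let ?i = "fps_inv m"
  have i0: "?i $ 0 = 0" by (simp add: fps_inv_def)
  have i1: "?i $ 1 = 1" using assms by (simp add: fps_inv_def)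
  have n: "(c oo ?i) $ k = (\<Sum>i\<le>k. c $ i * (?i ^ i) $ k)" for k
    by (simp add: fps_compose_nth atLeast0AtMost)
  show "(c oo ?i) $ k = 0" if "k < j" for k unfolding n
    by (rule sum.neutral) (use assms(3) that in auto)
  have "(\<Sum>i\<le>j. c $ i * (?i ^ i) $ j) = (\<Sum>i\<in>{j}. c $ i * (?i ^ i) $ j)"
    by (rule sum.mono_neutral_right) (use assms(3) in auto)
  also have "\<dots> = c $ j * (?i $ 1) ^ j" using startsby_zero_power_nth_same[OF i0] by simp
  finally show "(c oo ?i) $ j = c $ j" unfolding n i1 by simp
qed

section \<open>Lagrange inversion\<close>

lemma fps_compose_mult_nth:
  fixes a Y W :: "real fps"
  assumes "Y $ 0 = 0"
  shows "((a oo Y) * W) $ n = (\<Sum>i\<le>n. a $ i * (Y ^ i * W) $ n)"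
proof -
  have "(a oo Y) $ j = (\<Sum>i\<le>n. a $ i * (Y ^ i) $ j)" if "j \<le> n" for j
    unfolding fps_compose_nth atLeast0AtMost
    by (rule sum.mono_neutral_left) (use that fps_nth_power_eq_0[OF assms] in auto)
  then have "((a oo Y) * W) $ n = (\<Sum>j\<le>n. \<Sum>i\<le>n. a $ i * (Y ^ i) $ j * W $ (n - j))"
    by (simp add: fps_mult_nth atLeast0AtMost sum_distrib_right)
  also have "\<dots> = (\<Sum>i\<le>n. \<Sum>j\<le>n. a $ i * (Y ^ i) $ j * W $ (n - j))" by (rule sum.swap)
  finally show ?thesis by (simp add: fps_mult_nth atLeast0AtMost sum_distrib_left mult.assoc)
qed

text \<open>With z = \<open>H oo fps_inv Y\<close> one has H' = (z' o Y) Y', so it suffices that the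
  n-th coefficient of Y^i Y' B^(n+1) is 1 for i = n and 0 for i < n. This says that Y^(i-n-1) Y' has
  a residue only for a simple pole, written without negative powers by means of B = x / Y.\<close>

theorem lagrange_inversion:
  fixes H Y B :: "real fps"
  assumes "Y * B = fps_X" "B $ 0 \<noteq> 0"
  shows "real (Suc n) * (H oo fps_inv Y) $ Suc n = (fps_deriv H * B ^ Suc n) $ n"
proof -
  have "(Y * B) $ 0 = 0" using assms(1) by simp
  then have Y0: "Y $ 0 = 0" using assms(2) by simp
  have "(Y * B) $ 1 = 1" using assms(1) by simp
  then have Y1: "Y $ 1 * B $ 0 = 1" by (simp add: fps_mult_nth Y0)
  then have Y1': "Y $ 1 \<noteq> 0" by auto
  define z where "z = H oo fps_inv Y"
  have "z oo Y = H oo (fps_inv Y oo Y)"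
    unfolding z_def by (rule fps_compose_assoc[symmetric]) (auto simp: Y0 fps_inv_def)
  then have zY: "z oo Y = H" using fps_inv[OF Y0 Y1'] by simp
  have dH: "fps_deriv H = (fps_deriv z oo Y) * fps_deriv Y"
    unfolding zY[symmetric] by (rule fps_compose_deriv) (rule Y0)
  have "(fps_deriv H * B ^ Suc n) $ n = (\<Sum>i\<le>n. fps_deriv z $ i * (Y ^ i * (fps_deriv Y * B ^ Suc n)) $ n)"
    unfolding dH mult.assoc by (rule fps_compose_mult_nth[OF Y0])
  also have "\<dots> = (\<Sum>i\<in>{n}. fps_deriv z $ i * (Y ^ i * (fps_deriv Y * B ^ Suc n)) $ n)"
  proof (rule sum.mono_neutral_right)
    show "\<forall>i\<in>{..n} - {n}. fps_deriv z $ i * (Y ^ i * (fps_deriv Y * B ^ Suc n)) $ n = 0"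
    proof
    fix i assume "i \<in> {..n} - {n}"
    then have "i \<le> n" "i \<noteq> n" by auto
    then obtain m where m: "n = i + Suc m" by (auto simp: le_less dest!: less_imp_Suc_add)
    have "fps_deriv (Y * B) = 1" using assms(1) by simp
    then have d: "fps_deriv Y * B + Y * fps_deriv B = 1" by (simp add: algebra_simps)
    \<comment> \<open>The derivative of Y B = x, multiplied by B, expresses Y' B^2 through B
      alone.\<close>
    have "fps_deriv Y * B ^ 2 = (fps_deriv Y * B + Y * fps_deriv B) * B - (Y * B) * fps_deriv B"
      by (simp add: algebra_simps power2_eq_square)
    then have d': "fps_deriv Y * B ^ 2 = B - fps_X * fps_deriv B" unfolding d assms(1) by simp
    have "Y ^ i * (fps_deriv Y * B ^ Suc n) = (Y * B) ^ i * (B ^ m * (fps_deriv Y * B ^ 2))"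
      unfolding m by (simp add: power_mult_distrib power_add power2_eq_square mult_ac)
    also have "\<dots> = fps_X ^ i * (B ^ Suc m - fps_X * (B ^ m * fps_deriv B))"
      unfolding d' assms(1) by (simp add: algebra_simps)
    finally have "(Y ^ i * (fps_deriv Y * B ^ Suc n)) $ n = B ^ Suc m $ Suc m - (B ^ m * fps_deriv B) $ m"
      unfolding m by (simp add: fps_X_power_mult_nth)
    moreover have "B ^ Suc m $ Suc m = (B ^ m * fps_deriv B) $ m"
    proof -
      have "fps_deriv (B ^ Suc m) = fps_const (real (Suc m)) * (B ^ m * fps_deriv B)"
        by (subst fps_deriv_power) (simp only: diff_Suc_1 mult_ac)
      then have "fps_deriv (B ^ Suc m) $ m = real (Suc m) * (B ^ m * fps_deriv B) $ m"
        by (simp only: fps_mult_left_const_nth)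
      then show ?thesis by (simp only: fps_deriv_nth Suc_eq_plus1[symmetric]) simp
    qed
    ultimately show "fps_deriv z $ i * (Y ^ i * (fps_deriv Y * B ^ Suc n)) $ n = 0" by simp
    qed
  qed auto
  also have "\<dots> = real (Suc n) * z $ Suc n * (Y ^ n * (fps_deriv Y * B ^ Suc n)) $ n" by simp
  also have "Y ^ n * (fps_deriv Y * B ^ Suc n) = (Y * B) ^ n * (B * fps_deriv Y)"
    by (simp add: power_mult_distrib mult_ac)
  also have "\<dots> $ n = 1" unfolding assms(1) using Y1 by (simp add: fps_X_power_mult_nth mult.commute)
  finally show ?thesis by (simp add: z_def)
qed

section \<open>Estimates uniform in the number of factors\<close>

lemma odf_add_nat: "odf (x + int i) = odf x * (\<Prod>l<i. 2 * of_int (x + int l) + 1)"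
proof (induction i)
  case (Suc i)
  have "x + int (Suc i) = (x + int i) + 1" by simp
  then have "odf (x + int (Suc i)) = (2 * of_int (x + int i) + 1) * odf (x + int i)" by (simp only: odf_plus_one)
  then show ?case by (simp only: Suc prod.lessThan_Suc mult_ac)
qed simp

lemma fact_rev: "fact i = (\<Prod>l<i. real (i - l))"
proof -
  have "(\<Prod>l<i. real (i - l)) = (\<Prod>l\<in>{1..i}. real l)"
    by (rule prod.reindex_bij_witness[of _ "\<lambda>l. i - l" "\<lambda>l. i - l"]) auto
  then show ?thesis by (simp add: fact_prod)
qed

text \<open>Pairing the factors of \<open>i!\<close> in decreasing order with those of
  \<open>odf (m - i) / odf (m - 2 i)\<close> in increasing order makes each of the \<open>i\<close> products at least
  \<open>m / 2\<close>.\<close>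

lemma power_odf_bound:
  assumes "2 * i \<le> m"
  shows "real m ^ i / fact i * odf (int m - 2 * int i) \<le> 2 ^ i * odf (int m - int i)"
proof -
  define e where "e = m - 2 * i"
  have m: "m = 2 * i + e" using assms by (simp add: e_def)
  have "real m ^ i \<le> (\<Prod>l<i. 2 * real (i - l) * (2 * of_int (int e + int l) + 1))"
  proof (rule order_trans[OF eq_refl prod_mono[of "{..<i}" "\<lambda>_. real m"]], simp, intro conjI)
    fix l assume "l \<in> {..<i}"
    then obtain q where q: "i = l + Suc q" by (auto dest!: less_imp_Suc_add)
    have "m \<le> 2 * Suc q * (2 * (e + l) + 1)" unfolding m q by (simp add: algebra_simps)
    then have "real m \<le> real (2 * Suc q * (2 * (e + l) + 1))" by (simp only: of_nat_le_iff)
    then show "real m \<le> 2 * real (i - l) * (2 * of_int (int e + int l) + 1)" by (simp add: q algebra_simps)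
  qed simp
  also have "\<dots> = 2 ^ i * fact i * (\<Prod>l<i. 2 * of_int (int e + int l) + 1)"
    by (simp only: prod.distrib fact_rev prod_constant card_lessThan)
  finally have "real m ^ i / fact i \<le> 2 ^ i * (\<Prod>l<i. 2 * of_int (int e + int l) + 1)"
    by (simp add: pos_divide_le_eq mult_ac)
  then have "real m ^ i / fact i * odf (int e) \<le> 2 ^ i * (\<Prod>l<i. 2 * of_int (int e + int l) + 1) * odf (int e)"
    by (rule mult_right_mono) (use odf_pos[of "int e"] in simp)
  also have "\<dots> = 2 ^ i * odf (int e + int i)" unfolding odf_add_nat by (simp add: mult_ac)
  finally show ?thesis by (simp add: m algebra_simps)
qed

text \<open>Each of the i - I steps from m - i up to m - I multiplies by an odd number of size at
  least m, because m - i is at least m / 2.\<close>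

lemma odf_ratio_bound:
  assumes "I \<le> i" "2 * i \<le> m"
  shows "real m ^ (i - I) * odf (int m - int i) \<le> odf (int m - int I)"
proof -
  have "int m - int I = (int m - int i) + int (i - I)" using assms by (simp add: of_nat_diff)
  then have e: "odf (int m - int I) = odf (int m - int i) * (\<Prod>l<i - I. 2 * of_int (int m - int i + int l) + 1)"
    by (simp only: odf_add_nat)
  have "real m ^ (i - I) \<le> (\<Prod>l<i - I. 2 * of_int (int m - int i + int l) + 1)"
    by (rule order_trans[OF eq_refl prod_mono[of "{..<i - I}" "\<lambda>_. real m"]]) (use assms(2) in auto)
  then have "real m ^ (i - I) * odf (int m - int i) \<le> (\<Prod>l<i - I. 2 * of_int (int m - int i + int l) + 1) * odf (int m - int i)"
    by (rule mult_right_mono) (use odf_pos[of "int m - int i"] assms in simp)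
  then show ?thesis unfolding e by (simp only: mult.commute)
qed

text \<open>The bound may depend on \<open>i\<close> only through a geometric factor, since the
  binomial series to be estimated has a number of terms that grows with the index.\<close>

lemma dominated_power_bound:
  fixes g h :: "real fps"
  assumes "dominated (int s) (fps_nth g)" "dominated (int s) (fps_nth h)"
  obtains K L where "K > 0" "L > 0" "\<And>i n. \<bar>(g * h ^ i) $ n\<bar> \<le> K * L ^ i * odf (int n + int s)"
proof -
  have pos: "\<bar>odf (int i + int s)\<bar> = odf (int i + int s)" for i using odf_pos[of "int i + int s"] by simp
  obtain K where K: "K > 0" "\<And>n. \<bar>g $ n\<bar> \<le> K * \<bar>odf (int n + int s)\<bar>" using assms(1) by (rule dominatedE) blast
  obtain H where H: "H > 0" "\<And>n. \<bar>h $ n\<bar> \<le> H * \<bar>odf (int n + int s)\<bar>" using assms(2) by (rule dominatedE) blast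
  obtain C where C: "C > 0"
    "\<And>n. (\<Sum>j\<le>n. odf (int j + int s) * odf (int (n - j) + int s)) \<le> C * odf (int n + int s)"
    using odf_conv_bound[of s] by blast
  have "\<bar>(g * h ^ i) $ n\<bar> \<le> K * (H * C) ^ i * odf (int n + int s)" for i n
  proof (induction i arbitrary: n)
    case 0 then show ?case using K(2)[of n] by (simp add: pos)
  next
    case (Suc i)
    have "\<bar>((g * h ^ i) * h) $ n\<bar> \<le> K * (H * C) ^ i * H * (\<Sum>j\<le>n. odf (int j + int s) * odf (int (n - j) + int s))"
      by (rule fps_mult_nth_abs_le) (use Suc H[unfolded pos] K(1) C(1) odf_pos in \<open>auto simp: less_imp_le\<close>)
    also have "\<dots> \<le> K * (H * C) ^ i * H * (C * odf (int n + int s))"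
      by (intro mult_left_mono C) (use K H C in auto)
    finally show ?case by (simp add: mult_ac)
  qed
  then show ?thesis using K(1) H(1) C(1) by (intro that[of K "H * C"]) auto
qed

text \<open>Term i combines a binomial coefficient of size N^i / i! with a factor x^(2i), which
  lowers the order by 2 i. \<open>power_odf_bound\<close> converts N^i / i! back into i orders at
  the price of 2^i. \<open>odf_ratio_bound\<close> turns each order beyond I into a factor of size 1
  / N, so for large N the terms from I on are bounded by a geometric series of ratio 1/2.\<close>

lemma dominated_binomial_tail:
  fixes g \<sigma> :: "real fps" and b :: real
  assumes g: "dominated 4 (fps_nth g)" and sig: "dominated 4 (fps_nth \<sigma>)"
  defines "t \<equiv> \<lambda>i N. real (N - 1 choose i) * binconv b (g * (fps_X ^ 2 * \<sigma>) ^ i) N"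
  shows "dominated (4 - int I) (\<lambda>N. (\<Sum>i\<le>N - 1. t i N) - (\<Sum>i<I. t i N))"
proof -
  have s4: "dominated (int 4) (fps_nth (f * bin b a))" if "dominated 4 (fps_nth f)" for f a
    using that by (intro dominated_mult dominated_bin) auto
  \<comment> \<open>The exponent N + 3/2 has to become N + (4 - 2 i) - 1/2, the one matching class 4
    - 2 i. So (1 + b x)^2 is attached to every factor \<open>\<sigma>\<close> and (1 + b x)^(-2) to
    \<open>g\<close>.\<close>
  obtain K L where KL: "K > 0" "L > 0"
    "\<And>i n. \<bar>(g * bin b (- 2) * (\<sigma> * bin b 2) ^ i) $ n\<bar> \<le> K * L ^ i * odf (int n + int 4)"
    using dominated_power_bound[OF s4[OF g, of "-2"] s4[OF sig, of 2]] by blast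
  define E where "E = exp (\<bar>b\<bar> / 2)"
  have E: "E > 0" by (simp add: E_def)
  have X2: "(fps_X ^ 2 :: real fps) ^ i = fps_X ^ (2 * i)" for i by (simp only: power_mult)
  have zero: "binconv b (g * (fps_X ^ 2 * \<sigma>) ^ i) N = 0" if "N < 2 * i" for i N
  proof -
    have "g * (fps_X ^ 2 * \<sigma>) ^ i * bin b (real N + 3/2) = fps_X ^ (2 * i) * (g * \<sigma> ^ i * bin b (real N + 3/2))"
      by (simp only: power_mult_distrib X2 mult_ac)
    then show ?thesis unfolding binconv_def using that by (simp only: fps_X_power_mult_nth if_True)
  qed
  have bnd: "\<bar>binconv b (g * (fps_X ^ 2 * \<sigma>) ^ i) N\<bar> \<le> K * L ^ i * E * odf (int (N + 4) - 2 * int i)"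
    if "2 * i \<le> N" for i N
  proof -
    let ?e = "fps_X ^ (2 * i) * (g * bin b (- 2) * (\<sigma> * bin b 2) ^ i)"
    have e: "\<bar>?e $ k\<bar> \<le> K * L ^ i * \<bar>odf (int k + (4 - 2 * int i))\<bar>" for k
    proof (cases "k < 2 * i")
      case True then show ?thesis using KL(1,2) by (simp add: fps_X_power_mult_nth)
    next
      case False
      have "int (k - 2 * i) + int 4 = int k + (4 - 2 * int i)" using False by (simp add: of_nat_diff)
      then show ?thesis using False KL(3)[of i "k - 2 * i"] KL(1,2)
        by (simp only: fps_X_power_mult_nth if_False) (rule order_trans, assumption, intro mult_left_mono, auto)
    qed
    have p1: "bin b 2 ^ i = bin b (real i * 2)" by (rule bin_power)
    have "bin b (- 2) * bin b (real i * 2) * bin b (real N + of_int (4 - 2 * int i) - 1/2)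
       = bin b (- 2 + real i * 2 + (real N + of_int (4 - 2 * int i) - 1/2))" by (simp only: bin_add)
    also have "- 2 + real i * 2 + (real N + of_int (4 - 2 * int i) - 1/2) = real N + 3/2" by simp
    finally have p2: "bin b (real N + 3/2) = bin b (- 2) * bin b (real i * 2) * bin b (real N + of_int (4 - 2 * int i) - 1/2)" by simp
    have "g * (fps_X ^ 2 * \<sigma>) ^ i * bin b (real N + 3/2)
       = ?e * bin b (real N + of_int (4 - 2 * int i) - 1/2)"
      unfolding p2 power_mult_distrib p1 X2 by (simp only: mult_ac)
    then have "\<bar>binconv b (g * (fps_X ^ 2 * \<sigma>) ^ i) N\<bar> \<le> K * L ^ i * E * \<bar>odf (int N + (4 - 2 * int i))\<bar>"
      unfolding binconv_def E_def
      using mult_bin_bound[OF e, where b = b and n = N] KL(1,2) by (simp only: mult_nonneg_nonneg less_imp_le zero_le_power)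
    also have "\<bar>odf (int N + (4 - 2 * int i))\<bar> = odf (int (N + 4) - 2 * int i)"
      using odf_pos[of "int N + (4 - 2 * int i)"] that by (simp add: algebra_simps)
    finally show ?thesis .
  qed
  define \<Lambda> where "\<Lambda> = 2 * L"
  have \<Lambda>: "\<Lambda> > 0" using KL(2) by (simp add: \<Lambda>_def)
  obtain n0 :: nat where n0: "real n0 \<ge> 2 * \<Lambda>" using real_arch_simple by blast
  have tb: "\<bar>t i N\<bar> \<le> K * E * \<Lambda> ^ I * odf (int (N + 4) - int I) * (1 / 2) ^ (i - I)"
    if i: "I \<le> i" and N: "N \<ge> n0" "N > I" for i N
  proof (cases "2 * i \<le> N")
    case False
    then have "t i N = 0" using zero by (simp add: t_def)
    moreover have "odf (int (N + 4) - int I) > 0" using N by (intro odf_pos) simp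
    ultimately show ?thesis using KL(1) E \<Lambda> by simp
  next
    case True
    let ?m = "N + 4"
    have m: "real ?m \<ge> 2 * \<Lambda>" "2 * i \<le> ?m" using n0 N(1) True by auto
    have p: "odf (int ?m - 2 * int i) > 0" "odf (int ?m - int i) > 0" "odf (int ?m - int I) > 0"
      using True N by (auto intro!: odf_pos)
    have "real (N - 1 choose i) \<le> real ?m ^ i / fact i"
    proof -
      have "real ((N - 1 choose i) * fact i) \<le> real ((N - 1) ^ i)"
        using binomial_fact_pow[of "N - 1" i] by (simp only: of_nat_le_iff)
      then have "real (N - 1 choose i) * fact i \<le> real (N - 1) ^ i"
        by (simp only: of_nat_mult of_nat_fact of_nat_power)
      then have "real (N - 1 choose i) \<le> real (N - 1) ^ i / fact i"
        by (simp only: pos_le_divide_eq fact_gt_zero)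
      also have "\<dots> \<le> real ?m ^ i / fact i" by (intro divide_right_mono power_mono) auto
      finally show ?thesis .
    qed
    then have "\<bar>t i N\<bar> \<le> real ?m ^ i / fact i * (K * L ^ i * E * odf (int ?m - 2 * int i))"
      unfolding t_def abs_mult by (intro mult_mono) (use bnd[OF True] in auto)
    also have "\<dots> = K * E * L ^ i * (real ?m ^ i / fact i * odf (int ?m - 2 * int i))" by (simp add: mult_ac)
    also have "\<dots> \<le> K * E * L ^ i * (2 ^ i * odf (int ?m - int i))"
      by (intro mult_left_mono power_odf_bound m) (use KL(1,2) E in auto)
    also have "\<dots> = K * E * \<Lambda> ^ I * (\<Lambda> ^ (i - I) * odf (int ?m - int i))"
    proof -
      have "\<Lambda> ^ i = \<Lambda> ^ I * \<Lambda> ^ (i - I)" using i by (simp add: power_add[symmetric])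
      then show ?thesis by (simp add: \<Lambda>_def power_mult_distrib mult_ac)
    qed
    also have "\<dots> \<le> K * E * \<Lambda> ^ I * ((1/2) ^ (i - I) * odf (int ?m - int I))"
    proof (intro mult_left_mono)
      have "\<Lambda> ^ (i - I) \<le> (real ?m / 2) ^ (i - I)" using m(1) \<Lambda> by (intro power_mono) auto
      then have "\<Lambda> ^ (i - I) * odf (int ?m - int i) \<le> (real ?m / 2) ^ (i - I) * odf (int ?m - int i)"
        by (rule mult_right_mono) (use p in simp)
      also have "\<dots> = (1/2) ^ (i - I) * (real ?m ^ (i - I) * odf (int ?m - int i))"
        by (simp add: power_divide power_one_over)
      also have "\<dots> \<le> (1/2) ^ (i - I) * odf (int ?m - int I)"
        by (intro mult_left_mono odf_ratio_bound m i) auto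
      finally show "\<Lambda> ^ (i - I) * odf (int ?m - int i) \<le> (1/2) ^ (i - I) * odf (int ?m - int I)" .
    qed (use KL(1) E \<Lambda> in auto)
    finally show ?thesis by (simp add: mult_ac)
  qed
  show ?thesis
  proof (rule dominated_eventually[of "max n0 (Suc I)" _ "K * E * \<Lambda> ^ I * 2"])
    fix N assume N: "N \<ge> max n0 (Suc I)"
    let ?A = "K * E * \<Lambda> ^ I * odf (int (N + 4) - int I)"
    have op: "odf (int (N + 4) - int I) > 0" using N by (intro odf_pos) simp
    have A: "?A \<ge> 0" using KL(1) E \<Lambda> op by auto
    have "{..N - 1} = {..<I} \<union> {I..N - 1}" using N by auto
    then have "(\<Sum>i\<le>N - 1. t i N) = (\<Sum>i<I. t i N) + (\<Sum>i=I..N - 1. t i N)"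
      by (simp add: sum.union_disjoint ivl_disj_int)
    then have "\<bar>(\<Sum>i\<le>N - 1. t i N) - (\<Sum>i<I. t i N)\<bar> \<le> (\<Sum>i=I..N - 1. \<bar>t i N\<bar>)" by simp
    also have "\<dots> \<le> (\<Sum>i=I..N - 1. ?A * (1 / 2) ^ (i - I))"
      by (intro sum_mono tb) (use N in auto)
    also have "\<dots> = ?A * (\<Sum>j\<le>N - 1 - I. (1 / 2) ^ j)"
      unfolding sum_distrib_left[symmetric]
      by (rule arg_cong[of _ _ "(*) ?A"], rule sum.reindex_bij_witness[of _ "\<lambda>j. j + I" "\<lambda>i. i - I"]) (use N in auto)
    also have "\<dots> \<le> ?A * 2"
    proof (rule mult_left_mono[OF _ A])
      have "(\<Sum>j\<le>k. (1 / 2 :: real) ^ j) = 2 - (1/2) ^ k" for k by (induction k) auto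
      then show "(\<Sum>j\<le>N - 1 - I. (1 / 2 :: real) ^ j) \<le> 2" by simp
    qed
    also have "\<dots> = K * E * \<Lambda> ^ I * 2 * \<bar>odf (int N + (4 - int I))\<bar>"
      using op by (simp add: algebra_simps)
    finally show "\<bar>(\<Sum>i\<le>N - 1. t i N) - (\<Sum>i<I. t i N)\<bar> \<le> K * E * \<Lambda> ^ I * 2 * \<bar>odf (int N + (4 - int I))\<bar>" .
  qed
qed

section \<open>Polynomial factors in the index\<close>

lemma dominated_divide_linear:
  assumes "dominated (s + 1) (\<lambda>n. (real n + 1) * f n)"
  shows "dominated s f"
proof -
  obtain K where K: "K > 0" "\<And>n. \<bar>(real n + 1) * f n\<bar> \<le> K * \<bar>odf (int n + (s + 1))\<bar>"
    using assms by (rule dominatedE) blast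
  show ?thesis
  proof (rule dominatedI)
    fix n
    have "(real n + 1) * \<bar>f n\<bar> \<le> K * (\<bar>2 * real_of_int (int n + s) + 1\<bar> * \<bar>odf (int n + s)\<bar>)"
      using K(2)[of n] odf_plus_one[of "int n + s"] by (simp add: abs_mult add.assoc)
    also have "\<dots> \<le> K * ((real n + 1) * (2 + 2 * \<bar>real_of_int s\<bar>) * \<bar>odf (int n + s)\<bar>)"
    proof (intro mult_left_mono mult_right_mono)
      have "\<bar>2 * real_of_int (int n + s) + 1\<bar> \<le> 2 * real n + 2 * \<bar>real_of_int s\<bar> + 1" by simp
      also have "\<dots> \<le> (real n + 1) * (2 + 2 * \<bar>real_of_int s\<bar>)" by (simp add: algebra_simps)
      finally show "\<bar>2 * real_of_int (int n + s) + 1\<bar> \<le> (real n + 1) * (2 + 2 * \<bar>real_of_int s\<bar>)" .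
    qed (use K(1) in auto)
    finally have "(real n + 1) * \<bar>f n\<bar> \<le> (real n + 1) * (K * (2 + 2 * \<bar>real_of_int s\<bar>) * \<bar>odf (int n + s)\<bar>)"
      by (simp only: mult_ac)
    then show "\<bar>f n\<bar> \<le> K * (2 + 2 * \<bar>real_of_int s\<bar>) * \<bar>odf (int n + s)\<bar>"
      by (rule mult_left_le_imp_le) simp
  qed
qed

text \<open>From (n + 1) odf(n + 2 - k) = odf(n + 3 - k) / 2 + (k - 3/2) odf(n + 2 - k), comparison
  at odf(n + 3 - R) gives a recursion in which the new unknown has the factor 1/2 and can be solved
  for.\<close>

lemma expands_divide_linear:
  assumes "expands a c" "c $ 0 = 0" "\<And>n. (real n + 1) * z n = a (n + 2)"
  obtains d where "expands z d" "d $ 0 = 2 * c $ 1"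
proof -
  define e where "e = rec_nat (2 * c $ 1) (\<lambda>k ek. 2 * (c $ (k + 2) - (real k - 3 / 2) * ek))"
  have e0: "e 0 = 2 * c $ 1" and eS: "e (Suc k) = 2 * (c $ (k + 2) - (real k - 3 / 2) * e k)" for k
    by (simp_all add: e_def)
  \<comment> \<open>The part carried over from the previous coefficient, with factor (R - 1) -
    3/2.\<close>
  define q where "q R = (if R = 0 then 0 else (real R - 5 / 2) * e (R - 1))" for R
  have eq: "e R / 2 + q R = c $ Suc R" for R
    by (cases R) (simp_all add: e0 eS q_def diff_divide_distrib)
  have sum: "(real n + 1) * (\<Sum>k<R. e k * odf (int n + 2 - int k))
     = (\<Sum>k<Suc R. c $ k * odf (int n + 4 - int k)) + q R * odf (int n + 3 - int R)" for n R
  proof (induction R)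
    case 0 then show ?case by (simp add: q_def assms)
  next
    case (Suc R)
    have o: "(real n + 1) * odf (int n + 2 - int R) =
       odf (int n + 3 - int R) / 2 + (real R - 3 / 2) * odf (int n + 2 - int R)"
      using odf_plus_one[of "int n + 2 - int R"] by (simp add: field_simps)
    have i: "int n + 3 - int (Suc R) = int n + 2 - int R" "int n + 4 - int (Suc R) = int n + 3 - int R" by simp_all
    have qS: "q (Suc R) = (real R - 3 / 2) * e R" by (simp add: q_def)
    have "(real n + 1) * (\<Sum>k<Suc R. e k * odf (int n + 2 - int k))
       = (\<Sum>k<Suc R. c $ k * odf (int n + 4 - int k)) + q R * odf (int n + 3 - int R)
         + e R * ((real n + 1) * odf (int n + 2 - int R))"
      using Suc by (simp add: algebra_simps)
    also have "\<dots> = (\<Sum>k<Suc R. c $ k * odf (int n + 4 - int k)) + (e R / 2 + q R) * odf (int n + 3 - int R)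
         + (real R - 3 / 2) * e R * odf (int n + 2 - int R)"
      unfolding o by (simp add: algebra_simps)
    finally show ?case unfolding eq sum.lessThan_Suc[of _ "Suc R"] i qS .
  qed
  have "expands z (Abs_fps e)"
    unfolding expands_def
  proof
    fix R
    have "dominated (2 - int R + 1) (\<lambda>n. a (n + 2) - (\<Sum>k<Suc R. c $ k * odf (int (n + 2) + 2 - int k)))"
      using dominated_shift_left[OF expandsD[OF assms(1), of "Suc R"], of 2] by simp
    moreover have "dominated (2 - int R + 1) (\<lambda>n. q R * odf (int n + (2 - int R + 1)))"
      by (intro dominated_cmult dominated_odf)
    ultimately have "dominated (2 - int R + 1) (\<lambda>n. a (n + 2) - (\<Sum>k<Suc R. c $ k * odf (int (n + 2) + 2 - int k))
       - q R * odf (int n + (2 - int R + 1)))" by (rule dominated_diff)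
    moreover have "a (n + 2) - (\<Sum>k<Suc R. c $ k * odf (int (n + 2) + 2 - int k)) - q R * odf (int n + (2 - int R + 1))
      = (real n + 1) * (z n - (\<Sum>k<R. Abs_fps e $ k * odf (int n + 2 - int k)))" for n
    proof -
      have i: "int (n + 2) + 2 = int n + 4" "int n + (2 - int R + 1) = int n + 3 - int R" by simp_all
      show ?thesis unfolding right_diff_distrib fps_nth_Abs_fps assms(3) sum i by simp
    qed
    ultimately have "dominated (2 - int R + 1) (\<lambda>n. (real n + 1) * (z n - (\<Sum>k<R. Abs_fps e $ k * odf (int n + 2 - int k))))"
      by (simp only:)
    then show "dominated (2 - int R) (\<lambda>n. z n - (\<Sum>k<R. Abs_fps e $ k * odf (int n + 2 - int k)))"
      by (rule dominated_divide_linear)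
  qed
  then show ?thesis by (intro that[of "Abs_fps e"]) (simp_all add: e0)
qed

text \<open>Each of the i linear factors moves the expansion by one order with leading factor 1/2,
  and the denominators multiply to i!.\<close>

lemma expands_gbinomial_mult:
  assumes "expands a c" "\<And>k. k < j + i \<Longrightarrow> c $ k = 0"
  obtains d where "expands (\<lambda>n. ((real n - 1) gchoose i) * a n) d" "\<And>k. k < j \<Longrightarrow> d $ k = 0"
    "d $ j = c $ (j + i) / (2 ^ i * fact i)"
  using assms
proof (induction i arbitrary: j thesis)
  case 0
  then show ?case by (intro "0.prems"(1)[of c]) simp_all
next
  case (Suc i)
  obtain d where d: "expands (\<lambda>n. ((real n - 1) gchoose i) * a n) d" "\<And>k. k < Suc j \<Longrightarrow> d $ k = 0"
    "d $ Suc j = c $ (Suc j + i) / (2 ^ i * fact i)"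
    using Suc.IH[of "Suc j"] Suc.prems(2,3) by auto
  let ?d = "Abs_fps (\<lambda>k. d $ Suc k / 2 + (real k - 5 / 2 + (- 1 - real i)) * d $ k)"
  have "expands (\<lambda>n. (real n + (- 1 - real i)) * (((real n - 1) gchoose i) * a n)) ?d"
    by (rule expands_linear_mult[OF d(1)]) (use d(2) in simp)
  then have "expands (\<lambda>n. 1 / (real i + 1) * ((real n + (- 1 - real i)) * (((real n - 1) gchoose i) * a n)))
     (fps_const (1 / (real i + 1)) * ?d)" by (rule expands_cmult)
  moreover have "1 / (real i + 1) * ((real n + (- 1 - real i)) * (((real n - 1) gchoose i) * a n))
     = ((real n - 1) gchoose Suc i) * a n" for n
    by (simp add: gbinomial_prod_rev atLeast0_lessThan_Suc field_simps)
  ultimately have "expands (\<lambda>n. ((real n - 1) gchoose Suc i) * a n) (fps_const (1 / (real i + 1)) * ?d)"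
    by (simp only:)
  then show ?case
  proof (rule Suc.prems(1))
    have "c $ (Suc j + i) / (2 ^ i * fact i) / 2 / (real i + 1) = c $ (j + Suc i) / (2 ^ Suc i * fact (Suc i))"
      by (simp add: mult_ac add_ac)
    then show "(fps_const (1 / (real i + 1)) * ?d) $ j = c $ (j + Suc i) / (2 ^ Suc i * fact (Suc i))"
      using d(2,3) by simp
  qed (use d(2) in simp)
qed

text \<open>For N = n + 2, (n + 1) times the coefficient is [x^N] g (1 + \<tau>)^(N-1) (1 + b
  x)^(N+3/2), where B = (1 + b x) (1 + \<tau>) and g = x^2 H' (1 + b x)^(-5/2); the weight x^2 keeps
  H' within the scale. At leading order only the terms i = 0 and i = 1 of the binomial series count,
  and they give the summands \<open>cH $ 1\<close> and \<open>H $ 1 * cB $ 0\<close>.\<close>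

theorem expands_lagrange:
  fixes B H Y :: "real fps"
  assumes B: "expands (fps_nth B) cB" "B $ 0 = 1"
    and H: "expands (fps_nth H) cH" "cH $ 0 = 0" and Y: "Y * B = fps_X"
  obtains d where "expands (\<lambda>n. (H oo fps_inv Y) $ Suc n) d"
    "d $ 0 = exp (B $ 1 / 2) * (cH $ 1 + H $ 1 * cB $ 0)"
proof -
  define b where "b = B $ 1"
  define \<tau> where "\<tau> = B * bin b (- 1) - 1"
  define c\<tau> where "c\<tau> = B * 0 + bin b (- 1) * cB - 0"
  have \<tau>: "expands (fps_nth \<tau>) c\<tau>"
    unfolding \<tau>_def c\<tau>_def by (intro expands_fps_diff expands_mult expands_bin B expands_1)
  have \<tau>01: "\<tau> $ 0 = 0" "\<tau> $ 1 = 0" using B(2) by (simp_all add: \<tau>_def fps_mult_nth bin_nth b_def)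
  have c\<tau>0: "c\<tau> $ 0 = cB $ 0" by (simp add: c\<tau>_def bin_nth)
  define \<sigma> where "\<sigma> = fps_shift 2 \<tau>"
  have \<tau>\<sigma>: "\<tau> = fps_X ^ 2 * \<sigma>"
  proof (rule fps_ext)
    fix n show "\<tau> $ n = (fps_X ^ 2 * \<sigma>) $ n"
    proof (cases "n < 2")
      case True
      then have "n = 0 \<or> n = 1" by auto
      then show ?thesis using \<tau>01 by (auto simp: fps_X_power_mult_nth)
    next
      case False
      then have "n = (n - 2) + 2" by simp
      then show ?thesis using False by (simp only: fps_X_power_mult_nth \<sigma>_def fps_shift_nth if_False)
    qed
  qed
  have d\<sigma>: "dominated 4 (fps_nth \<sigma>)"
    using dominated_shift_left[OF expands_dominated[OF \<tau>], of 2] by (simp add: \<sigma>_def fps_nth_ops)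
  have B\<tau>: "B = bin b 1 * (1 + \<tau>)"
  proof -
    have "bin b 1 * bin b (- 1) = 1" by (simp add: bin_add[symmetric])
    then show ?thesis by (simp add: \<tau>_def mult.left_commute)
  qed
  define g where "g = fps_X ^ 2 * fps_deriv H * bin b (- 5 / 2)"
  define cg where "cg = fps_X ^ 2 * fps_deriv H * 0 + bin b (- 5 / 2) *
    (fps_const (1/2) * cH + fps_X ^ 2 * fps_deriv cH - fps_const (5/2) * (fps_X * cH))"
  have g: "expands (fps_nth g) cg"
    unfolding g_def cg_def by (intro expands_mult expands_X2_deriv H expands_bin)
  have cg01: "cg $ 0 = 0" "cg $ 1 = cH $ 1 / 2"
    using H(2) by (simp_all add: cg_def bin_nth fps_mult_nth[of _ _ 1] fps_X_power_mult_nth)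
  define g' where "g' = fps_deriv H * bin b (- 5 / 2)"
  have gg: "g = fps_X ^ 2 * g'" by (simp add: g_def g'_def mult.assoc)
  have g'0: "g' $ 0 = H $ 1" by (simp add: g'_def bin_nth)
  define cc where "cc i = (of_nat i * \<tau> ^ (i - 1) * c\<tau>) * g + \<tau> ^ i * cg" for i
  have ex: "expands (fps_nth (g * \<tau> ^ i)) (cc i)" for i
    using expands_mult[OF g expands_power[OF \<tau>, of i]] by (simp add: cc_def mult_ac)
  define m where "m = fps_X * bin b (- 1)"
  have m: "m $ 0 = 0" "m $ 1 = 1" by (simp_all add: m_def bin_nth)
  define dd where "dd i = fps_const (exp (b / 2)) * (cc i oo fps_inv m)" for i
  have bc: "expands (binconv b (g * \<tau> ^ i)) (dd i)" for i
    unfolding dd_def m_def by (rule expands_binconv[OF ex])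
  \<comment> \<open>The product rule does not spoil the order 2 i: where one \<open>\<tau>\<close>
    is replaced by its coefficient series, the x^2 in \<open>g\<close> makes up for it; where
    \<open>g\<close> is replaced, all i factors \<open>\<tau>\<close> remain.\<close>
  have cc_low: "cc i $ k = 0" if "k < 2 * i" for i k
  proof (cases i)
    case (Suc j)
    have "cc i = fps_X ^ (2 * i) * (of_nat i * \<sigma> ^ j * c\<tau> * g' + \<sigma> ^ i * cg)"
    proof -
      have "\<tau> ^ j * g = fps_X ^ (2 * i) * (\<sigma> ^ j * g')"
      proof -
        have "(fps_X ^ 2 :: real fps) ^ j * fps_X ^ 2 = fps_X ^ (2 * i)"
          unfolding Suc by (simp only: power_mult[symmetric] power_add[symmetric]) simp
        moreover have "\<tau> ^ j * g = ((fps_X ^ 2) ^ j * fps_X ^ 2) * (\<sigma> ^ j * g')"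
          unfolding \<tau>\<sigma> gg power_mult_distrib by (simp only: mult_ac)
        ultimately show ?thesis by (simp only:)
      qed
      moreover have "\<tau> ^ i = fps_X ^ (2 * i) * \<sigma> ^ i" unfolding \<tau>\<sigma> power_mult_distrib power_mult ..
      moreover have "cc i = of_nat i * c\<tau> * (\<tau> ^ j * g) + \<tau> ^ i * cg" unfolding cc_def Suc by (simp only: diff_Suc_1 mult_ac)
      ultimately show ?thesis by (simp add: algebra_simps)
    qed
    then show ?thesis using that by (simp only: fps_X_power_mult_nth if_True)
  qed (use that in simp)
  have cc1: "cc 1 $ 2 = H $ 1 * cB $ 0"
  proof -
    have "cc 1 = fps_X ^ 2 * (g' * c\<tau> + \<sigma> * cg)" by (simp add: cc_def gg \<tau>\<sigma> algebra_simps)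
    then show ?thesis using cg01 g'0 c\<tau>0 by (simp add: fps_X_power_mult_nth)
  qed
  have cc0: "cc 0 $ 0 = 0" "cc 0 $ 1 = cH $ 1 / 2" using cg01 by (simp_all add: cc_def)
  have dd_low: "dd i $ k = 0" if "k < 2 * i" for i k
    using fps_compose_inv_leading(1)[OF m cc_low that] by (simp add: dd_def)
  have dd1: "dd 1 $ 2 = exp (b / 2) * (H $ 1 * cB $ 0)"
    using fps_compose_inv_leading(2)[OF m, of 2 "cc 1"] cc_low[of _ 1] cc1 by (simp add: dd_def)
  have dd0: "dd 0 $ 0 = 0" "dd 0 $ 1 = exp (b / 2) * (cH $ 1 / 2)"
    using fps_compose_inv_leading[OF m, of 1 "cc 0"] cc0 by (simp_all add: dd_def)
  define t where "t i N = real (N - 1 choose i) * binconv b (g * \<tau> ^ i) N" for i N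
  have "\<exists>d. expands (t i) d \<and> (\<forall>k<i. d $ k = 0) \<and> d $ i = dd i $ (2 * i) / (2 ^ i * fact i)
     \<and> (i = 0 \<longrightarrow> d = dd 0)" for i
  proof (cases i)
    case 0
    have "expands (t 0) (dd 0)"
      by (rule expands_eventually_eq[OF bc[of 0], of 0]) (simp add: t_def)
    then show ?thesis using 0 by (intro exI[of _ "dd 0"]) auto
  next
    case (Suc j)
    obtain d where d: "expands (\<lambda>n. ((real n - 1) gchoose i) * binconv b (g * \<tau> ^ i) n) d" "\<And>k. k < i \<Longrightarrow> d $ k = 0"
      "d $ i = dd i $ (i + i) / (2 ^ i * fact i)"
      using expands_gbinomial_mult[OF bc[of i], of i i] dd_low[of _ i] by (auto simp: mult_2)
    have "expands (t i) d"
    proof (rule expands_eventually_eq[OF d(1), of 1])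
      fix n :: nat assume "n \<ge> 1"
      then have e: "real n - 1 = real (n - 1)" by (simp add: of_nat_diff)
      have "real (n - 1 choose i) = (real (n - 1) gchoose i)" by (rule binomial_gbinomial)
      then show "t i n = ((real n - 1) gchoose i) * binconv b (g * \<tau> ^ i) n"
        unfolding t_def e by (simp only:)
    qed
    moreover have "i \<noteq> 0" by (simp add: Suc)
    moreover have "i + i = 2 * i" by simp
    ultimately show ?thesis using d(2,3) by metis
  qed
  then have "\<exists>ds. \<forall>i. expands (t i) (ds i) \<and> (\<forall>k<i. ds i $ k = 0) \<and> ds i $ i = dd i $ (2 * i) / (2 ^ i * fact i)
     \<and> (i = 0 \<longrightarrow> ds i = dd 0)" by (intro choice allI)
  then obtain ds where ds: "\<And>i. expands (t i) (ds i)" "\<And>i k. k < i \<Longrightarrow> ds i $ k = 0"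
    "\<And>i. ds i $ i = dd i $ (2 * i) / (2 ^ i * fact i)" "ds 0 = dd 0"
    by blast
  define A where "A N = (\<Sum>i\<le>N - 1. t i N)" for N
  \<comment> \<open>The sum may stop at k because \<open>ds i\<close> vanishes below order
    i.\<close>
  define D where "D = Abs_fps (\<lambda>k. \<Sum>i\<le>k. ds i $ k)"
  have D: "D $ 0 = 0" "D $ 1 = exp (b / 2) * (cH $ 1 + H $ 1 * cB $ 0) / 2"
    using ds(3)[of 0] ds(3)[of 1] dd0 dd1[unfolded numeral_2_eq_2] by (simp_all add: D_def ds(4) algebra_simps)
  have AD: "expands A D"
    unfolding expands_def
  proof
    fix R
    have "dominated 4 (fps_nth g)" by (rule dominated_mono[OF expands_dominated[OF g]]) simp
    \<comment> \<open>The cut at R + 2 makes the tail class 4 - I equal to 2 - R.\<close>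
    from dominated_binomial_tail[OF this d\<sigma>, where b = b and I = "R + 2"]
    have 1: "dominated (2 - int R) (\<lambda>N. A N - (\<Sum>i<R + 2. t i N))"
      unfolding A_def t_def \<tau>\<sigma> by simp
    have 2: "dominated (2 - int R) (\<lambda>N. \<Sum>i<R + 2. t i N - (\<Sum>k<R. ds i $ k * odf (int N + 2 - int k)))"
      by (intro dominated_sum expandsD ds)
    have "(\<Sum>i<R + 2. \<Sum>k<R. ds i $ k * odf (int N + 2 - int k)) = (\<Sum>k<R. D $ k * odf (int N + 2 - int k))" for N
    proof -
      have "(\<Sum>i<R + 2. \<Sum>k<R. ds i $ k * odf (int N + 2 - int k)) = (\<Sum>k<R. (\<Sum>i<R + 2. ds i $ k) * odf (int N + 2 - int k))"
        by (subst sum.swap) (simp only: sum_distrib_right)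
      also have "\<dots> = (\<Sum>k<R. D $ k * odf (int N + 2 - int k))"
      proof (rule sum.cong[OF refl])
        fix k assume "k \<in> {..<R}"
        then have "(\<Sum>i<R + 2. ds i $ k) = (\<Sum>i\<le>k. ds i $ k)"
          by (intro sum.mono_neutral_right) (auto intro: ds(2))
        then show "(\<Sum>i<R + 2. ds i $ k) * odf (int N + 2 - int k) = D $ k * odf (int N + 2 - int k)"
          by (simp add: D_def)
      qed
      finally show ?thesis .
    qed
    then have "A N - (\<Sum>k<R. D $ k * odf (int N + 2 - int k)) = A N - (\<Sum>i<R + 2. t i N)
      + (\<Sum>i<R + 2. t i N - (\<Sum>k<R. ds i $ k * odf (int N + 2 - int k)))" for N
      by (simp only: sum_subtractf diff_add_eq add_diff_eq diff_add_cancel)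
    then show "dominated (2 - int R) (\<lambda>N. A N - (\<Sum>k<R. D $ k * odf (int N + 2 - int k)))"
      using dominated_add[OF 1 2] by (simp only:)
  qed
  have eq: "(real n + 1) * (H oo fps_inv Y) $ Suc n = A (n + 2)" for n
  proof -
    have "real (Suc n) * (H oo fps_inv Y) $ Suc n = (fps_deriv H * B ^ Suc n) $ n"
      by (rule lagrange_inversion[OF Y]) (simp add: B(2))
    also have "\<dots> = (fps_X ^ 2 * (fps_deriv H * B ^ Suc n)) $ (n + 2)" by (simp add: fps_X_power_mult_nth)
    also have "fps_X ^ 2 * (fps_deriv H * B ^ Suc n) = (\<Sum>i\<le>Suc n. of_nat (Suc n choose i) * (g * \<tau> ^ i * bin b (real (n + 2) + 3/2)))"
    proof -
      have "B ^ Suc n = bin b (real (Suc n)) * (\<tau> + 1) ^ Suc n"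
        by (subst B\<tau>) (simp only: power_mult_distrib bin_power mult_1_right add.commute)
      also have "bin b (real (Suc n)) = bin b (- 5 / 2) * bin b (real (n + 2) + 3/2)"
      proof -
        have "real (Suc n) = - 5 / 2 + (real (n + 2) + 3/2)" by simp
        then show ?thesis by (simp only: bin_add)
      qed
      finally have "fps_X ^ 2 * (fps_deriv H * B ^ Suc n) = g * bin b (real (n + 2) + 3/2) * (\<tau> + 1) ^ Suc n"
        unfolding g_def by (simp only: mult_ac)
      also have "\<dots> = (\<Sum>k\<le>Suc n. g * bin b (real (n + 2) + 3/2) * (of_nat (Suc n choose k) * \<tau> ^ k * 1 ^ (Suc n - k)))"
        unfolding binomial_ring by (rule sum_distrib_left)
      also have "\<dots> = (\<Sum>i\<le>Suc n. of_nat (Suc n choose i) * (g * \<tau> ^ i * bin b (real (n + 2) + 3/2)))"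
        by (intro sum.cong refl) (simp only: power_one mult_1_left mult_1_right mult_ac)
      finally show ?thesis .
    qed
    also have "\<dots> $ (n + 2) = A (n + 2)"
    proof -
      have "(of_nat k * f :: real fps) $ j = real k * f $ j" for k f j
        by (simp only: fps_of_nat[symmetric] fps_mult_left_const_nth)
      then show ?thesis unfolding A_def fps_sum_nth t_def binconv_def by (simp del: binomial_Suc_Suc)
    qed
    finally show ?thesis by (simp add: add.commute)
  qed
  obtain d where "expands (\<lambda>n. (H oo fps_inv Y) $ Suc n) d" "d $ 0 = 2 * D $ 1"
    using expands_divide_linear[of A D "\<lambda>n. (H oo fps_inv Y) $ Suc n", OF AD D(1) eq] by blast
  then show ?thesis using D(2) by (intro that[of d]) (simp_all add: b_def)
qed

section \<open>The free energy as a trivariate series\<close>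

text \<open>Up to a fixed total degree, \<open>subst3 f Y\<close> is a finite sum of powers of
  \<open>Y\<close>. An identity is proved by verifying it up to every degree, which involves finite
  sums only.\<close>

definition agree :: "nat \<Rightarrow> series3 \<Rightarrow> series3 \<Rightarrow> bool" where
  "agree K F G \<longleftrightarrow> (\<forall>a b c. a + b + c \<le> K \<longrightarrow> F $ a $ b $ c = G $ a $ b $ c)"

lemma agree_refl [simp]: "agree K F F" by (simp add: agree_def)

lemma agree_sym: "agree K F G \<Longrightarrow> agree K G F" by (simp add: agree_def)

lemma agree_trans: "agree K F G \<Longrightarrow> agree K G H \<Longrightarrow> agree K F H" by (simp add: agree_def)

lemma agree_imp_eq: "(\<And>K. agree K F G) \<Longrightarrow> F = G"
  by (auto simp: agree_def intro!: fps_ext)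

lemma mult3_nth: "(F * G) $ a $ b $ c =
    (\<Sum>i\<le>a. \<Sum>j\<le>b. \<Sum>l\<le>c. F $ i $ j $ l * G $ (a - i) $ (b - j) $ (c - l))"
  for F G :: series3
  by (simp add: fps_mult_nth fps_sum_nth atLeast0AtMost)

lemma agree_mult: "agree K F G \<Longrightarrow> agree K F' G' \<Longrightarrow> agree K (F * F') (G * G')"
  by (auto simp: agree_def mult3_nth intro!: sum.cong)

definition order_ge :: "nat \<Rightarrow> series3 \<Rightarrow> bool" where
  "order_ge k F \<longleftrightarrow> (\<forall>a b c. a + b + c < k \<longrightarrow> F $ a $ b $ c = 0)"

lemma order_ge_mult:
  assumes "order_ge k F" "order_ge l G"
  shows "order_ge (k + l) (F * G)"
  unfolding order_ge_def mult3_nth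
proof (intro allI impI sum.neutral ballI)
  fix a b c i j m assume *: "a + b + c < k + l" "i \<in> {..a}" "j \<in> {..b}" "m \<in> {..c}"
  then have "i + j + m < k \<or> (a - i) + (b - j) + (c - m) < l" by auto
  then show "F $ i $ j $ m * G $ (a - i) $ (b - j) $ (c - m) = 0"
    using assms by (auto simp: order_ge_def)
qed

lemma order_ge_power:
  assumes "Y $ 0 $ 0 $ 0 = 0"
  shows "order_ge k (Y ^ k)"
proof (induction k)
  case (Suc k)
  have "order_ge 1 Y" using assms by (simp add: order_ge_def)
  from order_ge_mult[OF this Suc] show ?case by simp
qed (simp add: order_ge_def)

definition const3 :: "real \<Rightarrow> series3" where
  "const3 r = fps_const (fps_const (fps_const r))"

lemma const3_mult_nth: "(const3 r * F) $ a $ b $ c = r * F $ a $ b $ c"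
  by (simp add: const3_def)

lemma subst3_agree:
  assumes "Y $ 0 $ 0 $ 0 = 0" "K \<le> N"
  shows "agree K (subst3 f Y) (\<Sum>k\<le>N. const3 (f $ k) * Y ^ k)"
  unfolding agree_def
proof (intro allI impI)
  fix a b c assume *: "a + b + c \<le> K"
  have "(Y ^ k) $ a $ b $ c = 0" if "k > a + b + c" for k
    using order_ge_power[OF assms(1), of k] that by (simp add: order_ge_def)
  then have "(\<Sum>k\<le>a + b + c. f $ k * (Y ^ k) $ a $ b $ c) = (\<Sum>k\<le>N. f $ k * (Y ^ k) $ a $ b $ c)"
    by (intro sum.mono_neutral_left) (use * assms(2) in auto)
  then show "subst3 f Y $ a $ b $ c = (\<Sum>k\<le>N. const3 (f $ k) * Y ^ k) $ a $ b $ c"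
    by (simp add: subst3_def fps_sum_nth const3_mult_nth)
qed

lemma subst3_add: "subst3 (f + g) Y = subst3 f Y + subst3 g Y"
  by (rule agree_imp_eq) (simp add: agree_def subst3_def algebra_simps sum.distrib)

lemma subst3_const: "subst3 (fps_const r) Y = const3 r"
proof -
  have "(\<Sum>k\<le>n. (fps_const r :: real fps) $ k * (Y ^ k) $ a $ b $ c) = r * (1 :: series3) $ a $ b $ c" for n a b c
    by (subst sum.atMost_shift) simp
  then show ?thesis
    by (intro fps_ext) (simp add: subst3_def const3_def)
qed

lemma subst3_1: "subst3 1 Y = 1"
  using subst3_const[of 1 Y] by (simp add: const3_def)

lemma subst3_nth_0: "subst3 f Y $ 0 $ 0 $ 0 = f $ 0"
  by (simp add: subst3_def)

lemma subst3_X_mult: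
  assumes Y: "Y $ 0 $ 0 $ 0 = 0"
  shows "subst3 (fps_X * f) Y = Y * subst3 f Y"
proof (rule agree_imp_eq)
  fix K
  have "agree K (subst3 (fps_X * f) Y) (\<Sum>k\<le>Suc K. const3 ((fps_X * f) $ k) * Y ^ k)"
    by (rule subst3_agree[OF Y]) simp
  also have "(\<Sum>k\<le>Suc K. const3 ((fps_X * f) $ k) * Y ^ k) = Y * (\<Sum>k\<le>K. const3 (f $ k) * Y ^ k)"
    by (subst sum.atMost_Suc_shift) (simp add: const3_def sum_distrib_left mult_ac)
  finally have 1: "agree K (subst3 (fps_X * f) Y) (Y * (\<Sum>k\<le>K. const3 (f $ k) * Y ^ k))" .
  have "agree K (Y * subst3 f Y) (Y * (\<Sum>k\<le>K. const3 (f $ k) * Y ^ k))"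
    by (intro agree_mult subst3_agree Y) auto
  with 1 show "agree K (subst3 (fps_X * f) Y) (Y * subst3 f Y)" using agree_sym agree_trans by blast
qed

text \<open>Treats the derivatives in t and in j at once, as W without j^2 / 2 depends on the
  sources only through 1 - j - t. By the axiom \<open>local\<close> at most one degree is lost, so a
  derivation is compatible with the truncations of a substitution.\<close>

locale derivation3 =
  fixes D :: "series3 \<Rightarrow> series3"
  assumes add: "D (F + G) = D F + D G"
    and mult: "D (F * G) = D F * G + F * D G"
    and const: "D (const3 r) = 0"
    and local: "agree (Suc K) F G \<Longrightarrow> agree K (D F) (D G)"
begin

lemma D_1: "D 1 = 0" using const[of 1] by (simp add: const3_def)

lemma D_0: "D 0 = 0" using const[of 0] by (simp add: const3_def)

lemma sum: "D (\<Sum>i\<in>A. F i) = (\<Sum>i\<in>A. D (F i))"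
  by (induction A rule: infinite_finite_induct) (simp_all add: D_0 add)

lemma power: "D (F ^ Suc k) = of_nat (Suc k) * F ^ k * D F"
  by (induction k) (simp_all add: mult algebra_simps)

lemma diff_1: "D (F - 1) = D F"
  using add[of "F - 1" 1] by (simp add: D_1)

lemma subst3:
  assumes Y: "Y $ 0 $ 0 $ 0 = 0"
  shows "D (subst3 f Y) = subst3 (fps_deriv f) Y * D Y"
proof (rule agree_imp_eq)
  fix K
  have "agree K (D (subst3 f Y)) (D (\<Sum>k\<le>Suc K. const3 (f $ k) * Y ^ k))"
    by (intro local subst3_agree Y) auto
  also have "D (\<Sum>k\<le>Suc K. const3 (f $ k) * Y ^ k) = (\<Sum>k\<le>K. const3 (fps_deriv f $ k) * Y ^ k) * D Y"
  proof -
    have "D (const3 (f $ Suc k) * Y ^ Suc k) = const3 (fps_deriv f $ k) * Y ^ k * D Y" for k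
    proof -
      have "const3 (fps_deriv f $ k) = of_nat (Suc k) * const3 (f $ Suc k)"
        by (simp add: const3_def fps_of_nat[symmetric])
      moreover have "D (const3 (f $ Suc k) * Y ^ Suc k) = const3 (f $ Suc k) * (of_nat (Suc k) * Y ^ k * D Y)"
        unfolding mult power const by simp
      ultimately show ?thesis by (simp only: mult_ac)
    qed
    then show ?thesis
      by (subst sum.atMost_Suc_shift) (simp add: add sum const sum_distrib_right)
  qed
  finally have 1: "agree K (D (subst3 f Y)) ((\<Sum>k\<le>K. const3 (fps_deriv f $ k) * Y ^ k) * D Y)" .
  have "agree K (subst3 (fps_deriv f) Y * D Y) ((\<Sum>k\<le>K. const3 (fps_deriv f $ k) * Y ^ k) * D Y)"
    by (intro agree_mult subst3_agree Y) auto
  with 1 show "agree K (D (subst3 f Y)) (subst3 (fps_deriv f) Y * D Y)" using agree_sym agree_trans by blast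
qed

text \<open>The derivative of log(1 + x) is 1 / (1 + x), whose substitution at F - 1 is a reciprocal
  of F.\<close>

lemma log3:
  assumes "F $ 0 $ 0 $ 0 = 1"
  shows "F * D (log3 F) = D F"
proof -
  define V where "V = F - 1"
  have V: "V $ 0 $ 0 $ 0 = 0" using assms by (simp add: V_def)
  define L where "L = subst3 (inverse (1 + fps_X)) V"
  have "subst3 (fps_deriv (fps_ln 1)) V = L" by (simp add: fps_ln_deriv L_def)
  then have "D (log3 F) = L * D F"
    unfolding log3_def V_def[symmetric] using subst3[OF V, of "fps_ln 1"] diff_1[of F] by (simp add: V_def)
  moreover have "F * L = 1"
  proof -
    have "(1 + fps_X) * inverse (1 + fps_X :: real fps) = 1"
      by (rule inverse_mult_eq_1') simp
    then have "subst3 (inverse (1 + fps_X) + fps_X * inverse (1 + fps_X)) V = 1"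
      using subst3_1 by (simp add: distrib_right)
    then have "L + V * L = 1" unfolding subst3_add subst3_X_mult[OF V] L_def .
    then show ?thesis by (simp add: V_def algebra_simps)
  qed
  ultimately show ?thesis by (simp add: mult.assoc[symmetric])
qed

end

section \<open>The derivatives of the free energy\<close>

lemma derivation3_t: "derivation3 fps_deriv"
  by standard (auto simp: const3_def agree_def fps_of_nat[symmetric] algebra_simps)

definition deriv_j :: "series3 \<Rightarrow> series3" where
  "deriv_j F = Abs_fps (\<lambda>a. fps_deriv (F $ a))"

lemma deriv_j_nth [simp]: "deriv_j F $ a = fps_deriv (F $ a)"
  by (simp add: deriv_j_def)

lemma derivation3_j: "derivation3 deriv_j"
proof
  fix F G :: series3
  show "deriv_j (F * G) = deriv_j F * G + F * deriv_j G"
    by (rule fps_ext) (simp add: fps_mult_nth fps_deriv_sum sum.distrib)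
qed (auto simp: const3_def agree_def fps_of_nat[symmetric] intro!: fps_ext)

text \<open>The recursion (2 m + 1)!! = (2 m + 1) (2 m - 1)!! for generating functions: the summand
  1 yields x chi, the summand 2 m yields 2 x^2 chi'.\<close>

lemma chi_ode: "chi = 1 + fps_X * chi + fps_const 2 * (fps_X * (fps_X * fps_deriv chi))"
proof (rule fps_ext)
  fix n
  show "chi $ n = (1 + fps_X * chi + fps_const 2 * (fps_X * (fps_X * fps_deriv chi))) $ n"
  proof (cases n)
    case (Suc m)
    have "dfact (2 * Suc m - 1) = (2 * m + 1) * dfact (2 * m - 1)" by (cases m) auto
    then show ?thesis using Suc by (cases m) (auto simp: chi_def algebra_simps)
  qed (simp add: chi_def)
qed

lemma chi_nth_0 [simp]: "chi $ 0 = 1"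
  by (simp add: chi_def)

lemma Hbar_nonzero: "Hbar \<noteq> 0"
proof
  assume "Hbar = 0"
  then have "Hbar $ 0 $ 0 $ 1 = 0" by simp
  then show False by (simp add: Hbar_def)
qed

definition Y3 :: series3 where "Y3 = Hbar * inverse Usrc ^ 2"
definition C3 :: series3 where "C3 = subst3 chi Y3"
definition M3 :: series3 where "M3 = Hbar * log3 (inverse Usrc) + Hbar * log3 C3"

lemma Y3_0: "Y3 $ 0 $ 0 $ 0 = 0"
  by (simp add: Y3_def Hbar_def)

lemma Y3_U: "Y3 * Usrc ^ 2 = Hbar"
proof -
  have "Y3 * Usrc ^ 2 = Hbar * ((Usrc * inverse Usrc) * (Usrc * inverse Usrc))"
    by (simp only: Y3_def power2_eq_square mult_ac)
  then show ?thesis by (simp add: Usrc_inverse)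
qed

lemma Usrc_inverse_0: "inverse Usrc $ 0 $ 0 $ 0 = 1"
proof -
  have "(Usrc * inverse Usrc) $ 0 $ 0 $ 0 = 1" unfolding Usrc_inverse by simp
  moreover have "(F * G) $ 0 $ 0 $ 0 = F $ 0 $ 0 $ 0 * G $ 0 $ 0 $ 0" for F G :: series3 by simp
  moreover have "Usrc $ 0 $ 0 $ 0 = 1" by (simp add: Usrc_def Jsrc_def Tsrc_def)
  ultimately show ?thesis by (simp only: mult_1_left)
qed

lemma C3_0: "C3 $ 0 $ 0 $ 0 = 1"
  by (simp add: C3_def subst3_nth_0)

lemma C3_ode: "C3 = 1 + Y3 * C3 + 2 * (Y3 * (Y3 * subst3 (fps_deriv chi) Y3))"
proof -
  have "C3 = subst3 (1 + fps_X * chi + fps_const 2 * (fps_X * (fps_X * fps_deriv chi))) Y3"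
    unfolding C3_def using chi_ode by (rule arg_cong)
  also have "fps_const 2 * (fps_X * (fps_X * fps_deriv chi)) = fps_X * (fps_X * fps_deriv chi) + fps_X * (fps_X * fps_deriv chi)"
    by (rule fps_ext) (simp only: fps_mult_left_const_nth fps_add_nth mult_2)
  finally have "C3 = 1 + Y3 * C3 + (Y3 * (Y3 * subst3 (fps_deriv chi) Y3) + Y3 * (Y3 * subst3 (fps_deriv chi) Y3))"
    unfolding subst3_add subst3_X_mult[OF Y3_0] subst3_1 C3_def[symmetric] .
  then show ?thesis unfolding mult_2 .
qed

context derivation3
begin

text \<open>With U, Y, C, M for \<open>Usrc\<close>, \<open>Y3\<close>, \<open>C3\<close>,
  \<open>M3\<close>: the assumptions give D Y = 2 Y / U and D M = hbar / U + hbar D C / C, where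
  hbar = Y U^2. The equation of chi then eliminates chi' and leaves D M = U (1 - 1 / C).\<close>

lemma free_energy_parts:
  assumes DU: "D Usrc = - 1" and DH: "D Hbar = 0"
  shows "C3 * D M3 = Usrc * (C3 - 1)" "Y3 * Usrc * D C3 = C3 - 1 - Y3 * C3"
proof -
  define I where "I = inverse Usrc"
  have UI: "Usrc * I = 1" by (simp add: I_def Usrc_inverse)
  have "D (Usrc * I) = 0" by (simp add: UI D_1)
  then have "Usrc * D I = I" by (simp add: mult DU)
  then have "(Usrc * I) * D I = I * I" by (simp add: mult_ac)
  then have DI: "D I = I * I" by (simp add: UI)
  have Y: "Y3 = Hbar * (I * I)" by (simp add: Y3_def I_def power2_eq_square)
  have DY: "D Y3 = 2 * Y3 * I" unfolding Y by (simp add: mult DH DI algebra_simps)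
  define E where "E = subst3 (fps_deriv chi) Y3"
  have ode: "C3 = 1 + Y3 * C3 + 2 * (Y3 * (Y3 * E))" unfolding E_def by (rule C3_ode)
  have DC: "D C3 = E * (2 * Y3 * I)"
    unfolding C3_def E_def using subst3[OF Y3_0, of chi] by (simp add: DY)
  have LI: "I * D (log3 I) = I * I" using log3[of I] Usrc_inverse_0 by (simp add: I_def[symmetric] DI)
  have "D (log3 I) = I"
  proof -
    have "Usrc * (I * D (log3 I)) = Usrc * (I * I)" by (simp only: LI)
    then show ?thesis by (simp add: mult.assoc[symmetric] UI)
  qed
  then have DM: "D M3 = Hbar * I + Hbar * D (log3 C3)"
    unfolding M3_def I_def[symmetric] by (simp add: add mult DH)
  have LC: "C3 * D (log3 C3) = D C3" by (rule log3) (rule C3_0)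
  have ode': "2 * (Y3 * (Y3 * E)) = C3 - (1 + Y3 * C3)" using ode by (metis add_diff_cancel_left')
  show "Y3 * Usrc * D C3 = C3 - 1 - Y3 * C3"
  proof -
    have "Y3 * Usrc * D C3 = (Usrc * I) * (2 * (Y3 * (Y3 * E)))" unfolding DC by (simp add: mult_ac)
    then show ?thesis unfolding UI ode' by (simp add: algebra_simps)
  qed
  \<comment> \<open>The extra factor \<open>Hbar\<close> is rewritten as
    \<open>Y3 * Usrc ^ 2\<close> to clear the reciprocals of \<open>Usrc\<close>, and one factor
    \<open>Hbar\<close> is cancelled at the end.\<close>
  have "Hbar * (C3 * D M3) = Y3 * Usrc ^ 2 * (Hbar * (I * C3 + D C3))"
    unfolding DM Y3_U LC[symmetric] by (simp only: distrib_left mult_ac)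
  also have "\<dots> = Hbar * (Usrc * I) * Usrc * (Y3 * C3 + 2 * (Y3 * (Y3 * E)))"
    unfolding DC Y3_U[symmetric] by (simp only: power2_eq_square distrib_left mult_ac)
  also have "\<dots> = Hbar * (Usrc * (C3 - 1))" unfolding UI ode' by (simp add: algebra_simps)
  finally show "C3 * D M3 = Usrc * (C3 - 1)" by (simp only: mult_left_cancel[OF Hbar_nonzero])
qed

end

lemma free_energy_M3: "free_energy = const3 (1/2) * Jsrc ^ 2 + M3"
  by (simp add: free_energy_def M3_def C3_def Y3_def const3_def)

definition C_j :: "real fps fps" where "C_j = C3 $ 0"
definition Y_j :: "real fps fps" where "Y_j = Y3 $ 0"
definition W_t :: "real fps fps" where "W_t = fps_deriv free_energy $ 0"

lemma Usrc_nth_0: "Usrc $ 0 = 1 - fps_X"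
  by (simp add: Usrc_def Jsrc_def Tsrc_def)

lemma C_j_nonzero: "C_j \<noteq> 0"
  using C3_0 by (auto simp: C_j_def)

lemma W_t_eq: "C_j * W_t = (1 - fps_X) * (C_j - 1)"
proof -
  interpret derivation3 fps_deriv by (rule derivation3_t)
  have "C3 * fps_deriv M3 = Usrc * (C3 - 1)"
    by (rule free_energy_parts) (auto simp: Usrc_def Jsrc_def Tsrc_def Hbar_def)
  then have "(C3 * fps_deriv M3) $ 0 = (Usrc * (C3 - 1)) $ 0" by (rule arg_cong)
  moreover have "fps_deriv free_energy = fps_deriv M3"
  proof -
    have "const3 (1/2) * Jsrc ^ 2 = fps_const (fps_const (fps_const (1/2)) * fps_X ^ 2)"
      by (simp add: const3_def Jsrc_def fps_const_power fps_const_mult)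
    then show ?thesis by (simp only: free_energy_M3 fps_deriv_add fps_deriv_const add_0)
  qed
  ultimately show ?thesis by (simp add: W_t_def C_j_def Usrc_nth_0 del: fps_deriv_nth)
qed

text \<open>At t = 0 the t- and j-derivatives of \<open>M3\<close> solve the same equation with
  nonzero factor \<open>C_j\<close>, so they coincide. The vacuum condition thus becomes one on the
  fermionic coefficient \<open>W_t\<close>.\<close>

lemma deriv_free_energy: "fps_deriv (free_energy $ 0) = fps_X + W_t"
proof -
  interpret derivation3 deriv_j by (rule derivation3_j)
  have "C3 * deriv_j M3 = Usrc * (C3 - 1)"
    by (rule free_energy_parts) (auto simp: Usrc_def Jsrc_def Tsrc_def Hbar_def intro!: fps_ext)
  then have "(C3 * deriv_j M3) $ 0 = (Usrc * (C3 - 1)) $ 0" by (rule arg_cong)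
  then have "C_j * fps_deriv (M3 $ 0) = C_j * W_t" unfolding W_t_eq by (simp add: C_j_def Usrc_nth_0)
  then have "fps_deriv (M3 $ 0) = W_t" using C_j_nonzero by simp
  moreover have "fps_deriv ((const3 (1/2) * Jsrc ^ 2) $ 0) = fps_X"
  proof -
    have "(const3 (1/2) * Jsrc ^ 2) $ 0 = fps_const (fps_const (1/2)) * fps_X ^ 2"
      by (simp add: const3_def Jsrc_def power2_eq_square)
    moreover have "fps_const (fps_const (1/2)) * 2 = (1 :: real fps fps)"
      by (simp only: numeral_fps_const fps_const_mult) simp
    moreover have "fps_deriv (fps_const a * fps_X ^ 2) = fps_const a * 2 * fps_X" for a :: "real fps"
      by (simp add: power2_eq_square algebra_simps)
    ultimately show ?thesis by (simp only: mult_1_left)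
  qed
  ultimately show ?thesis by (simp add: free_energy_M3)
qed

lemma deriv_C_j: "Y_j * (1 - fps_X) * fps_deriv C_j = C_j - 1 - Y_j * C_j"
proof -
  interpret derivation3 deriv_j by (rule derivation3_j)
  have "Y3 * Usrc * deriv_j C3 = C3 - 1 - Y3 * C3"
    by (rule free_energy_parts) (auto simp: Usrc_def Jsrc_def Tsrc_def Hbar_def intro!: fps_ext)
  then have "(Y3 * Usrc * deriv_j C3) $ 0 = (C3 - 1 - Y3 * C3) $ 0" by (rule arg_cong)
  then show ?thesis by (simp add: C_j_def Y_j_def Usrc_nth_0)
qed

lemma Y_j_eq: "Y_j * (1 - fps_X) ^ 2 = fps_const fps_X"
proof -
  have "(Y3 * Usrc ^ 2) $ 0 = Hbar $ 0" by (simp only: Y3_U)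
  then show ?thesis by (simp add: Y_j_def Usrc_nth_0 Hbar_def power2_eq_square)
qed

section \<open>The vacuum\<close>

lemma at_j_nth:
  assumes "y $ 0 = 0" "n \<le> N"
  shows "at_j A y $ n = (\<Sum>k\<le>N. (A $ k * y ^ k) $ n)"
proof -
  have "(A $ k * y ^ k) $ n = 0" if "k > n" for k
  proof -
    have "(y ^ k) $ i = 0" if "i < k" for i by (rule startsby_zero_power_prefix[rule_format]) (use assms that in auto)
    then show ?thesis using that by (simp add: fps_mult_nth)
  qed
  then have "(\<Sum>k\<le>n. (A $ k * y ^ k) $ n) = (\<Sum>k\<le>N. (A $ k * y ^ k) $ n)"
    by (intro sum.mono_neutral_left) (use assms(2) in auto)
  then show ?thesis by (simp add: at_j_def)
qed

lemma at_j_add: "at_j (A + B) y = at_j A y + at_j B y"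
  by (rule fps_ext) (simp add: at_j_def distrib_right sum.distrib)

lemma at_j_diff: "at_j (A - B) y = at_j A y - at_j B y"
  by (rule fps_ext) (simp add: at_j_def left_diff_distrib sum_subtractf)

lemma at_j_const: "at_j (fps_const a) y = a"
proof (rule fps_ext)
  fix n
  show "at_j (fps_const a) y $ n = a $ n"
    unfolding at_j_def fps_nth_Abs_fps by (subst sum.atMost_shift) simp
qed

lemma at_j_1: "at_j 1 y = 1"
  using at_j_const[of 1 y] by simp

lemma at_j_X:
  assumes "y $ 0 = 0"
  shows "at_j fps_X y = y"
proof (rule fps_ext)
  fix n
  have "at_j fps_X y $ n = (\<Sum>k\<le>Suc n. ((fps_X :: real fps fps) $ k * y ^ k) $ n)"
    by (rule at_j_nth[OF assms]) simp
  also have "\<dots> = y $ n"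
    by (subst sum.atMost_Suc_shift, subst sum.atMost_shift) (simp add: fps_X_def)
  finally show "at_j fps_X y $ n = y $ n" .
qed

lemma at_j_mult:
  assumes "y $ 0 = 0"
  shows "at_j (A * B) y = at_j A y * at_j B y"
proof (rule fps_ext)
  fix n
  define g where "g i j = (A $ i * B $ j * y ^ (i + j)) $ n" for i j
  have "at_j (A * B) y $ n = (\<Sum>k\<le>n. \<Sum>i\<le>k. g i (k - i))"
    by (simp add: at_j_def fps_mult_nth[of A B] sum_distrib_right fps_sum_nth g_def atLeast0AtMost)
  also have "\<dots> = (\<Sum>(i, j)\<in>{(i, j). i + j \<le> n}. g i j)"
    by (rule sum.triangle_reindex_eq[symmetric])
  also have "\<dots> = (\<Sum>(i, j)\<in>{..n} \<times> {..n}. g i j)"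
  proof (rule sum.mono_neutral_left)
    have "g i j = 0" if "\<not> i + j \<le> n" for i j
    proof -
      have "(y ^ (i + j)) $ l = 0" if "l < i + j" for l
        by (rule startsby_zero_power_prefix[rule_format]) (use assms that in auto)
      then show ?thesis using that by (simp add: g_def fps_mult_nth[of "A $ i * B $ j"])
    qed
    then show "\<forall>p\<in>{..n} \<times> {..n} - {(i, j). i + j \<le> n}. (case p of (i, j) \<Rightarrow> g i j) = 0"
      by fast
  qed auto
  also have "\<dots> = (\<Sum>i\<le>n. \<Sum>j\<le>n. g i j)" by (simp add: sum.cartesian_product)
  also have "\<dots> = ((\<Sum>i\<le>n. A $ i * y ^ i) * (\<Sum>j\<le>n. B $ j * y ^ j)) $ n"
    by (simp add: sum_product fps_sum_nth g_def power_add mult_ac)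
  also have "\<dots> = (at_j A y * at_j B y) $ n"
    unfolding fps_mult_nth by (intro sum.cong refl) (simp add: at_j_nth[OF assms, of _ n] fps_sum_nth)
  finally show "at_j (A * B) y $ n = (at_j A y * at_j B y) $ n" .
qed

lemma at_j_power: "y $ 0 = 0 \<Longrightarrow> at_j (A ^ k) y = at_j A y ^ k"
  by (induction k) (simp_all add: at_j_1 at_j_mult)

lemma at_j_sum: "at_j (\<Sum>i\<in>I. A i) y = (\<Sum>i\<in>I. at_j (A i) y)"
proof -
  have "at_j 0 y = 0" using at_j_const[of 0 y] by simp
  then show ?thesis by (induction I rule: infinite_finite_induct) (simp_all add: at_j_add)
qed

lemma at_j_agree:
  assumes "y $ 0 = 0" "agree n F G"
  shows "at_j (F $ 0) y $ n = at_j (G $ 0) y $ n"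
  unfolding at_j_def fps_nth_Abs_fps
proof (rule sum.cong[OF refl])
  fix k assume k: "k \<in> {..n}"
  show "(F $ 0 $ k * y ^ k) $ n = (G $ 0 $ k * y ^ k) $ n"
    unfolding fps_mult_nth
  proof (rule sum.cong[OF refl])
    fix i assume i: "i \<in> {0..n}"
    show "F $ 0 $ k $ i * (y ^ k) $ (n - i) = G $ 0 $ k $ i * (y ^ k) $ (n - i)"
    proof (cases "k + i \<le> n")
      case True then show ?thesis using assms(2) by (simp add: agree_def)
    next
      case False
      then have "n - i < k" using i by auto
      then have "(y ^ k) $ (n - i) = 0"
        by (intro startsby_zero_power_prefix[rule_format]) (use assms(1) in auto)
      then show ?thesis by simp
    qed
  qed
qed

lemma fps_nth_0_power: "((Y :: series3) ^ k) $ 0 = (Y $ 0) ^ k"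
  by (induction k) simp_all

lemma at_j_subst3:
  assumes "y $ 0 = 0" "Y $ 0 $ 0 $ 0 = 0"
  shows "at_j (subst3 f Y $ 0) y = f oo at_j (Y $ 0) y"
proof (rule fps_ext)
  fix n
  have "at_j (subst3 f Y $ 0) y $ n = at_j ((\<Sum>k\<le>n. const3 (f $ k) * Y ^ k) $ 0) y $ n"
    by (rule at_j_agree[OF assms(1)]) (rule subst3_agree[OF assms(2) order_refl])
  also have "(\<Sum>k\<le>n. const3 (f $ k) * Y ^ k) $ 0 = (\<Sum>k\<le>n. fps_const (fps_const (f $ k)) * (Y $ 0) ^ k)"
    by (simp add: fps_sum_nth const3_def fps_nth_0_power)
  also have "at_j \<dots> y = (\<Sum>k\<le>n. fps_const (f $ k) * at_j (Y $ 0) y ^ k)"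
    by (simp add: at_j_sum at_j_mult at_j_power at_j_const assms(1))
  finally show "at_j (subst3 f Y $ 0) y $ n = (f oo at_j (Y $ 0) y) $ n"
    by (simp add: fps_sum_nth fps_compose_nth atLeast0AtMost)
qed

lemma fps_inv_unique:
  fixes P x :: "real fps"
  assumes "P $ 0 = 0" "P $ 1 \<noteq> 0" "x $ 0 = 0" "P oo x = fps_X"
  shows "x = fps_inv P"
proof -
  have "fps_inv P oo (P oo x) = (fps_inv P oo P) oo x"
    by (rule fps_compose_assoc) (use assms in auto)
  then show ?thesis using assms fps_inv[OF assms(1,2)] by simp
qed

definition x_vac :: "real fps" where "x_vac = fps_inv (fps_X * chi ^ 2)"
definition u_vac :: "real fps" where "u_vac = chi oo x_vac"

lemma x_vac_0 [simp]: "x_vac $ 0 = 0"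
  by (simp add: x_vac_def fps_inv_def)

lemma u_vac_0 [simp]: "u_vac $ 0 = 1"
  by (simp add: u_vac_def)

lemma X_chi2: "(fps_X * chi ^ 2) $ 0 = 0" "(fps_X * chi ^ 2) $ 1 = 1"
  by (simp_all add: power2_eq_square)

lemma x_u_vac: "x_vac * u_vac ^ 2 = fps_X"
proof -
  have "(fps_X * chi ^ 2) oo x_vac = fps_X"
    unfolding x_vac_def by (rule fps_inv_right) (use X_chi2 in auto)
  then show ?thesis by (simp add: fps_compose_mult_distrib fps_compose_power u_vac_def)
qed

context
  fixes y :: "real fps"
  assumes y0: "y $ 0 = 0"
begin

lemma at_j_Y_j: "at_j Y_j y * (1 - y) ^ 2 = fps_X"
proof -
  have "at_j (Y_j * (1 - fps_X) ^ 2) y = fps_X" by (simp only: Y_j_eq at_j_const)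
  then show ?thesis by (simp add: at_j_mult at_j_power at_j_diff at_j_1 at_j_X y0)
qed

lemma at_j_C_j: "at_j C_j y = chi oo at_j Y_j y"
  unfolding C_j_def Y_j_def C3_def by (rule at_j_subst3[OF y0 Y3_0])

lemma at_j_W_t: "at_j C_j y * at_j W_t y = (1 - y) * (at_j C_j y - 1)"
proof -
  have "at_j (C_j * W_t) y = at_j ((1 - fps_X) * (C_j - 1)) y" by (simp only: W_t_eq)
  then show ?thesis by (simp add: at_j_mult at_j_diff at_j_1 at_j_X y0)
qed

text \<open>Multiplying y + W_t by u = chi(x), where x (1 - y)^2 = hbar, gives u + y - 1. For y = 1
  - u the constraint reads x u^2 = hbar, and uniqueness of the compositional inverse fixes
  x.\<close>

lemma vacuum_iff: "at_j (fps_deriv (free_energy $ 0)) y = 0 \<longleftrightarrow> y = 1 - u_vac"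
proof -
  define u x where "u = at_j C_j y" and "x = at_j Y_j y"
  have ux: "u = chi oo x" by (simp add: u_def x_def at_j_C_j)
  have xy: "x * (1 - y) ^ 2 = fps_X" by (simp add: x_def at_j_Y_j)
  have "(x * (1 - y) ^ 2) $ 0 = 0" by (simp add: xy)
  then have x0: "x $ 0 = 0" using y0 by (simp add: power2_eq_square)
  have u0: "u \<noteq> 0" using ux by (metis fps_compose_nth_0 chi_nth_0 fps_zero_nth zero_neq_one)
  have "at_j (fps_deriv (free_energy $ 0)) y = y + at_j W_t y"
    by (simp add: deriv_free_energy at_j_add at_j_X y0)
  then have "u * at_j (fps_deriv (free_energy $ 0)) y = u + y - 1"
    using at_j_W_t by (simp add: u_def algebra_simps)
  then have "at_j (fps_deriv (free_energy $ 0)) y = 0 \<longleftrightarrow> u + y - 1 = 0"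
    using u0 by (metis mult_eq_0_iff)
  also have "\<dots> \<longleftrightarrow> y = 1 - u" by (auto simp: algebra_simps)
  also have "\<dots> \<longleftrightarrow> y = 1 - u_vac"
  proof
    assume y: "y = 1 - u"
    have "(fps_X * chi ^ 2) oo x = x * u ^ 2"
      by (simp add: fps_compose_mult_distrib fps_compose_power x0 ux)
    also have "\<dots> = fps_X" using xy y by simp
    finally have "x = x_vac"
      unfolding x_vac_def by (intro fps_inv_unique x0) (use X_chi2 in auto)
    then show "y = 1 - u_vac" using y ux by (simp add: u_vac_def)
  next
    assume y: "y = 1 - u_vac"
    then have "x * u_vac ^ 2 = x_vac * u_vac ^ 2" using xy x_u_vac by simp
    moreover have "u_vac ^ 2 \<noteq> 0" using u_vac_0 by (metis fps_zero_nth power_not_zero zero_neq_one)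
    ultimately have "x = x_vac" by simp
    then show "y = 1 - u" using y ux by (simp add: u_vac_def)
  qed
  finally show ?thesis .
qed

end

lemma j_vac_eq: "j_vac = 1 - u_vac"
  unfolding j_vac_def
proof (rule the_equality)
  show "(1 - u_vac) $ 0 = 0 \<and> at_j (fps_deriv (free_energy $ 0)) (1 - u_vac) = 0"
    by (simp add: vacuum_iff)
qed (use vacuum_iff in blast)

lemma j_vac_0: "j_vac $ 0 = 0"
  by (simp add: j_vac_eq)

lemma at_vac:
  shows "at_j Y_j j_vac = x_vac" "at_j C_j j_vac = u_vac" "at_j W_t j_vac = u_vac - 1"
proof -
  have "at_j Y_j j_vac * u_vac ^ 2 = x_vac * u_vac ^ 2"
    using at_j_Y_j[OF j_vac_0] x_u_vac by (simp add: j_vac_eq)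
  moreover have "u_vac ^ 2 \<noteq> 0" using u_vac_0 by (metis fps_zero_nth power_not_zero zero_neq_one)
  ultimately show 1: "at_j Y_j j_vac = x_vac" by simp
  show "at_j C_j j_vac = u_vac" using at_j_C_j[OF j_vac_0] by (simp add: 1 u_vac_def)
  have "at_j (fps_deriv (free_energy $ 0)) j_vac = 0" using vacuum_iff[OF j_vac_0] by (simp add: j_vac_eq)
  then show "at_j W_t j_vac = u_vac - 1"
    by (simp add: deriv_free_energy at_j_add at_j_X j_vac_0) (simp add: j_vac_eq algebra_simps)
qed

text \<open>The relation for \<open>W_t\<close> is differentiated in j before j = j_0 is inserted,
  and \<open>deriv_C_j\<close> eliminates the derivative of \<open>C_j\<close>. The factor hbar = x
  u^2 clears the denominators.\<close>

lemma at_vac_deriv: "fps_X * at_j (fps_deriv W_t) j_vac = u_vac - 1 - fps_X"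
proof -
  define v c where "v = at_j (fps_deriv W_t) j_vac" and "c = at_j (fps_deriv C_j) j_vac"
  note hom = at_j_mult at_j_diff at_j_add at_j_1 at_j_X j_vac_0 at_vac v_def[symmetric] c_def[symmetric]
  have J: "1 - j_vac = u_vac" by (simp add: j_vac_eq)
  have "fps_deriv (C_j * W_t) = fps_deriv ((1 - fps_X) * (C_j - 1))" by (simp only: W_t_eq)
  then have "fps_deriv C_j * W_t + C_j * fps_deriv W_t = (1 - fps_X) * fps_deriv C_j - (C_j - 1)"
    by (simp add: algebra_simps)
  then have "at_j (fps_deriv C_j * W_t + C_j * fps_deriv W_t) j_vac = at_j ((1 - fps_X) * fps_deriv C_j - (C_j - 1)) j_vac"
    by (rule arg_cong)
  then have 1: "c * (u_vac - 1) + u_vac * v = u_vac * c - (u_vac - 1)"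
    by (simp add: hom J)
  have "at_j (Y_j * (1 - fps_X) * fps_deriv C_j) j_vac = at_j (C_j - 1 - Y_j * C_j) j_vac"
    by (simp only: deriv_C_j)
  then have 2: "x_vac * u_vac * c = u_vac - 1 - x_vac * u_vac" by (simp add: hom J)
  have "fps_X * v = x_vac * u_vac * (u_vac * v)" by (simp add: x_u_vac[symmetric] power2_eq_square mult_ac)
  also have "u_vac * v = c - (u_vac - 1)" using 1 by (simp add: algebra_simps)
  also have "x_vac * u_vac * (c - (u_vac - 1)) = x_vac * u_vac * c - x_vac * u_vac ^ 2 + x_vac * u_vac"
    by (simp add: algebra_simps power2_eq_square)
  finally show ?thesis unfolding 2 x_u_vac by (simp add: v_def)
qed

text \<open>(u - 1) / hbar, the common value of the bosonic and the fermionic second derivative of W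
  at the vacuum.\<close>

definition w_vac :: "real fps" where "w_vac = fps_shift 1 (u_vac - 1)"

lemma X_w_vac: "fps_X * w_vac = u_vac - 1"
  by (rule fps_ext) (simp add: w_vac_def)

lemma W_ee_eq: "W_ee = w_vac"
  unfolding W_ee_def W_t_def[symmetric] at_vac X_w_vac[symmetric]
  by (rule nonzero_mult_div_cancel_left) simp

lemma W_jj_eq: "W_jj = w_vac"
proof -
  have "fps_X * W_jj = fps_X * w_vac"
    unfolding W_jj_def deriv_free_energy X_w_vac
    by (simp add: at_j_add at_j_1 distrib_left at_vac_deriv)
  then show ?thesis by simp
qed

lemma W_jee_eq: "W_jee = (w_vac - 1) / fps_X"
proof -
  have "fps_X * at_j (fps_deriv W_t) j_vac = fps_X * (w_vac - 1)"
    by (simp add: at_vac_deriv right_diff_distrib X_w_vac)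
  then have "at_j (fps_deriv W_t) j_vac = w_vac - 1" by simp
  then show ?thesis by (simp add: W_jee_def W_t_def fps_eq_iff)
qed

section \<open>Renormalisation\<close>

lemma fps_nonzeroI: "f $ n \<noteq> 0 \<Longrightarrow> f \<noteq> 0"
  by auto

lemma chi_coeffs: "chi $ Suc 0 = 1" "chi $ 2 = 3" "chi $ 3 = 15"
  by (simp_all add: chi_def numeral_eq_Suc)

lemma w_vac_coeffs: "w_vac $ 0 = 1" "w_vac $ Suc 0 = 1"
proof -
  have x1: "x_vac $ Suc 0 = 1"
  proof -
    have "(x_vac * u_vac ^ 2) $ Suc 0 = 1" by (simp add: x_u_vac)
    then show ?thesis by (simp add: fps_mult_nth power2_eq_square)
  qed
  have u: "u_vac $ n = (\<Sum>i\<le>n. chi $ i * (x_vac ^ i) $ n)" for n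
    by (simp add: u_vac_def fps_compose_nth atLeast0AtMost)
  have u1: "u_vac $ Suc 0 = 1" unfolding u by (simp add: chi_coeffs x1)
  have "(x_vac * u_vac ^ 2) $ 2 = 0" by (simp add: x_u_vac)
  then have x2: "x_vac $ 2 = - 2"
    by (simp add: fps_mult_nth power2_eq_square numeral_2_eq_2 x1 u1)
  have "u_vac $ 2 = 1"
    unfolding u by (simp add: numeral_2_eq_2 chi_coeffs[unfolded numeral_2_eq_2] x2[unfolded numeral_2_eq_2] x1 power2_eq_square fps_mult_nth)
  then show "w_vac $ 0 = 1" "w_vac $ Suc 0 = 1" by (simp_all add: w_vac_def u1 numeral_2_eq_2)
qed

lemma W_jee_props: "fps_X * W_jee = w_vac - 1" "W_jee $ 0 = 1"
proof -
  have "w_vac - 1 = fps_X * fps_shift 1 (w_vac - 1)"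
    by (rule fps_ext) (simp add: w_vac_coeffs)
  then have "W_jee = fps_shift 1 (w_vac - 1)"
    unfolding W_jee_eq by (metis fps_X_neq_zero nonzero_mult_div_cancel_left)
  then show 1: "fps_X * W_jee = w_vac - 1" using \<open>w_vac - 1 = _\<close> by simp
  have "(fps_X * W_jee) $ Suc 0 = (w_vac - 1) $ Suc 0" by (simp only: 1)
  then show "W_jee $ 0 = 1" by (simp add: w_vac_coeffs)
qed

lemma G_eq: "G_phipsipsi * w_vac ^ 3 = W_jee" "G_phipsipsi $ 0 = 1"
proof -
  have nz: "(w_vac ^ 3) $ 0 = 1" by (simp add: power3_eq_cube w_vac_coeffs)
  have G: "G_phipsipsi = W_jee * inverse (w_vac ^ 3)"
    unfolding G_phipsipsi_def W_jj_eq W_ee_eq power_Suc[symmetric]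
    using nz by (simp add: fps_divide_unit numeral_3_eq_3 numeral_2_eq_2)
  have "G_phipsipsi * w_vac ^ 3 = W_jee * (inverse (w_vac ^ 3) * w_vac ^ 3)" unfolding G by (rule mult.assoc)
  also have "inverse (w_vac ^ 3) * w_vac ^ 3 = 1" by (rule inverse_mult_eq_1) (simp add: nz)
  finally show "G_phipsipsi * w_vac ^ 3 = W_jee" by simp
  then have "(G_phipsipsi * w_vac ^ 3) $ 0 = 1" by (simp only: W_jee_props)
  then show "G_phipsipsi $ 0 = 1" using nz by simp
qed

text \<open>As both -G_phiphi and -G_psipsi equal 1 / w, the charge is alpha = G^2 w^3 with G =
  W_jee / w^3; the square root enters only through its square.\<close>

lemma inv_charge_eq: "inv_charge * w_vac ^ 3 = W_jee ^ 2" "inv_charge $ 0 = 1"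
proof -
  define iw where "iw = inverse w_vac"
  have iw0: "iw $ 0 = 1" by (simp add: iw_def w_vac_coeffs)
  have iw: "iw * w_vac = 1" unfolding iw_def by (rule inverse_mult_eq_1) (simp add: w_vac_coeffs)
  define \<rho> where "\<rho> = fps_radical root 2 (- G_phiphi)"
  have G1: "- G_phiphi = iw" "- G_psipsi = iw"
    by (simp_all add: G_phiphi_def G_psipsi_def W_jj_eq W_ee_eq iw_def fps_divide_unit w_vac_coeffs)
  have "fps_radical root (Suc 1) iw ^ Suc 1 = iw"
    by (subst power_radical[symmetric]) (simp_all add: iw0)
  then have \<rho>: "\<rho> ^ 2 = iw" by (simp add: \<rho>_def G1 numeral_2_eq_2)
  have \<rho>0: "\<rho> $ 0 = 1" by (simp add: \<rho>_def G1 iw0)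
  have ic: "inv_charge = (G_phipsipsi * inverse (\<rho> * iw)) ^ 2"
    unfolding inv_charge_def \<rho>_def[symmetric] unfolding G1 by (simp add: fps_divide_unit \<rho>0 iw0)
  have "(g * a) ^ 2 * b ^ 2 = (g * (a * b)) ^ 2" for g a b :: "real fps"
    by (simp only: power_mult_distrib mult.assoc)
  then have "inv_charge * (\<rho> * iw) ^ 2 = (G_phipsipsi * (inverse (\<rho> * iw) * (\<rho> * iw))) ^ 2"
    unfolding ic .
  also have "inverse (\<rho> * iw) * (\<rho> * iw) = 1" by (rule inverse_mult_eq_1) (simp add: \<rho>0 iw0)
  finally have "inv_charge * (\<rho> * iw) ^ 2 = G_phipsipsi ^ 2" by simp
  moreover have "(\<rho> * iw) ^ 2 = iw ^ 3"
    unfolding power_mult_distrib \<rho> by (simp add: power3_eq_cube power2_eq_square)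
  ultimately have "inv_charge * iw ^ 3 = G_phipsipsi ^ 2" by simp
  moreover have "inv_charge * iw ^ 3 * w_vac ^ 6 = inv_charge * w_vac ^ 3 * (iw * w_vac) ^ 3"
    by (simp add: power_mult_distrib mult_ac flip: power_add)
  moreover have "G_phipsipsi ^ 2 * w_vac ^ 6 = (G_phipsipsi * w_vac ^ 3) ^ 2"
    by (simp add: power_mult_distrib flip: power_mult)
  ultimately show e: "inv_charge * w_vac ^ 3 = W_jee ^ 2" by (simp add: iw G_eq)
  have "(inv_charge * w_vac ^ 3) $ 0 = 1" unfolding e by (simp add: W_jee_props power2_eq_square)
  then show "inv_charge $ 0 = 1" by (simp add: w_vac_coeffs power3_eq_cube)
qed

lemma hbar_of_ren_eq: "hbar_of_ren = fps_inv (fps_X * inv_charge)"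
proof -
  define P where "P = fps_X * inv_charge"
  have P: "P $ 0 = 0" "P $ 1 = 1" by (simp_all add: P_def inv_charge_eq)
  have Pc: "P oo h = h * (inv_charge oo h)" if "h $ 0 = 0" for h
    using that by (simp add: P_def fps_compose_mult_distrib)
  have i0: "fps_inv P $ 0 = 0" "fps_inv P $ 1 = 1" using P by (simp_all add: fps_inv_def)
  show ?thesis
    unfolding hbar_of_ren_def P_def[symmetric]
  proof (rule the_equality)
    show "fps_inv P $ 0 = 0 \<and> fps_inv P $ 1 = 1 \<and> fps_X = fps_inv P * (inv_charge oo fps_inv P)"
      using i0 Pc[OF i0(1)] fps_inv_right[of P] P by simp
  next
    fix h assume h: "h $ 0 = 0 \<and> h $ 1 = 1 \<and> fps_X = h * (inv_charge oo h)"
    then show "h = fps_inv P" using Pc[of h] P by (intro fps_inv_unique) auto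
  qed
qed

section \<open>Algebraic relations in the renormalised coupling\<close>

abbreviation "hren \<equiv> hbar_of_ren"
definition r_ren :: "real fps" where "r_ren = w_vac oo hren"
definition x_ren :: "real fps" where "x_ren = x_vac oo hren"
definition c_ren :: "real fps" where "c_ren = chi oo x_ren"

lemma hren_props: "hren $ 0 = 0" "hren $ 1 = 1" "hren * (inv_charge oo hren) = fps_X"
proof -
  have P: "(fps_X * inv_charge) $ 0 = 0" "(fps_X * inv_charge) $ 1 = 1" by (simp_all add: inv_charge_eq)
  show h: "hren $ 0 = 0" "hren $ 1 = 1"
    using P by (simp_all add: hbar_of_ren_eq fps_inv_def)
  have "(fps_X * inv_charge) oo hren = fps_X"
    unfolding hbar_of_ren_eq by (rule fps_inv_right) (use P in auto)
  then show "hren * (inv_charge oo hren) = fps_X" using h by (simp add: fps_compose_mult_distrib)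
qed

lemma hren_nonzero: "hren \<noteq> 0"
  using hren_props(2) by (intro fps_nonzeroI[of _ 1]) simp

lemma r_ren_0: "r_ren $ 0 = 1"
  by (simp add: r_ren_def w_vac_coeffs)

lemma r_ren_nonzero: "r_ren \<noteq> 0"
  using r_ren_0 by (intro fps_nonzeroI[of _ 0]) simp

lemma x_ren_0: "x_ren $ 0 = 0"
  by (simp add: x_ren_def)

lemma c_ren_nonzero: "c_ren \<noteq> 0"
  by (intro fps_nonzeroI[of _ 0]) (simp add: c_ren_def)

text \<open>Here \<open>fps_X\<close> is hbar_ren. The last relation combines 1 / G = hbar r^3 / (r
  - 1) with the third, which is the definition of the renormalised coupling in terms of r.\<close>

lemma ren_relations:
  shows "x_ren * c_ren ^ 2 = hren" "hren * r_ren = c_ren - 1" "fps_X * (hren * r_ren ^ 3) = (r_ren - 1) ^ 2"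
    and "fps_X * z_vertex = r_ren - 1"
proof -
  note hom = fps_compose_mult_distrib[OF hren_props(1)] fps_compose_power[OF hren_props(1), symmetric] fps_compose_sub_distrib hren_props(1)
  have u: "u_vac oo hren = c_ren"
    unfolding u_vac_def c_ren_def x_ren_def
    by (rule fps_compose_assoc[symmetric]) (simp_all add: hren_props)
  have "(x_vac * u_vac ^ 2) oo hren = fps_X oo hren" by (simp only: x_u_vac)
  then show "x_ren * c_ren ^ 2 = hren" by (simp add: hom u x_ren_def)
  have "(fps_X * w_vac) oo hren = (u_vac - 1) oo hren" by (simp only: X_w_vac)
  then show "hren * r_ren = c_ren - 1" by (simp add: hom u r_ren_def)
  have "inv_charge * w_vac ^ 3 * fps_X ^ 2 = (w_vac - 1) ^ 2"
    by (simp add: inv_charge_eq(1) W_jee_props(1)[symmetric] power_mult_distrib mult.commute)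
  then have "(inv_charge * w_vac ^ 3 * fps_X ^ 2) oo hren = ((w_vac - 1) ^ 2) oo hren" by (rule arg_cong)
  then have "(inv_charge oo hren) * r_ren ^ 3 * hren ^ 2 = (r_ren - 1) ^ 2" by (simp add: hom r_ren_def)
  moreover have "(inv_charge oo hren) * r_ren ^ 3 * hren ^ 2 = (hren * (inv_charge oo hren)) * (hren * r_ren ^ 3)"
    by (simp add: power2_eq_square mult_ac)
  ultimately show 3: "fps_X * (hren * r_ren ^ 3) = (r_ren - 1) ^ 2" by (simp only: hren_props(3))
  define g where "g = G_phipsipsi oo hren"
  have "G_phipsipsi * w_vac ^ 3 * fps_X = w_vac - 1"
    by (simp add: G_eq(1) W_jee_props(1)[symmetric] mult.commute)
  then have "(G_phipsipsi * w_vac ^ 3 * fps_X) oo hren = (w_vac - 1) oo hren" by (rule arg_cong)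
  then have g: "g * (hren * r_ren ^ 3) = r_ren - 1" by (simp add: hom r_ren_def g_def mult_ac)
  have g0: "g $ 0 = 1" by (simp add: g_def G_eq)
  have "z_vertex = inverse g" by (simp add: z_vertex_def g_def[symmetric] fps_divide_unit g0)
  then have zg: "z_vertex * g = 1" using inverse_mult_eq_1[of g] g0 by simp
  have "z_vertex * (r_ren - 1) = hren * r_ren ^ 3"
    unfolding g[symmetric] mult.assoc[symmetric] zg by simp
  then have "(fps_X * z_vertex) * (r_ren - 1) = (r_ren - 1) * (r_ren - 1)"
    using 3 by (simp add: mult.assoc power2_eq_square)
  moreover have "r_ren - 1 \<noteq> 0"
  proof
    assume "r_ren - 1 = 0"
    then have "hren * r_ren ^ 3 = 0" using 3 by simp
    then show False using hren_nonzero r_ren_nonzero by simp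
  qed
  ultimately show "fps_X * z_vertex = r_ren - 1" using mult_right_cancel by blast
qed

section \<open>The same quantities as series in x\<close>

definition Q_chi :: "real fps" where "Q_chi = 1 - inverse chi"
definition Q1 :: "real fps" where "Q1 = fps_shift 1 Q_chi"
definition S_x :: "real fps" where "S_x = Q1 * (1 - Q_chi) - 1"
definition S1 :: "real fps" where "S1 = fps_shift 1 S_x"
text \<open>\<open>Y_x\<close> is hbar_ren as a series in x, and \<open>B_x\<close> is x /
  \<open>Y_x\<close>. Using the shifted series \<open>Q1\<close> and \<open>S1\<close> means that
  only units are inverted.\<close>

definition B_x :: "real fps" where "B_x = (1 - Q_chi) * Q1 ^ 3 * inverse S1 ^ 2"
definition Y_x :: "real fps" where "Y_x = fps_X * S1 ^ 2 * chi * inverse Q1 ^ 3"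

lemma chi_inverse: "chi * inverse chi = 1"
  by (rule inverse_mult_eq_1') simp

lemma inverse_chi_coeffs:
  "inverse chi $ 0 = 1" "inverse chi $ Suc 0 = - 1" "inverse chi $ 2 = - 2" "inverse chi $ 3 = - 10"
proof -
  let ?i = "inverse chi"
  have e: "(\<Sum>k\<le>n. chi $ k * ?i $ (n - k)) = (if n = 0 then 1 else 0)" for n
  proof -
    have "(chi * ?i) $ n = (if n = 0 then 1 else 0)" unfolding chi_inverse by simp
    then show ?thesis by (simp add: fps_mult_nth atLeast0AtMost)
  qed
  note c = chi_coeffs chi_coeffs[unfolded numeral_2_eq_2 numeral_3_eq_3]
  show 0: "?i $ 0 = 1" by simp
  show 1: "?i $ Suc 0 = - 1" using e[of 1] by (simp add: c)
  show 2: "?i $ 2 = - 2" using e[of 2] 1 by (simp add: c numeral_eq_Suc)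
  show "?i $ 3 = - 10" using e[of 3] 1 2 by (simp add: c numeral_eq_Suc)
qed

lemma Q_coeffs: "Q_chi $ 0 = 0" "Q_chi $ Suc 0 = 1" "Q_chi $ 2 = 2" "Q_chi $ 3 = 10"
  using inverse_chi_coeffs by (simp_all add: Q_chi_def)

lemma Q1_coeffs: "Q1 $ 0 = 1" "Q1 $ Suc 0 = 2" "Q1 $ 2 = 10"
  using Q_coeffs by (simp_all add: Q1_def numeral_eq_Suc)

lemma S_x_coeffs: "S_x $ 0 = 0" "S_x $ Suc 0 = 1" "S_x $ 2 = 6"
  using Q_coeffs Q1_coeffs by (simp_all add: S_x_def fps_mult_nth numeral_eq_Suc)

lemma S1_coeffs: "S1 $ 0 = 1" "S1 $ Suc 0 = 6"
  using S_x_coeffs by (simp_all add: S1_def numeral_eq_Suc)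

text \<open>The linear coefficient, whose half is the exponent -7/2 of the theorem, is -1 + 6 - 12:
  from 1 - Q = 1 - x + ..., Q1 = 1 + 2 x + ... cubed, and S1 = 1 + 6 x + ... to the power
  -2.\<close>

lemma B_x_coeffs: "B_x $ 0 = 1" "B_x $ Suc 0 = - 7"
proof -
  have i0: "inverse S1 $ 0 = 1" by (simp add: S1_coeffs)
  have "S1 * inverse S1 = 1" by (rule inverse_mult_eq_1') (simp add: S1_coeffs)
  then have "(S1 * inverse S1) $ Suc 0 = 0" by simp
  then have i1: "inverse S1 $ Suc 0 = - 6" by (simp add: fps_mult_nth S1_coeffs)
  show "B_x $ 0 = 1" "B_x $ Suc 0 = - 7"
    using Q_coeffs Q1_coeffs i0 i1 by (simp_all add: B_x_def fps_mult_nth power2_eq_square power3_eq_cube)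
qed

lemma X_Q1: "fps_X * Q1 = Q_chi"
  by (rule fps_ext) (simp add: Q1_def Q_coeffs)

lemma X_S1: "fps_X * S1 = S_x"
  by (rule fps_ext) (simp add: S1_def S_x_coeffs)

lemma chi_Q: "chi * (1 - Q_chi) = 1"
  by (simp add: Q_chi_def chi_inverse)

lemma Q1_inverse: "Q1 * inverse Q1 = 1"
  by (rule inverse_mult_eq_1') (simp add: Q1_coeffs)

lemma S1_inverse: "S1 * inverse S1 = 1"
  by (rule inverse_mult_eq_1') (simp add: S1_coeffs)

lemma Y_B: "Y_x * B_x = fps_X"
proof -
  have "Y_x * B_x = fps_X * (chi * (1 - Q_chi)) * (S1 * inverse S1) ^ 2 * (Q1 * inverse Q1) ^ 3"
    by (simp only: Y_x_def B_x_def power_mult_distrib mult_ac)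
  then show ?thesis by (simp add: chi_Q S1_inverse Q1_inverse)
qed

text \<open>The relation hbar r = c - 1 as series in x; it identifies 1 + S with r.\<close>

lemma S_x_relation: "fps_X * chi ^ 2 * (1 + S_x) = chi - 1"
proof -
  have "fps_X * chi ^ 2 * (1 + S_x) = (fps_X * Q1) * chi * (chi * (1 - Q_chi))"
    by (simp add: S_x_def power2_eq_square mult_ac)
  also have "\<dots> = Q_chi * chi" by (simp add: X_Q1 chi_Q)
  also have "\<dots> = chi - 1" using chi_inverse by (simp add: Q_chi_def algebra_simps)
  finally show ?thesis .
qed

lemma Y_x_relation: "Y_x * (fps_X * chi ^ 2) * (1 + S_x) ^ 3 = S_x ^ 2"
proof -
  have "Y_x * (fps_X * chi ^ 2) * (1 + S_x) ^ 3 = (fps_X * S1) ^ 2 * (chi * (1 - Q_chi)) ^ 3 * (Q1 * inverse Q1) ^ 3"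
    by (simp add: Y_x_def S_x_def power2_eq_square power3_eq_cube mult_ac)
  then show ?thesis by (simp add: X_S1 chi_Q Q1_inverse)
qed

lemma z_vertex_eq_compose: "fps_X * z_vertex = S_x oo fps_inv Y_x"
proof -
  note hom = fps_compose_mult_distrib[OF x_ren_0] fps_compose_power[OF x_ren_0, symmetric] fps_compose_sub_distrib
    fps_compose_add_distrib x_ren_0
  have "(fps_X * chi ^ 2 * (1 + S_x)) oo x_ren = (chi - 1) oo x_ren" by (simp only: S_x_relation)
  then have "hren * (1 + (S_x oo x_ren)) = hren * r_ren"
    by (simp add: hom c_ren_def[symmetric] ren_relations)
  then have S: "1 + (S_x oo x_ren) = r_ren" using hren_nonzero by simp
  have "(Y_x * (fps_X * chi ^ 2) * (1 + S_x) ^ 3) oo x_ren = (S_x ^ 2) oo x_ren" by (simp only: Y_x_relation)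
  then have "(Y_x oo x_ren) * hren * r_ren ^ 3 = (S_x oo x_ren) ^ 2"
    by (simp add: hom c_ren_def[symmetric] ren_relations S)
  also have "S_x oo x_ren = r_ren - 1" using S by (simp add: algebra_simps)
  also have "(r_ren - 1) ^ 2 = fps_X * (hren * r_ren ^ 3)" by (simp only: ren_relations)
  finally have "(Y_x oo x_ren) * (hren * r_ren ^ 3) = fps_X * (hren * r_ren ^ 3)" by (simp only: mult.assoc)
  then have "Y_x oo x_ren = fps_X" using hren_nonzero r_ren_nonzero by simp
  moreover have "Y_x $ 0 = 0" "Y_x $ 1 \<noteq> 0"
    by (simp_all add: Y_x_def fps_mult_nth S1_coeffs Q1_coeffs power2_eq_square power3_eq_cube)
  ultimately have "x_ren = fps_inv Y_x" by (intro fps_inv_unique x_ren_0)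
  moreover have "S_x oo x_ren = r_ren - 1" using S by (simp add: algebra_simps)
  ultimately show ?thesis using ren_relations(4) by simp
qed

section \<open>The differential equation of the renormalisation constant\<close>

text \<open>The equation of chi is pulled back along x(hbar_ren) and its variables are eliminated in
  turn: x by x c^2 = h, c by c = 1 + h r, and finally h and r by h r^3 = X z^2 and r = 1 + X z,
  where X = hbar_ren.\<close>

lemma z_vertex_ode:
  defines "z \<equiv> z_vertex"
  shows "2 * fps_X * z ^ 3 + 2 * fps_X ^ 2 * z ^ 2 * fps_deriv z
     = (1 + fps_X * z - z) * (z - 2 * fps_X * z ^ 2 + (2 * fps_X - fps_X ^ 2 * z) * fps_deriv z)"
proof -
  define h r c x where "h = hren" and "r = r_ren" and "c = c_ren" and "x = x_ren"
  define h' r' c' x' z' where "h' = fps_deriv h" and "r' = fps_deriv r" and "c' = fps_deriv c" and "x' = fps_deriv x" and "z' = fps_deriv z"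
  note rel = ren_relations[folded h_def r_def c_def x_def z_def]
  have nz: "h \<noteq> 0" "r \<noteq> 0" "c \<noteq> 0"
    using hren_nonzero r_ren_nonzero c_ren_nonzero by (simp_all add: h_def r_def c_def)
  define e where "e = fps_deriv chi oo x"
  have x0: "x $ 0 = 0" by (simp add: x_def x_ren_0)
  have c'e: "c' = e * x'" unfolding c'_def c_def e_def c_ren_def x'_def x_def by (rule fps_compose_deriv) (rule x_ren_0)
  have "c = (1 + fps_X * chi + fps_const 2 * (fps_X * (fps_X * fps_deriv chi))) oo x"
    unfolding c_def c_ren_def x_def using chi_ode by (rule arg_cong)
  also have "\<dots> = 1 + x * c + fps_const 2 * (x * (x * e))"
    unfolding fps_compose_add_distrib fps_compose_mult_distrib[OF x_ren_0] fps_X_fps_compose_startby0[OF x_ren_0]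
      fps_compose_1 fps_const_compose e_def c_def c_ren_def x_def ..
  finally have "c = 1 + x * c + fps_const 2 * (x * (x * e))" .
  moreover have "fps_const 2 = (2 :: real fps)" by (simp add: numeral_fps_const)
  ultimately have e: "c = 1 + x * c + 2 * (x * (x * e))" by (simp only:)
  \<comment> \<open>Multiplication by x' makes chi' occur only through c' = chi'(x) x'.\<close>
  have e1: "(c - 1 - x * c) * x' = 2 * x ^ 2 * c'"
    using e c'e by algebra
  have "fps_deriv (x * c ^ 2) = h'" by (simp add: rel h'_def)
  then have d1: "x' * c ^ 2 + 2 * x * c * c' = h'"
    by (simp add: power2_eq_square x'_def c'_def algebra_simps)
  have "fps_deriv (h * r) = fps_deriv (c - 1)" by (simp only: rel)
  then have d2: "h' * r + h * r' = c'" by (simp add: h'_def r'_def c'_def algebra_simps)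
  have 1: "c * ((c ^ 2 - c - h) * h') = c * (2 * h * (c - 1) * c')"
    using e1 d1 rel(1) by algebra
  then have 2: "(c ^ 2 - c - h) * h' = 2 * h * (c - 1) * c'" using nz by simp
  have "h * ((r - 1 - h * r ^ 2) * h') = h * (2 * h ^ 2 * r * r')"
    using 2 rel(2) d2 by algebra
  then have 3: "(r - 1 - h * r ^ 2) * h' = 2 * h ^ 2 * r * r'" using nz by simp
  have rz: "r = 1 + fps_X * z" using rel(4) by (simp add: algebra_simps)
  have "fps_X * (h * r ^ 3) = fps_X * (fps_X * z ^ 2)" using rel(3) rz by algebra
  then have 4: "h * r ^ 3 = fps_X * z ^ 2" by simp
  have r': "r' = z + fps_X * z'" unfolding r'_def rz z'_def by (simp add: algebra_simps)
  have "fps_deriv (h * r ^ 3) = fps_deriv (fps_X * z ^ 2)" by (simp only: 4)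
  then have d4: "h' * r ^ 3 + 3 * h * r ^ 2 * r' = z ^ 2 + 2 * fps_X * z * z'"
    by (simp add: power2_eq_square power3_eq_cube h'_def r'_def z'_def algebra_simps)
  have z0: "z \<noteq> 0"
  proof
    assume "z = 0"
    then show False using 4 nz by simp
  qed
  \<comment> \<open>Powers of r are supplied so that h and h' appear only in h r^3 and h' r^4, both
    of which are expressible by z.\<close>
  have h4: "h' * r ^ 4 = r * (z ^ 2 + 2 * fps_X * z * z') - 3 * r' * (fps_X * z ^ 2)"
    using d4 4 by algebra
  have "2 * (h * r ^ 3) ^ 2 * r' = ((r - 1) * r - h * r ^ 3) * (h' * r ^ 4)"
    using 3 by algebra
  then have "2 * (fps_X * z ^ 2) ^ 2 * r' = (fps_X * z * r - fps_X * z ^ 2) * (r * (z ^ 2 + 2 * fps_X * z * z') - 3 * r' * (fps_X * z ^ 2))"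
    unfolding 4 h4 using rz by (simp add: algebra_simps)
  then have "(fps_X * z * z) * (2 * fps_X * z ^ 2 * r') = (fps_X * z * z) * ((r - z) * (r * (z + 2 * fps_X * z') - 3 * fps_X * z * r'))"
    by algebra
  then have "2 * fps_X * z ^ 2 * r' = (r - z) * (r * (z + 2 * fps_X * z') - 3 * fps_X * z * r')"
    using z0 by simp
  then show ?thesis unfolding z'_def[symmetric] using rz r' by algebra
qed

section \<open>The vertex renormalisation constant\<close>

text \<open>The coefficient (2 n - 1)!! is odf(n), which is exactly the scale function with k =
  2.\<close>

lemma expands_chi: "expands (fps_nth chi) (fps_X ^ 2)"
  unfolding expands_def
proof
  fix R
  have chi: "chi $ n = odf (int n)" for n by (simp add: chi_def odf_dfact)
  have d: "dominated 0 (\<lambda>n. odf (int n))" using dominated_odf[of 0] by simp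
  show "dominated (2 - int R) (\<lambda>n. chi $ n - (\<Sum>k<R. (fps_X ^ 2) $ k * odf (int n + 2 - int k)))"
  proof (cases "R \<le> 2")
    case True
    then have "(\<Sum>k<R. (fps_X ^ 2 :: real fps) $ k * odf (int n + 2 - int k)) = 0" for n
      by (intro sum.neutral) (auto simp: fps_X_power_nth)
    then show ?thesis unfolding chi using dominated_mono[OF d, of "2 - int R"] True by simp
  next
    case False
    have "(\<Sum>k<R. (fps_X ^ 2 :: real fps) $ k * odf (int n + 2 - int k)) = odf (int n)" for n
    proof -
      have "(\<Sum>k<R. (fps_X ^ 2 :: real fps) $ k * odf (int n + 2 - int k))
         = (\<Sum>k\<in>{2}. (fps_X ^ 2 :: real fps) $ k * odf (int n + 2 - int k))"
        by (rule sum.mono_neutral_right) (use False in \<open>auto simp: fps_X_power_nth\<close>)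
      then show ?thesis by (simp add: fps_X_power_nth)
    qed
    then show ?thesis unfolding chi by simp
  qed
qed

lemma expands_Q_chi: "expands (fps_nth Q_chi) (inverse chi ^ 2 * fps_X ^ 2)"
  using expands_fps_diff[OF expands_1 expands_inverse[OF expands_chi]] by (simp add: Q_chi_def)

lemma expands_Q1: "expands (fps_nth Q1) (fps_shift 1 (inverse chi ^ 2 * fps_X ^ 2))"
  unfolding Q1_def by (rule expands_shift[OF expands_Q_chi]) simp

text \<open>The division by x in \<open>Q1\<close> raises the order by one, so the leading
  coefficient sits at k = 1 and comes from \<open>Q1\<close> alone.\<close>

lemma expands_S_x:
  obtains c where "expands (fps_nth S_x) c" "c $ 0 = 0" "c $ 1 = 1"
proof -
  let ?q = "inverse chi ^ 2 * fps_X ^ 2" and ?q1 = "fps_shift 1 (inverse chi ^ 2 * fps_X ^ 2)"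
  have q: "?q $ 0 = 0" "?q $ 1 = 0" "?q $ 2 = 1"
    by (simp_all add: fps_X_power_mult_right_nth) (simp add: power2_eq_square)
  then have q1: "?q1 $ 0 = 0" "?q1 $ 1 = 1" by (simp_all add: numeral_2_eq_2)
  have "expands (fps_nth S_x) (Q1 * (0 - ?q) + (1 - Q_chi) * ?q1 - 0)"
    unfolding S_x_def by (intro expands_fps_diff expands_mult expands_1 expands_Q_chi expands_Q1)
  then show ?thesis
    by (rule that) (use q q1 Q_coeffs in \<open>simp_all add: fps_mult_nth[of _ _ 0] fps_mult_nth[of _ _ 1] fps_mult_nth[of _ _ "Suc 0"]\<close>)
qed

text \<open>Only \<open>S1\<close>, with its further division by x, reaches order k = 0; its
  coefficient 1 there is multiplied by the exponent -2.\<close>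

lemma expands_B_x:
  obtains c where "expands (fps_nth B_x) c" "c $ 0 = - 2"
proof -
  let ?q = "inverse chi ^ 2 * fps_X ^ 2" and ?q1 = "fps_shift 1 (inverse chi ^ 2 * fps_X ^ 2)"
  have q: "?q $ 0 = 0" by simp
  have q1: "?q1 $ 0 = 0" by (simp add: fps_X_power_mult_right_nth)
  obtain s where s: "expands (fps_nth S_x) s" "s $ 0 = 0" "s $ 1 = 1" by (rule expands_S_x)
  have s1: "expands (fps_nth S1) (fps_shift 1 s)" unfolding S1_def by (rule expands_shift[OF s(1,2)])
  define si where "si = - (inverse S1 ^ 2 * fps_shift 1 s)"
  have si: "expands (fps_nth (inverse S1)) si" unfolding si_def by (rule expands_inverse[OF s1]) (simp add: S1_coeffs)
  have i0: "inverse S1 $ 0 = 1" by (simp add: S1_coeffs)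
  have si0: "si $ 0 = - 1" using s(3) i0 by (simp add: si_def power2_eq_square)
  define p where "p = (1 - Q_chi) * (of_nat 3 * Q1 ^ (3 - 1) * ?q1) + Q1 ^ 3 * (0 - ?q)"
  have p: "expands (fps_nth ((1 - Q_chi) * Q1 ^ 3)) p"
    unfolding p_def by (intro expands_mult expands_fps_diff expands_power expands_1 expands_Q_chi expands_Q1)
  have p0: "p $ 0 = 0" using q q1 by (simp add: p_def)
  have "expands (fps_nth B_x) ((1 - Q_chi) * Q1 ^ 3 * (of_nat 2 * inverse S1 ^ (2 - 1) * si) + inverse S1 ^ 2 * p)"
    unfolding B_x_def by (intro expands_mult expands_power p si)
  then show ?thesis
    by (rule that) (simp add: p0 si0 S1_coeffs Q_coeffs Q1_coeffs power3_eq_cube)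
qed

text \<open>The two summands of the Lagrange formula are 1 from \<open>S_x\<close> and -2 from
  \<open>B_x\<close>; their sum -1 is the sign that disappears in 1 - z.\<close>

lemma expands_z_vertex:
  obtains d where "expands (fps_nth z_vertex) d" "d $ 0 = - exp (- 7 / 2)"
proof -
  obtain cS where S: "expands (fps_nth S_x) cS" "cS $ 0 = 0" "cS $ 1 = 1" by (rule expands_S_x)
  obtain cB where B: "expands (fps_nth B_x) cB" "cB $ 0 = - 2" by (rule expands_B_x)
  obtain d where d: "expands (\<lambda>n. (S_x oo fps_inv Y_x) $ Suc n) d"
    "d $ 0 = exp (B_x $ 1 / 2) * (cS $ 1 + S_x $ 1 * cB $ 0)"
    by (rule expands_lagrange[OF B(1) B_x_coeffs(1) S(1,2) Y_B])
  have "(\<lambda>n. (S_x oo fps_inv Y_x) $ Suc n) = fps_nth z_vertex"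
    unfolding z_vertex_eq_compose[symmetric] by (rule ext) simp
  then show ?thesis using d S(3) B(2) B_x_coeffs S_x_coeffs by (intro that[of d]) simp_all
qed

section \<open>Low-order coefficients of z and of its expansion\<close>

lemma fps_mult_nth_upto_6:
  fixes f g :: "real fps"
  shows "(f * g) $ 0 = f $ 0 * g $ 0"
    "(f * g) $ 1 = f $ 0 * g $ 1 + f $ 1 * g $ 0"
    "(f * g) $ 2 = f $ 0 * g $ 2 + f $ 1 * g $ 1 + f $ 2 * g $ 0"
    "(f * g) $ 3 = f $ 0 * g $ 3 + f $ 1 * g $ 2 + f $ 2 * g $ 1 + f $ 3 * g $ 0"
    "(f * g) $ 4 = f $ 0 * g $ 4 + f $ 1 * g $ 3 + f $ 2 * g $ 2 + f $ 3 * g $ 1 + f $ 4 * g $ 0"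
    "(f * g) $ 5 = f $ 0 * g $ 5 + f $ 1 * g $ 4 + f $ 2 * g $ 3 + f $ 3 * g $ 2 + f $ 4 * g $ 1 + f $ 5 * g $ 0"
    "(f * g) $ 6 = f $ 0 * g $ 6 + f $ 1 * g $ 5 + f $ 2 * g $ 4 + f $ 3 * g $ 3 + f $ 4 * g $ 2 + f $ 5 * g $ 1 + f $ 6 * g $ 0"
  by (simp_all add: fps_mult_nth numeral_eq_Suc)

text \<open>The weighted derivative to which \<open>expands_X2_deriv\<close> applies; z' will occur
  only in this combination.\<close>

definition w_z :: "real fps" where "w_z = fps_X ^ 2 * fps_deriv z_vertex"

lemma fps_X_power_2_mult_nth:
  fixes f :: "real fps"
  shows "(fps_X ^ 2 * f) $ 0 = 0" "(fps_X ^ 2 * f) $ 1 = 0" "(fps_X ^ 2 * f) $ 2 = f $ 0"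
    "(fps_X ^ 2 * f) $ 3 = f $ 1" "(fps_X ^ 2 * f) $ 4 = f $ 2" "(fps_X ^ 2 * f) $ 5 = f $ 3" "(fps_X ^ 2 * f) $ 6 = f $ 4"
  by (simp_all add: fps_X_power_mult_nth)

lemma fps_X_mult_nth_upto_6:
  fixes f :: "real fps"
  shows "(fps_X * f) $ 0 = 0" "(fps_X * f) $ 1 = f $ 0" "(fps_X * f) $ 2 = f $ 1"
    "(fps_X * f) $ 3 = f $ 2" "(fps_X * f) $ 4 = f $ 3" "(fps_X * f) $ 5 = f $ 4" "(fps_X * f) $ 6 = f $ 5"
  by simp_all

lemma w_z_nth:
  "w_z $ 0 = 0" "w_z $ 1 = 0" "w_z $ 2 = z_vertex $ 1" "w_z $ 3 = 2 * z_vertex $ 2"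
  "w_z $ 4 = 3 * z_vertex $ 3" "w_z $ 5 = 4 * z_vertex $ 4" "w_z $ 6 = 5 * z_vertex $ 5"
  unfolding w_z_def fps_X_power_2_mult_nth by (simp_all add: numeral_eq_Suc)

lemma z_vertex_nth_0: "z_vertex $ 0 = 1"
proof -
  have S: "S_x $ 0 = 0" "S_x $ 1 = 1" using S_x_coeffs by simp_all
  have "(fps_X * z_vertex) $ 1 = (\<Sum>i\<le>1. S_x $ i * (fps_inv Y_x ^ i) $ 1)"
    unfolding z_vertex_eq_compose by (simp add: fps_compose_nth atLeast0AtMost)
  moreover have "fps_inv Y_x $ 1 = 1"
    by (simp add: fps_inv_def Y_x_def S1_coeffs Q1_coeffs power2_eq_square power3_eq_cube fps_mult_nth)
  ultimately show ?thesis using S by simp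
qed

text \<open>The differential equation times \<open>fps_X\<close>: with this extra power every z' is
  absorbed into \<open>w_z\<close>.\<close>

lemma z_vertex_polynomial:
  "2 * (fps_X ^ 2 * (z_vertex ^ 2 * z_vertex)) + 2 * (fps_X * (z_vertex ^ 2 * w_z))
   = (1 + fps_X * z_vertex - z_vertex)
     * (fps_X * z_vertex - 2 * (fps_X ^ 2 * z_vertex ^ 2) + (2 - fps_X * z_vertex) * w_z)"
  using arg_cong[OF z_vertex_ode, of "\<lambda>f. fps_X * f"] unfolding w_z_def
  by (simp add: power2_eq_square power3_eq_cube algebra_simps)

lemma two_mult_nth: "(2 * f) $ n = 2 * f $ n" for f :: "real fps"
  by (simp add: numeral_fps_const)

lemma two_nth: "(2 :: real fps) $ 0 = 2" "(2 :: real fps) $ 1 = 0" "(2 :: real fps) $ 2 = 0" "(2 :: real fps) $ 3 = 0"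
  "(2 :: real fps) $ 4 = 0" "(2 :: real fps) $ 5 = 0" "(2 :: real fps) $ 6 = 0"
  by (simp_all add: numeral_fps_const)

lemma one_nth: "(1 :: real fps) $ 0 = 1" "(1 :: real fps) $ 1 = 0" "(1 :: real fps) $ 2 = 0" "(1 :: real fps) $ 3 = 0"
  "(1 :: real fps) $ 4 = 0" "(1 :: real fps) $ 5 = 0" "(1 :: real fps) $ 6 = 0"
  by simp_all

lemma z_vertex_coeffs:
  "z_vertex $ 0 = 1" "z_vertex $ 1 = - 1" "z_vertex $ 2 = - 3" "z_vertex $ 3 = - 13"
  "z_vertex $ 4 = - 147" "z_vertex $ 5 = - 1965"
proof -
  note nths = fps_add_nth fps_sub_nth two_mult_nth two_nth one_nth fps_X_power_2_mult_nth fps_X_mult_nth_upto_6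
    fps_mult_nth_upto_6 w_z_nth power2_eq_square[of z_vertex]
  note eq = z_vertex_polynomial
  show 0: "z_vertex $ 0 = 1" by (rule z_vertex_nth_0)
  show 1: "z_vertex $ 1 = - 1" using arg_cong[OF eq, of "\<lambda>f. f $ 2"] unfolding nths 0 by simp
  show 2: "z_vertex $ 2 = - 3" using arg_cong[OF eq, of "\<lambda>f. f $ 3"] unfolding nths 0 1 by simp
  show 3: "z_vertex $ 3 = - 13" using arg_cong[OF eq, of "\<lambda>f. f $ 4"] unfolding nths 0 1 2 by simp
  show 4: "z_vertex $ 4 = - 147" using arg_cong[OF eq, of "\<lambda>f. f $ 5"] unfolding nths 0 1 2 3 by simp
  show 5: "z_vertex $ 5 = - 1965" using arg_cong[OF eq, of "\<lambda>f. f $ 6"] unfolding nths 0 1 2 3 4 by simp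
qed

text \<open>The product rule on both sides of the polynomial equation gives an equation linear in
  \<open>d\<close>. At order n the contributions of d_(n-1) cancel, so d_k is read off at order k +
  2, as a multiple of d_0.\<close>

lemma expands_z_vertex_coeffs:
  assumes "expands (fps_nth z_vertex) d"
  shows "d $ 1 = - 15 / 2 * d $ 0" "d $ 2 = - 97 / 8 * d $ 0" "d $ 3 = - 1935 / 16 * d $ 0"
proof -
  define dw where "dw = fps_const (1/2) * d + fps_X ^ 2 * fps_deriv d - fps_const (5/2) * (fps_X * d)"
  have ew: "expands (fps_nth w_z) dw"
    unfolding dw_def w_z_def by (rule expands_X2_deriv[OF assms])
  have dw: "dw $ 0 = d $ 0 / 2" "dw $ 1 = d $ 1 / 2 - 5 / 2 * d $ 0" "dw $ 2 = d $ 2 / 2 - 3 / 2 * d $ 1"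
    "dw $ 3 = d $ 3 / 2 - d $ 2 / 2" "dw $ 4 = d $ 4 / 2 + d $ 3 / 2"
    unfolding dw_def fps_sub_nth fps_add_nth fps_mult_left_const_nth fps_X_power_2_mult_nth fps_X_mult_nth_upto_6
    by (simp_all add: numeral_eq_Suc)
  note ez = assms
  note zz = expands_mult[OF ez ez]
  note two = expands_numeral[of "num.Bit0 num.One"]
  note X2 = expands_X_power[of 2]
  note L = expands_fps_add[OF expands_mult[OF two expands_mult[OF X2 expands_mult[OF zz ez]]]
      expands_mult[OF two expands_mult[OF expands_X expands_mult[OF zz ew]]]]
  note R = expands_mult[OF
      expands_fps_diff[OF expands_fps_add[OF expands_1 expands_mult[OF expands_X ez]] ez]
      expands_fps_add[OF expands_fps_diff[OF expands_mult[OF expands_X ez] expands_mult[OF two expands_mult[OF X2 zz]]]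
        expands_mult[OF expands_fps_diff[OF two expands_mult[OF expands_X ez]] ew]]]
  note eq = expands_unique[OF L R[folded z_vertex_polynomial[unfolded power2_eq_square[of z_vertex]]]]
  note nths = fps_add_nth fps_sub_nth two_mult_nth two_nth one_nth fps_X_power_2_mult_nth fps_X_mult_nth_upto_6
    fps_mult_nth_upto_6 w_z_nth z_vertex_coeffs dw
  show 1: "d $ 1 = - 15 / 2 * d $ 0"
    using arg_cong[OF eq, of "\<lambda>f. f $ 3"] unfolding nths mult_zero_right add_0_right by simp
  show 2: "d $ 2 = - 97 / 8 * d $ 0"
    using arg_cong[OF eq, of "\<lambda>f. f $ 4"] unfolding nths 1 mult_zero_right add_0_right by simp
  show 3: "d $ 3 = - 1935 / 16 * d $ 0"
    using arg_cong[OF eq, of "\<lambda>f. f $ 5"] unfolding nths 1 2 mult_zero_right add_0_right by simp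
qed

section \<open>Translation into double factorials\<close>

lemma odf_falling: "odf (int n + 2 - int k) * (\<Prod>i<k. 2 * real n + 3 - 2 * real i) = odf (int n + 2)"
proof (induction k)
  case (Suc k)
  have "odf (int n + 2 - int k) = (2 * real n + 3 - 2 * real k) * odf (int n + 2 - int (Suc k))"
    using odf_plus_one[of "int n + 2 - int (Suc k)"] by (simp add: algebra_simps)
  then show ?case using Suc by (simp add: mult_ac)
qed simp

theorem mainTheorem15:
  shows "\<exists>c :: nat \<Rightarrow> real.
    c 0 = 1 \<and> c 1 = - 15 / 2 \<and> c 2 = - 97 / 8 \<and> c 3 = - 1935 / 16 \<and>
    (\<forall>R. (\<lambda>n. (1 - z_vertex) $ n
             - exp (- 7 / 2) * (\<Sum>k<R. c k * real (dfact (2 * n + 3 - 2 * k))))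
          \<in> O(\<lambda>n. real (dfact (2 * n + 3 - 2 * R)))) \<and>
    (\<forall>R. (\<lambda>n. (1 - z_vertex) $ n / (exp (- 7 / 2) * real (dfact (2 * n + 3)))
             - (\<Sum>k<R. c k / (\<Prod>i<k. 2 * real n + 3 - 2 * real i)))
          \<in> O(\<lambda>n. 1 / (\<Prod>i<R. 2 * real n + 3 - 2 * real i)))"
proof -
  obtain d where d: "expands (fps_nth z_vertex) d" "d $ 0 = - exp (- 7 / 2)" by (rule expands_z_vertex)
  define E :: real where "E = exp (- 7 / 2)"
  have E: "E > 0" by (simp add: E_def)
  define c where "c k = - (d $ k) / E" for k
  have dc: "d $ k = - E * c k" for k using E by (simp add: c_def)
  have "d $ 0 = - E" using d(2) by (simp only: E_def)
  then have cs: "c 0 = 1" "c 1 = - 15 / 2" "c 2 = - 97 / 8" "c 3 = - 1935 / 16"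
    using expands_z_vertex_coeffs[OF d(1)] E by (simp_all add: c_def)
  have odf: "real (dfact (2 * n + 3 - 2 * k)) = odf (int n + 2 - int k)" if "k \<le> n" for n k
  proof -
    have "2 * (n + 2 - k) - 1 = 2 * n + 3 - 2 * k" "int (n + 2 - k) = int n + 2 - int k"
      using that by (auto simp: of_nat_diff)
    then show ?thesis using odf_dfact[of "n + 2 - k"] by simp
  qed
  \<comment> \<open>For n > R the natural-number differences in the double factorials are not
    truncated, and n \<ge> 1 makes the summand 1 of 1 - z contribute nothing.\<close>
  have bound: "\<exists>K. \<forall>n. n \<ge> Suc R \<longrightarrow>
     \<bar>(1 - z_vertex) $ n - E * (\<Sum>k<R. c k * odf (int n + 2 - int k))\<bar> \<le> K * \<bar>odf (int n + 2 - int R)\<bar>" for R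
  proof -
    have "dominated (2 - int R) (\<lambda>n. z_vertex $ n - (\<Sum>k<R. d $ k * odf (int n + 2 - int k)))"
      by (rule expandsD[OF d(1)])
    then obtain K where K: "\<And>n. \<bar>z_vertex $ n - (\<Sum>k<R. d $ k * odf (int n + 2 - int k))\<bar> \<le> K * \<bar>odf (int n + (2 - int R))\<bar>"
      unfolding dominated_def by blast
    have "\<bar>(1 - z_vertex) $ n - E * (\<Sum>k<R. c k * odf (int n + 2 - int k))\<bar> \<le> K * \<bar>odf (int n + 2 - int R)\<bar>"
      if n: "n \<ge> Suc R" for n
    proof -
      have "(1 - z_vertex) $ n - E * (\<Sum>k<R. c k * odf (int n + 2 - int k))
         = - (z_vertex $ n - (\<Sum>k<R. d $ k * odf (int n + 2 - int k)))"
        using n by (simp add: dc sum_distrib_left sum_negf mult.assoc)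
      then show ?thesis using K[of n] by (simp only: abs_minus_cancel add_diff_eq)
    qed
    then show ?thesis by blast
  qed
  have 1: "(\<lambda>n. (1 - z_vertex) $ n - E * (\<Sum>k<R. c k * real (dfact (2 * n + 3 - 2 * k))))
          \<in> O(\<lambda>n. real (dfact (2 * n + 3 - 2 * R)))" for R
  proof -
    obtain K where K: "\<And>n. n \<ge> Suc R \<Longrightarrow>
      \<bar>(1 - z_vertex) $ n - E * (\<Sum>k<R. c k * odf (int n + 2 - int k))\<bar> \<le> K * \<bar>odf (int n + 2 - int R)\<bar>"
      using bound[of R] by blast
    show ?thesis
    proof (rule bigoI[of _ K])
      show "\<forall>\<^sub>F n in sequentially. norm ((1 - z_vertex) $ n - E * (\<Sum>k<R. c k * real (dfact (2 * n + 3 - 2 * k))))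
         \<le> K * norm (real (dfact (2 * n + 3 - 2 * R)))"
        using eventually_ge_at_top[of "Suc R"]
      proof eventually_elim
        case (elim n)
        have "(\<Sum>k<R. c k * real (dfact (2 * n + 3 - 2 * k))) = (\<Sum>k<R. c k * odf (int n + 2 - int k))"
          by (intro sum.cong refl) (use elim in \<open>simp add: odf\<close>)
        then show ?case using K[OF elim] odf[of R n] elim by simp
      qed
    qed
  qed
  have 2: "(\<lambda>n. (1 - z_vertex) $ n / (E * real (dfact (2 * n + 3)))
             - (\<Sum>k<R. c k / (\<Prod>i<k. 2 * real n + 3 - 2 * real i)))
          \<in> O(\<lambda>n. 1 / (\<Prod>i<R. 2 * real n + 3 - 2 * real i))" for R
  proof -
    obtain K where K: "\<And>n. n \<ge> Suc R \<Longrightarrow>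
      \<bar>(1 - z_vertex) $ n - E * (\<Sum>k<R. c k * odf (int n + 2 - int k))\<bar> \<le> K * \<bar>odf (int n + 2 - int R)\<bar>"
      using bound[of R] by blast
    show ?thesis
    proof (rule bigoI[of _ "K / E"])
      show "\<forall>\<^sub>F n in sequentially. norm ((1 - z_vertex) $ n / (E * real (dfact (2 * n + 3)))
             - (\<Sum>k<R. c k / (\<Prod>i<k. 2 * real n + 3 - 2 * real i)))
         \<le> K / E * norm (1 / (\<Prod>i<R. 2 * real n + 3 - 2 * real i))"
        using eventually_ge_at_top[of "Suc R"]
      proof eventually_elim
        case (elim n)
        define D where "D = odf (int n + 2)"
        have D: "D > 0" unfolding D_def by (rule odf_pos) simp
        have inv: "1 / (\<Prod>i<k. 2 * real n + 3 - 2 * real i) = odf (int n + 2 - int k) / D" for k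
        proof -
          have "1 / p = q / e" if "q * p = e" "e > 0" for p q e :: real
            using that by (auto simp: field_simps)
          then show ?thesis using odf_falling D unfolding D_def by blast
        qed
        have "(\<Sum>k<R. c k / (\<Prod>i<k. 2 * real n + 3 - 2 * real i)) = (\<Sum>k<R. c k * odf (int n + 2 - int k)) / D"
          unfolding sum_divide_distrib
        proof (intro sum.cong refl)
          fix k
          show "c k / (\<Prod>i<k. 2 * real n + 3 - 2 * real i) = c k * odf (int n + 2 - int k) / D"
            using arg_cong[OF inv[of k], of "\<lambda>x. c k * x"] by simp
        qed
        moreover have "real (dfact (2 * n + 3)) = D" using odf[of 0 n] by (simp add: D_def)
        ultimately have "(1 - z_vertex) $ n / (E * real (dfact (2 * n + 3))) - (\<Sum>k<R. c k / (\<Prod>i<k. 2 * real n + 3 - 2 * real i))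
           = ((1 - z_vertex) $ n - E * (\<Sum>k<R. c k * odf (int n + 2 - int k))) / (E * D)"
          using E D by (simp add: field_simps)
        also have "norm \<dots> \<le> K * \<bar>odf (int n + 2 - int R)\<bar> / (E * D)"
          using K[OF elim] E D by (simp add: abs_mult divide_right_mono)
        also have "\<dots> = K / E * norm (1 / (\<Prod>i<R. 2 * real n + 3 - 2 * real i))"
          unfolding inv using D by (simp add: abs_mult)
        finally show ?case .
      qed
    qed
  qed
  show ?thesis using cs 1 2 unfolding E_def by blast
qed

end
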